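(* The generating function $\sum_{\sigma} x^{|\sigma|}$, where $\sigma$ ranges over simple permutations of length at least $4$ that avoid $2341$, $4123$ and $3412$, equals $$\frac{2(x^4+x^6+x^9)}{(1-x^2)(1-2x+x^3-x^4)}.$$
   Context: A permutation $\pi$ avoids $\tau$ if $\pi$ has no subsequence order-isomorphic to $\tau$. An interval of $\pi$ is a contiguous subsequence whose values form a set of consecutive integers; $\pi$ is simple if its only intervals are itself and singletons. $|\sigma|$ denotes the length of $\sigma$. *)

theory Defs
  imports
    "HOL-Combinatorics.Multiset_Permutations"
    "HOL-Library.Sublist"
    "HOL-Computational_Algebra.Formal_Power_Series"
begin

text \<open>
  A permutation of length \<open>n\<close> is given in one-line notation, as a list of the numbers
  \<open>1, \<dots>, n\<close>.
\<close>

definition is_perm :: "nat list \<Rightarrow> bool" where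
  "is_perm p \<longleftrightarrow> p \<in> permutations_of_set {1..length p}"

definition order_isomorphic :: "nat list \<Rightarrow> nat list \<Rightarrow> bool" where
  "order_isomorphic xs ys \<longleftrightarrow> length xs = length ys \<and>
     (\<forall>i<length xs. \<forall>j<length xs. xs ! i < xs ! j \<longleftrightarrow> ys ! i < ys ! j)"

definition avoids :: "nat list \<Rightarrow> nat list \<Rightarrow> bool" where
  "avoids p t \<longleftrightarrow> \<not> (\<exists>s. subseq s p \<and> order_isomorphic s t)"

text \<open>
  In the library, \<open>subseq\<close> is the relation for arbitrary subsequences and \<open>sublist\<close> the one for
  contiguous subsequences. Intervals are nonempty. As the entries of a permutation are distinct,
  a contiguous subsequence determines its position.
\<close>

definition is_interval_of :: "nat list \<Rightarrow> nat list \<Rightarrow> bool" where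
  "is_interval_of s p \<longleftrightarrow> s \<noteq> [] \<and> sublist s p \<and> (\<exists>a b. set s = {a..b})"

definition simple_perm :: "nat list \<Rightarrow> bool" where
  "simple_perm p \<longleftrightarrow> is_perm p \<and> (\<forall>s. is_interval_of s p \<longrightarrow> s = p \<or> length s = 1)"

text \<open>
  The formal power series \<open>\<Sum>p\<in>C. x ^ length p\<close>, for a set \<open>C\<close> that contains only finitely many
  lists of each length (which holds for every set of permutations, by the lemma below).
\<close>

definition length_gf :: "'a list set \<Rightarrow> rat fps" where
  "length_gf C = Abs_fps (\<lambda>n. of_nat (card {p \<in> C. length p = n}))"

lemma finite_perms_of_length: "finite {p. is_perm p \<and> length p = n}"
  by (rule finite_subset[of _ "permutations_of_set {1..n}"]) (auto simp: is_perm_def)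

end

theory Submission
  imports Defs "HOL-Library.Infinite_Set"
begin

text \<open>
  The inversion graphs of \<open>2341\<close> and \<open>4123\<close> are claws and that of \<open>3412\<close> is a 4-cycle. Permutation graphs without
  induced claws and 4-cycles are unit interval graphs; if the permutation is simple, the interval order is the
  order of its entries by the sum of position and value. So a simple permutation of the class amounts to a
  unit interval graph without twins and universal vertices, together with signs that tell for each edge which
  of its ends is the upper left one.

  The signs force such a graph to be a chain of cliques. Two consecutive cliques either share a vertex and have
  opposite signs, or they have the same sign and are linked by a half graph on \<open>t + t\<close> vertices with \<open>t \<ge> 2\<close>, and
  in each clique at most one vertex does not take part in the links. Adding a link together with an unlinked
  vertex (or none) takes \<open>1\<close> or \<open>2\<close> vertices in the first case and \<open>2 * t\<close> or \<open>2 * t + 1\<close> vertices in the second, so that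
  chains correspond to compositions without parts equal to \<open>3\<close>. This gives the factor
  \<open>(1 - x) * (1 - x - x ^ 2) - x ^ 4 = 1 - 2 * x + x ^ 3 - x ^ 4\<close> of the denominator. The chains with
  a single link may have twins or a universal vertex and must be corrected for; the corrections depend
  only on the parity of the length and account for the factor \<open>1 - x ^ 2\<close>.
\<close>

section \<open>Signed unit interval graphs\<close>

text \<open>All signs are forced by one rule: if \<open>i < j < k\<close>, \<open>j\<close> is
  adjacent to \<open>i\<close> and to \<open>k\<close>, and \<open>i\<close> is not adjacent to
  \<open>k\<close>, then \<open>c j k = - c i j\<close>. Hence two edges into \<open>j\<close> from
  earlier vertices have the same sign as soon as \<open>j\<close> has a later neighbour that neither
  of these vertices sees. Twin-freeness supplies such neighbours, and almost every sign below is
  found in this way.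

  Chains are peeled from the left, and one kind of remainder is not enough: removing the vertex in
  front of a half graph may leave the last vertex of the first half and the first vertex of the
  second half as twins. So two classes are counted together, one of them tolerating this single
  pair. With \<open>q\<close> and \<open>h\<close> for their sizes,
  \<open>q n = q (n - 1) + q (n - 2) + h (n - 1)\<close> and
  \<open>h (n + 1) = h n + q (n - 2)\<close>. For each sign of the edge from \<open>0\<close> to
  \<open>1\<close> there are \<open>q n + h n\<close> candidates; those with a universal vertex are
  one half start for every \<open>n\<close> and one further graph for odd \<open>n\<close>.\<close>

text \<open>
  The vertices are \<open>0, \<dots>, n - 1\<close>, and \<open>r i\<close> is the last neighbour of \<open>i\<close> (or \<open>i\<close> itself). For \<open>i < j\<close>, the
  value \<open>c i j\<close> is \<open>0\<close> if \<open>i\<close> lies to the left of and below \<open>j\<close> in the permutation, \<open>1\<close> if \<open>i\<close> lies to the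
  left of and above \<open>j\<close>, and \<open>-1\<close> if it lies to the right of and below \<open>j\<close>. The last two conditions on \<open>c\<close> say
  that the positions and the values are linearly ordered. Beyond the vertices, \<open>r\<close> and \<open>c\<close> are \<open>0\<close>, so
  that a graph is determined by the pair \<open>(r, c)\<close>.
\<close>

definition sgraph :: "nat \<Rightarrow> (nat \<Rightarrow> nat) \<Rightarrow> (nat \<Rightarrow> nat \<Rightarrow> int) \<Rightarrow> bool" where
  "sgraph n r c \<longleftrightarrow> n > 0 \<and> (\<forall>i<n. r i < n) \<and> (\<forall>i\<ge>n. r i = 0) \<and>
     (\<forall>i. Suc i < n \<longrightarrow> i < r i \<and> r i \<le> r (Suc i)) \<and>
     (\<forall>i j. c i j \<in> {-1, 0, 1} \<and> (c i j \<noteq> 0 \<longleftrightarrow> i < j \<and> j \<le> r i)) \<and>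
     (\<forall>i j k. i < j \<longrightarrow> j \<le> r i \<longrightarrow> r i < k \<longrightarrow> k \<le> r j \<longrightarrow> c j k = - c i j) \<and>
     (\<forall>i j k. i < j \<longrightarrow> j < k \<longrightarrow> k \<le> r i \<longrightarrow> c i j = c j k \<longrightarrow> c i k = c i j)"

text \<open>
  Two vertices with the same closed neighbourhood can be taken to be consecutive; the two alternatives
  are a later and an earlier vertex that separates \<open>i\<close> from \<open>i + 1\<close>.
\<close>

definition twinfree :: "nat \<Rightarrow> (nat \<Rightarrow> nat) \<Rightarrow> bool" where
  "twinfree n r \<longleftrightarrow> (\<forall>i. Suc i < n \<longrightarrow> r i < r (Suc i) \<or> (\<exists>k<i. r k = i))"

lemma sgraphD:
  assumes "sgraph n r c"
  shows "n > 0" "i < n \<Longrightarrow> r i < n" "n \<le> i \<Longrightarrow> r i = 0" "Suc i < n \<Longrightarrow> i < r i"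
    "c i j \<in> {-1, 0, 1}" "c i j \<noteq> 0 \<longleftrightarrow> i < j \<and> j \<le> r i"
    "i < j \<Longrightarrow> j \<le> r i \<Longrightarrow> r i < k \<Longrightarrow> k \<le> r j \<Longrightarrow> c j k = - c i j"
    "i < j \<Longrightarrow> j < k \<Longrightarrow> k \<le> r i \<Longrightarrow> c i j = c j k \<Longrightarrow> c i k = c i j"
proof -
  note a = assms[unfolded sgraph_def]
  show "n > 0" using a by (elim conjE)
  show "i < n \<Longrightarrow> r i < n" using a by (elim conjE) blast
  show "n \<le> i \<Longrightarrow> r i = 0" using a by (elim conjE) blast
  show "Suc i < n \<Longrightarrow> i < r i" using a by (elim conjE) blast
  show "c i j \<in> {-1, 0, 1}" using a by (elim conjE) metis
  show "c i j \<noteq> 0 \<longleftrightarrow> i < j \<and> j \<le> r i" using a by (elim conjE) metis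
  show "i < j \<Longrightarrow> j \<le> r i \<Longrightarrow> r i < k \<Longrightarrow> k \<le> r j \<Longrightarrow> c j k = - c i j"
    using a by (elim conjE) metis
  show "i < j \<Longrightarrow> j < k \<Longrightarrow> k \<le> r i \<Longrightarrow> c i j = c j k \<Longrightarrow> c i k = c i j"
    using a by (elim conjE) metis
qed

lemma sgraph_mono:
  assumes "sgraph n r c" "i \<le> j" "j < n"
  shows "r i \<le> r j"
  using assms(2,3)
proof (induction j rule: dec_induct)
  case (step j)
  then show ?case using assms(1) unfolding sgraph_def by (meson Suc_lessD order_trans)
qed simp

lemma sgraph_ge:
  assumes "sgraph n r c" "i < n"
  shows "i \<le> r i"
proof (cases "Suc i < n")
  case False
  show ?thesis
  proof (cases i)
    case (Suc m)
    then have "m < r m" "r m \<le> r i" using assms unfolding sgraph_def by auto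
    then show ?thesis using Suc by simp
  qed simp
qed (use sgraphD(4)[OF assms(1)] in \<open>auto simp: less_imp_le\<close>)

text \<open>All conditions on \<open>r\<close> and \<open>c\<close> only look to the right, so they
  survive the deletion of an initial segment. Twin-freeness does not, because a separating vertex
  may be deleted; it has to be restored at each cut.\<close>

lemma sgraph_suffix:
  assumes "sgraph n r c" "k < n"
  shows "sgraph (n - k) (\<lambda>i. r (i + k) - k) (\<lambda>i j. c (i + k) (j + k))"
  unfolding sgraph_def
proof (intro conjI allI impI)
  fix i assume "Suc i < n - k"
  then show "i < r (i + k) - k" using sgraphD(4)[OF assms(1), of "i + k"] by linarith
next
  fix i assume "Suc i < n - k"
  then show "r (i + k) - k \<le> r (Suc i + k) - k" using sgraph_mono[OF assms(1), of "i + k" "Suc i + k"]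
      by (simp add: diff_le_mono)
next
  fix i j k' assume *: "i < j" "j \<le> r (i + k) - k" "r (i + k) - k < k'" "k' \<le> r (j + k) - k"
  then show "c (j + k) (k' + k) = - c (i + k) (j + k)"
    by (intro sgraphD(7)[OF assms(1)]) auto
next
  fix i j k' assume *: "i < j" "j < k'" "k' \<le> r (i + k) - k" "c (i + k) (j + k) = c (j + k) (k' + k)"
  then show "c (i + k) (k' + k) = c (i + k) (j + k)"
    by (intro sgraphD(8)[OF assms(1)]) auto
next
  fix i j
  show "c (i + k) (j + k) \<in> {-1, 0, 1}" by (rule sgraphD(5)[OF assms(1)])
  show "c (i + k) (j + k) \<noteq> 0 \<longleftrightarrow> i < j \<and> j \<le> r (i + k) - k"
    using sgraphD(6)[OF assms(1), of "i + k" "j + k"] sgraph_ge[OF assms(1), of "i + k"] 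
      sgraphD(3)[OF assms(1), of "i + k"] by auto
next
  fix i assume "i < n - k"
  then have "i + k < n" by simp
  then show "r (i + k) - k < n - k"
    using sgraphD(2)[OF assms(1), of "i + k"] sgraph_ge[OF assms(1), of "i + k"] by simp
next
  fix i assume "n - k \<le> i"
  then show "r (i + k) - k = 0" using sgraphD(3)[OF assms(1), of "i + k"] by simp
qed (use assms in auto)

text \<open>
  In \<open>mono_graphs\<close> all edges at the first vertex, hence in the first clique, have the same sign.
  In \<open>half_start\<close> the first \<open>t\<close> vertices form a clique of one sign, and all edges that leave it
  have the other sign. Here the vertices \<open>t - 1\<close> and \<open>t\<close> may be twins.
\<close>

definition mono_graphs :: "nat \<Rightarrow> int \<Rightarrow> ((nat \<Rightarrow> nat) \<times> (nat \<Rightarrow> nat \<Rightarrow> int)) set" where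
  "mono_graphs n e = {(r, c). sgraph n r c \<and> twinfree n r \<and> (\<forall>j. 0 < j \<longrightarrow> j \<le> r 0 \<longrightarrow> c 0 j = e)}"

definition half_start :: "nat \<Rightarrow> int \<Rightarrow> nat \<Rightarrow> (nat \<Rightarrow> nat) \<Rightarrow> (nat \<Rightarrow> nat \<Rightarrow> int) \<Rightarrow> bool" where
  "half_start n e t r c \<longleftrightarrow> sgraph n r c \<and> 2 \<le> t \<and> t \<le> r 0 \<and>
     (\<forall>i. Suc i < t \<longrightarrow> r i < r (Suc i)) \<and>
     (\<forall>i\<ge>t. Suc i < n \<longrightarrow> r i < r (Suc i) \<or> (\<exists>k<i. r k = i)) \<and>
     (\<forall>i<t. \<forall>j. i < j \<longrightarrow> j \<le> r i \<longrightarrow> c i j = (if j < t then e else - e))"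

definition half_graphs :: "nat \<Rightarrow> int \<Rightarrow> ((nat \<Rightarrow> nat) \<times> (nat \<Rightarrow> nat \<Rightarrow> int)) set" where
  "half_graphs n e = {(r, c). \<exists>t. half_start n e t r c}"

section \<open>Rigidity of a half-graph link\<close>

lemma strict_chain:
  assumes "\<And>i. Suc i < t \<Longrightarrow> r i < (r (Suc i) :: nat)" "i \<le> j" "j < t"
  shows "r i + (j - i) \<le> r j"
  using assms(2,3)
proof (induction j rule: dec_induct)
  case (step m) then show ?case using assms(1)[of m] by simp
qed simp

text \<open>The first clique \<open>{0..<t}\<close> is attached to the next one, \<open>{t..<2*t}\<close>, by a half graph.\<close>

lemma half_start_facts:
  assumes "half_start n e t r c" and e: "e = 1 \<or> e = -1"
  shows "i < t \<Longrightarrow> r i = t + i"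
    and "2 * t \<le> n"
    and "t \<le> i \<Longrightarrow> i < 2 * t \<Longrightarrow> r i = r t"
    and "t \<le> i \<Longrightarrow> i < 2 * t \<Longrightarrow> i < j \<Longrightarrow> j \<le> r t \<Longrightarrow> c i j = e"
proof -
  have g: "sgraph n r c" and t: "2 \<le> t" "t \<le> r 0"
    and inc: "\<And>i. Suc i < t \<Longrightarrow> r i < r (Suc i)"
    and tw: "\<And>i. t \<le> i \<Longrightarrow> Suc i < n \<Longrightarrow> r i < r (Suc i) \<or> (\<exists>k<i. r k = i)"
    and ce: "\<And>i j. i < t \<Longrightarrow> i < j \<Longrightarrow> j \<le> r i \<Longrightarrow> c i j = (if j < t then e else - e)"
    using assms(1) unfolding half_start_def by blast+
  note D = sgraphD[OF g]
  have tn: "t < n" using D(2)[of 0] D(1) t by simp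
  have chain: "r i + (j - i) \<le> r j" if "i \<le> j" "j < t" for i j
    using strict_chain[of t r i j] inc that by blast
  have ry: "t \<le> r i" "r i < n" if "i < t" for i
    using chain[of 0 i] that t D(2)[of i] tn by auto
  define z where "z = r (t - 1)"
  have z: "z < n" "t \<le> z" using ry[of "t - 1"] t z_def by auto
  have zge: "r i \<le> z" if "i < t" for i
    using sgraph_mono[OF g, of i "t - 1"] that z_def tn by simp
  have adjY: "k' \<le> r y" if "t \<le> y" "y \<le> k'" "k' \<le> z" for y k'
    using sgraph_mono[OF g, of "t - 1" y] that z z_def by linarith
  \<comment> \<open>Vertex \<open>t - 1\<close> sees all of \<open>{t..z}\<close> with sign
    \<open>- e\<close> and nothing beyond, so alternation turns the sign.\<close>
  have out: "c y k = e" if "t \<le> y" "y \<le> z" "z < k" "k \<le> r y" for y k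
    using D(7)[of "t - 1" y k] ce[of "t - 1" y] that t z_def by auto
  have sep: "c y y' = e" if "i < t" "t \<le> y" "y \<le> r i" "r i < y'" "y' \<le> z" for i y y'
  proof -
    have "c y y' = - c i y"
      using that t adjY[of y y'] by (intro D(7)) auto
    then show ?thesis using ce[of i y] that by auto
  qed
  \<comment> \<open>Consecutive vertices of the second clique are separated by the first clique.
    Otherwise twin-freeness separates them on the right by some \<open>k\<close>, which gives the
    edge between them the sign \<open>- e\<close>; a third vertex \<open>w\<close> of the second
    clique then contradicts this.\<close>
  have strictY: "\<exists>i<t. r i = y" if y: "t \<le> y" "y < z" for y
  proof (rule ccontr)
    assume no: "\<not> ?thesis"
    have "\<not> (\<exists>k<y. r k = y)"
    proof
      assume "\<exists>k<y. r k = y"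
      then obtain k where k: "k < y" "r k = y" by blast
      then have "t \<le> k" using no not_le by blast
      then have "z \<le> r k" using adjY[of k z] k y by simp
      then show False using k y by simp
    qed
    then have lt: "r y < r (Suc y)" using tw[of y] y z by auto
    define k where "k = r (Suc y)"
    have kz: "z < k" using lt adjY[of y z] y k_def by simp
    have yk: "r y < k" using lt k_def by simp
    have s1: "c y (Suc y) = - e"
    proof -
      have "c (Suc y) k = - c y (Suc y)"
        using y kz yk adjY[of y "Suc y"] k_def by (intro D(7)) auto
      moreover have "c (Suc y) k = e" using out[of "Suc y" k] y kz k_def by simp
      ultimately show ?thesis by simp
    qed
    \<comment> \<open>The first vertex that sees \<open>y\<close>. If it has a predecessor,
      \<open>w\<close> is the last neighbour of that predecessor; otherwise \<open>w\<close> is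
      taken to the right of \<open>y + 1\<close>.\<close>
    define i where "i = (LEAST i. y \<le> r i)"
    have i1: "y \<le> r i" unfolding i_def by (rule LeastI[of _ "t - 1"]) (use y z_def in simp)
    have i2: "i \<le> t - 1" unfolding i_def by (rule Least_le) (use y z_def in simp)
    have it: "i < t" using i2 t by simp
    have i3: "Suc y \<le> r i" using i1 no it by (metis le_neq_implies_less Suc_leI)
    show False
    proof (cases i)
      case (Suc m)
      have m: "r m < y" using not_less_Least[of m "\<lambda>i. y \<le> r i"] Suc i_def by simp
      define w where "w = r m"
      have w: "t \<le> w" "w < y" using ry[of m] m Suc it w_def by auto
      have "c w (Suc y) = e" by (rule sep[of m]) (use w w_def it Suc y in auto)
      moreover have "c (Suc y) k = - c w (Suc y)"
      proof (rule D(7))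
        show "Suc y \<le> r w" using adjY[of w "Suc y"] w y by simp
        show "r w < k" using sgraph_mono[OF g, of w y] w y z yk by simp
      qed (use w k_def in auto)
      moreover have "c (Suc y) k = e" using out[of "Suc y" k] y kz k_def by simp
      ultimately show False using e by auto
    next
      case 0
      \<comment> \<open>Vertex \<open>1\<close> belongs to the first clique because
        \<open>2 \<le> t\<close>, and it sees further than vertex \<open>0\<close>, hence beyond
        \<open>y + 1\<close>.\<close>
      define w where "w = r 1"
      have w: "Suc y < w" "w \<le> z" using inc[of 0] i3 0 zge[of 1] t w_def by auto
      have a: "c y w = e" by (rule sep[of 0]) (use w i1 0 t y inc[of 0] w_def in auto)
      have kw: "k \<le> r w" using sgraph_mono[OF g, of "Suc y" w] w z k_def by simp
      have "c w k = - c y w"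
        by (rule D(7)) (use w y adjY[of y w] yk kw in auto)
      moreover have "c w k = e" by (rule out) (use w y kz kw in auto)
      ultimately show False using a e by auto
    qed
  qed
  \<comment> \<open>Strict growth of \<open>r\<close> makes the second clique at least as large as
    the first, and separation by the first clique makes it at most as large.\<close>
  have z2: "z = 2 * t - 1"
  proof (rule antisym)
    show "2 * t - 1 \<le> z" using chain[of 0 "t - 1"] t z_def by simp
    have "{t..z} \<subseteq> r ` {..<t}"
    proof
      fix y assume "y \<in> {t..z}"
      then show "y \<in> r ` {..<t}" using strictY[of y] z_def t by (cases "y = z") auto
    qed
    then have "card {t..z} \<le> card (r ` {..<t})" by (intro card_mono) auto
    also have "\<dots> \<le> t" using card_image_le[of "{..<t}" r] by simp
    finally show "z \<le> 2 * t - 1" by simp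
  qed
  show rt: "r i = t + i" if "i < t" for i
  proof -
    have "t + i \<le> r i" using chain[of 0 i] t that by simp
    moreover have "r i + (t - 1 - i) \<le> z" using chain[of i "t - 1"] that z_def by simp
    ultimately show ?thesis using z2 that by simp
  qed
  show n2: "2 * t \<le> n" using z z2 by simp
  have cY: "c y y' = e" if "t \<le> y" "y < y'" "y' \<le> z" for y y'
    by (rule sep[of "y - t"]) (use that z2 rt[of "y - t"] in auto)
  \<comment> \<open>If \<open>i\<close> saw more than \<open>t\<close>, alternation at the extra
    neighbour would give it the sign \<open>- e\<close>, against \<open>out\<close>.\<close>
  show rY: "r i = r t" if "t \<le> i" "i < 2 * t" for i
  proof (rule ccontr)
    assume "r i \<noteq> r t"
    then have lt: "r t < r i" using sgraph_mono[OF g, of t i] that n2 by simp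
    have "t < i" using lt that by (cases "t = i") auto
    have zr: "z \<le> r t" using adjY[of t z] z by simp
    have "c i (r i) = - c t i"
      using that z2 adjY[of t i] lt \<open>t < i\<close> by (intro D(7)) auto
    moreover have "c i (r i) = e" using out[of i "r i"] that z2 zr lt by simp
    moreover have "c t i = e" using cY[of t i] \<open>t < i\<close> that z2 by simp
    ultimately show False using e by auto
  qed
  show "c i j = e" if "t \<le> i" "i < 2 * t" "i < j" "j \<le> r t" for i j
  proof (cases "j \<le> z")
    case True then show ?thesis using cY that by blast
  next
    case False then show ?thesis using out[of i j] that z2 rY[of i] by simp
  qed
qed

section \<open>Removing the first clique\<close>

text \<open>
  Two cliques of sign \<open>e\<close> with \<open>t\<close> linked vertices each are put in front of a graph; the first vertex of the
  latter is either the last of the \<open>t\<close> linked vertices (\<open>k = 2 * t - 1\<close>) or an unlinked one (\<open>k = 2 * t\<close>).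
\<close>

definition prepend_half :: "nat \<Rightarrow> int \<Rightarrow> nat \<Rightarrow> (nat \<Rightarrow> nat) \<times> (nat \<Rightarrow> nat \<Rightarrow> int) \<Rightarrow> (nat \<Rightarrow> nat) \<times> (nat \<Rightarrow> nat
    \<Rightarrow> int)" where
  "prepend_half n e k = (\<lambda>(r, c). let t = (k + 1) div 2 in
    (\<lambda>i. if i < t then t + i else if i < k then k + r 0 else if i < n then k + r (i - k) else 0,
     \<lambda>i j. if i < t then (if i < j \<and> j \<le> t + i then (if j < t then e else - e) else 0)
           else if i < k then (if i < j \<and> j \<le> k + r 0 then e else 0)
           else c (i - k) (j - k)))"

section \<open>Attaching and detaching a half-graph link\<close>

lemma mono_graphsD:
  assumes "(r, c) \<in> mono_graphs n e"
  shows "sgraph n r c" "twinfree n r" "0 < j \<Longrightarrow> j \<le> r 0 \<Longrightarrow> c 0 j = e"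
  using assms by (auto simp: mono_graphs_def)

lemma twinfreeD: "twinfree n r \<Longrightarrow> Suc i < n \<Longrightarrow> r i < r (Suc i) \<or> (\<exists>k<i. r k = i)"
  by (simp add: twinfree_def)

text \<open>A vertex \<open>k < i\<close> sees at least up to \<open>r 0\<close>, so it cannot end
  at \<open>i < r 0\<close>; only a later vertex can separate \<open>i\<close> from
  \<open>i + 1\<close>.\<close>

lemma twinfree_first:
  assumes "sgraph n r c" "twinfree n r" "i < r 0"
  shows "r i < r (Suc i)"
proof -
  have n: "Suc i < n" using sgraphD(2)[OF assms(1), of 0] sgraphD(1)[OF assms(1)] assms(3) by simp
  have "r k \<noteq> i" if "k < i" for k
    using sgraph_mono[OF assms(1), of 0 k] that n assms(3) by simp
  then show ?thesis using twinfreeD[OF assms(2) n] by blast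
qed

text \<open>The link edges carry \<open>- e\<close>, so by alternation the edges that leave the
  second clique carry \<open>e\<close>, the sign inside it. This is why the remainder has to start
  with the same sign \<open>e\<close>.\<close>

lemma half_start_prepend_half:
  assumes "(r', c') \<in> mono_graphs (n - k) e" "k < n" and e: "e = 1 \<or> e = -1"
    and k: "k = 2 * t - 1 \<or> k = 2 * t" and t: "2 \<le> t"
    and RC: "(R, C) = prepend_half n e k (r', c')"
  shows "half_start n e t R C"
proof -
  note g = mono_graphsD(1)[OF assms(1)]
  note D = sgraphD[OF g]
  note tf = twinfreeD[OF mono_graphsD(2)[OF assms(1)]]
  note mono = mono_graphsD(3)[OF assms(1)]
  have tk: "(k + 1) div 2 = t" "t < k" "k \<le> 2 * t" "2 * t \<le> Suc k" using k t by auto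
  have R: "R i = (if i < t then t + i else if i < k then k + r' 0 else if i < n then k + r' (i - k) else 0)" for i
    using RC tk(1) by (simp add: prepend_half_def Let_def)
  have C: "C i j = (if i < t then (if i < j \<and> j \<le> t + i then (if j < t then e else - e) else 0)
           else if i < k then (if i < j \<and> j \<le> k + r' 0 then e else 0)
           else c' (i - k) (j - k))" for i j
    using RC tk(1) by (simp add: prepend_half_def Let_def)
  have r0: "r' 0 < n - k" using D(2)[of 0] D(1) by simp
  have R3: "R i = k + r' (i - k)" if "k \<le> i" "i < n" for i using R that tk by simp
  have R3': "i < n" "k \<le> i" if "j \<le> R i" "i < j" "\<not> i < k" for i j
    using that R[of i] tk by (auto split: if_splits)
  have le: "i \<le> r' i" if "i < n - k" for i using sgraph_ge[OF g that] .
  have m: "r' i \<le> r' j" if "i \<le> j" "j < n - k" for i j using sgraph_mono[OF g that] .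
  have adj: "C i j \<noteq> 0 \<longleftrightarrow> i < j \<and> j \<le> R i" for i j
  proof (cases "i < k")
    case True then show ?thesis using e by (auto simp: C R)
  next
    case False
    then have C': "C i j = c' (i - k) (j - k)" using tk by (simp add: C)
    show ?thesis
    proof (cases "i < n")
      case True
      then show ?thesis unfolding C' D(6) using False R3[of i] by auto
    next
      case F: False
      then show ?thesis unfolding C' D(6) using False R[of i] tk D(3)[of "i - k"] by auto
    qed
  qed
  have tri: "C j l = - C i j" if a: "i < j" "j \<le> R i" "R i < l" "l \<le> R j" for i j l
  proof -
    consider "i < t" | "t \<le> i" "i < k" | "k \<le> i" by linarith
    then show ?thesis
    proof cases
      case 1
      then have ji: "j \<le> t + i" using a R by simp
      show ?thesis
      proof (cases "j < k")
        case True
        have Ri: "R i = t + i" using 1 R by simp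
        show ?thesis
        proof (cases "j < t")
          case j: True
          then have "R j = t + j" using R by simp
          then show ?thesis using a 1 ji Ri j by (simp add: C)
        next
          case j: False
          then have "R j = k + r' 0" using R True by simp
          then show ?thesis using a 1 ji j True by (simp add: C)
        qed
      next
        case False
        \<comment> \<open>This happens only for \<open>k = 2 * t - 1\<close>, when the last linked
          vertex of the second clique is the first vertex of the remainder.\<close>
        then have jk: "j = k" using 1 ji tk by linarith
        have "R j = k + r' 0" using jk R3[of k] assms(2) by simp
        then have "l - k \<le> r' 0" "0 < l - k" using a jk by auto
        then have "c' 0 (l - k) = e" using mono by simp
        then show ?thesis using 1 ji jk a tk by (simp add: C)
      qed
    next
      \<comment> \<open>The vertices \<open>i\<close> and \<open>k\<close> have the same last
        neighbour, so vertex \<open>0\<close> of the remainder can stand in for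
        \<open>i\<close>.\<close>
      case 2
      have Ri: "R i = k + r' 0" using 2 R by simp
      have jk: "k \<le> j"
      proof (rule ccontr)
        assume "\<not> k \<le> j"
        then have "R j = k + r' 0" using R a 2 by simp
        then show False using a Ri by simp
      qed
      have jn: "j < n" using a jk R[of j] tk by (cases "j < n") auto
      have "j \<noteq> k" using a R3[of j] Ri jn by auto
      then have j0: "0 < j - k" using jk by simp
      have "c' (j - k) (l - k) = - c' 0 (j - k)"
        by (rule D(7)) (use a Ri R3[of j] jk jn j0 in auto)
      moreover have "c' 0 (j - k) = e" using mono[OF j0] a Ri by simp
      moreover have "C i j = e" using 2 a Ri by (simp add: C)
      moreover have "C j l = c' (j - k) (l - k)" using jk tk by (simp add: C)
      ultimately show ?thesis by simp
    next
      case 3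
      have "i < n" using a 3 R3'[of j i] by simp
      have "j < n" using a 3 R[of j] tk by (cases "j < n") auto
      have "c' (j - k) (l - k) = - c' (i - k) (j - k)"
        by (rule D(7)) (use a R3[of j] R3[of i] 3 \<open>i < n\<close> \<open>j < n\<close> in auto)
      then show ?thesis using 3 a tk by (simp add: C)
    qed
  qed
  have clq: "C i l = C i j" if a: "i < j" "j < l" "l \<le> R i" "C i j = C j l" for i j l
  proof -
    consider "i < t" | "t \<le> i" "i < k" | "k \<le> i" by linarith
    then show ?thesis
    proof cases
      case 1
      then show ?thesis using a tk e by (auto simp: C R split: if_splits)
    next
      case 2
      then show ?thesis using a by (simp add: C R)
    next
      case 3
      have "i < n" using a 3 R3'[of l i] by simp
      have "c' (i - k) (l - k) = c' (i - k) (j - k)"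
        by (rule D(8)) (use a R3[of i] 3 \<open>i < n\<close> tk in \<open>auto simp: C\<close>)
      then show ?thesis using 3 a tk by (simp add: C)
    qed
  qed
  have G: "sgraph n R C"
    unfolding sgraph_def
  proof (intro conjI allI impI)
    show "0 < n" using assms(2) by simp
  next
    fix i assume "i < n"
    show "R i < n"
    proof (cases "i < k")
      case True
      then show ?thesis using r0 tk assms(2) by (auto simp: R)
    next
      case False
      then have "r' (i - k) < n - k" by (intro D(2)) (use \<open>i < n\<close> in auto)
      then show ?thesis using R3[of i] False \<open>i < n\<close> by simp
    qed
  next
    fix i assume "n \<le> i" then show "R i = 0" using tk assms(2) by (simp add: R)
  next
    fix i assume i: "Suc i < n"
    show "i < R i"
    proof (cases "i < k")
      case True then show ?thesis using i tk by (auto simp: R)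
    next
      case False
      then have "i - k < r' (i - k)" by (intro D(4)) (use i in auto)
      then show ?thesis using R3[of i] False i by simp
    qed
    show "R i \<le> R (Suc i)"
    proof (cases "i < k")
      case True then show ?thesis using tk i by (auto simp: R)
    next
      case False then show ?thesis using R3[of i] R3[of "Suc i"] i m[of "i - k" "Suc i - k"] by auto
    qed
  next
    fix i j show "C i j \<in> {-1, 0, 1}" using D(5)[of "i - k" "j - k"] e by (auto simp: C)
    show "C i j \<noteq> 0 \<longleftrightarrow> i < j \<and> j \<le> R i" by (rule adj)
  next
    fix i j l assume "i < j" "j \<le> R i" "R i < l" "l \<le> R j" then show "C j l = - C i j" by (rule tri)
  next
    fix i j l assume "i < j" "j < l" "l \<le> R i" "C i j = C j l" then show "C i l = C i j" by (rule clq)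
  qed
  show ?thesis
    unfolding half_start_def
  proof (intro conjI allI impI)
    show "sgraph n R C" by (rule G)
    show "2 \<le> t" by (rule t)
    show "t \<le> R 0" using t by (simp add: R)
  next
    fix i assume "Suc i < t" then show "R i < R (Suc i)" by (simp add: R)
  next
    fix i assume i: "t \<le> i" "Suc i < n"
    show "R i < R (Suc i) \<or> (\<exists>k<i. R k = i)"
    proof (cases "i < k")
      case True
      \<comment> \<open>In the half graph, vertex \<open>i - t\<close> of the first clique ends at
        \<open>i\<close> and so separates \<open>i\<close> from \<open>i + 1\<close>.\<close>
      then have "R (i - t) = i" "i - t < i" using i tk t by (auto simp: R)
      then show ?thesis by blast
    next
      case False
      then have "Suc (i - k) < n - k" using i by linarith
      then consider "r' (i - k) < r' (Suc (i - k))" | l where "l < i - k" "r' l = i - k"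
        using tf[of "i - k"] by blast
      then show ?thesis
      proof cases
        case 1
        then show ?thesis using False R3[of i] R3[of "Suc i"] i by (simp add: Suc_diff_le)
      next
        case 2
        then have "R (k + l) = i" "k + l < i" using R3[of "k + l"] i False by auto
        then show ?thesis by blast
      qed
    qed
  next
    fix i j assume "i < t" "i < j" "j \<le> R i"
    then show "C i j = (if j < t then e else - e)" by (simp add: C R)
  qed
qed

text \<open>The two linked halves are already rigid, so only the cut has to be chosen. Cutting at a
  vertex of the second clique keeps a representative with the same last neighbour as the removed
  linked vertices of that clique; from it the link can be rebuilt.\<close>

lemma half_start_peel:
  assumes h: "half_start n e t r c" and e: "e = 1 \<or> e = -1"
  shows "\<exists>k s. (k = 2 * t - 1 \<or> k = 2 * t) \<and> k < n \<and> s \<in> mono_graphs (n - k) e \<and> (r, c) = prepend_half n e k s"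
proof -
  have g: "sgraph n r c" and t: "2 \<le> t"
    and tw: "\<And>i. t \<le> i \<Longrightarrow> Suc i < n \<Longrightarrow> r i < r (Suc i) \<or> (\<exists>k<i. r k = i)"
    and ce: "\<And>i j. i < t \<Longrightarrow> i < j \<Longrightarrow> j \<le> r i \<Longrightarrow> c i j = (if j < t then e else - e)"
    using h unfolding half_start_def by blast+
  note D = sgraphD[OF g]
  note F = half_start_facts[OF h e]
  \<comment> \<open>A vertex \<open>2 * t\<close> with the same last neighbour as \<open>t\<close>
    is a member of the second clique without a link to the first one, and then the cut is made
    there.\<close>
  define k where "k = (if 2 * t < n \<and> r (2 * t) = r t then 2 * t else 2 * t - 1)"
  have k: "k = 2 * t - 1 \<or> k = 2 * t" and kn: "k < n" using k_def F(2) t by auto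
  have kt: "t < k" "(k + 1) div 2 = t" "k \<le> 2 * t" "2 * t \<le> Suc k" using k t by auto
  define r' where "r' = (\<lambda>i. r (i + k) - k)"
  define c' where "c' = (\<lambda>i j. c (i + k) (j + k))"
  have g': "sgraph (n - k) r' c'" unfolding r'_def c'_def by (rule sgraph_suffix[OF g kn])
  have rk: "r k = r t" using F(3)[of k] k t k_def by (auto split: if_splits)
  have r0: "k + r' 0 = r t" using rk sgraph_ge[OF g kn] r'_def by simp
  have ry: "r i = r t" if "t \<le> i" "i < k" for i using F(3)[of i] that kt by simp
  \<comment> \<open>There is no second unlinked vertex. For \<open>k = 2 * t - 1\<close> this is the
    choice of \<open>k\<close>; for \<open>k = 2 * t\<close> no vertex ends at \<open>k\<close>,
    since the first clique ends earlier and the linked vertices of the second one end at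
    \<open>r t > k\<close>.\<close>
  have nxt: "r k < r (Suc k)" if "Suc k < n" "k < r t"
  proof (rule ccontr)
    assume "\<not> ?thesis"
    then have eq: "r (Suc k) = r t" using sgraph_mono[OF g, of k "Suc k"] that rk by simp
    have "k = 2 * t"
      using k_def that eq t by (auto split: if_splits)
    then have "\<not> (\<exists>l<k. r l = k)"
    proof -
      assume "k = 2 * t"
      then have "r l \<noteq> k" if "l < k" for l
        using F(1)[of l] ry[of l] that \<open>k < r t\<close> by (cases "l < t") auto
      then show ?thesis by blast
    qed
    moreover have "r k < r (Suc k) \<or> (\<exists>l<k. r l = k)" using tw[of k] that kt by simp
    ultimately show False using eq rk by auto
  qed
  have tf': "twinfree (n - k) r'"
    unfolding twinfree_def
  proof (intro allI impI)
    fix i assume i: "Suc i < n - k"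
    show "r' i < r' (Suc i) \<or> (\<exists>l<i. r' l = i)"
    proof (cases "i = 0")
      case True
      have "k < r k" using D(4)[of k] i by simp
      then have "r k < r (Suc k)" using nxt rk i True by simp
      then show ?thesis using \<open>k < r k\<close> True by (simp add: r'_def diff_less_mono)
    next
      case False
      have ik: "t \<le> i + k" "Suc (i + k) < n" using i kt by auto
      from tw[OF this] show ?thesis
      proof
        assume "r (i + k) < r (Suc (i + k))"
        moreover have "i + k < r (i + k)" using D(4) ik by simp
        ultimately show ?thesis by (simp add: r'_def diff_less_mono)
      next
        assume "\<exists>l<i + k. r l = i + k"
        then obtain l where l: "l < i + k" "r l = i + k" by blast
        show ?thesis
        proof (cases "k \<le> l")
          case True
          then have "r' (l - k) = i" "l - k < i" using l by (auto simp: r'_def)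
          then show ?thesis by blast
        next
          case lk: False
          \<comment> \<open>The separating vertex is deleted. As \<open>i > 0\<close>, it lies in
            the second clique, and there \<open>k\<close> has the same last neighbour and takes
            over.\<close>
          have "t \<le> l \<or> l < t" by linarith
          then have "r t = i + k"
            using F(1)[of l] ry[of l] l lk kt False by auto
          then have "r' 0 = i" using r0 by simp
          then show ?thesis using False by blast
        qed
      qed
    qed
  qed
  have mono': "c' 0 j = e" if "0 < j" "j \<le> r' 0" for j
  proof -
    have j: "k < j + k" "j + k \<le> r t" using that r0 by auto
    show ?thesis
    proof (cases "k = 2 * t")
      case False
      then have "c k (j + k) = e" using F(4)[of k "j + k"] k t j by auto
      then show ?thesis by (simp add: c'_def)
    next
      case True
      \<comment> \<open>\<open>z\<close> is seen by \<open>j + k\<close> but by neither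
        \<open>t\<close> nor \<open>k\<close>, so the unknown sign at \<open>k\<close> equals the
        known one at \<open>t\<close>.\<close>
      define z where "z = r (j + k)"
      have jn: "j + k < n" using that sgraphD(2)[OF g', of 0] kn by simp
      have "r k < r (Suc k)" using nxt jn j that by simp
      moreover have "r (Suc k) \<le> z" using sgraph_mono[OF g, of "Suc k" "j + k"] that jn z_def by simp
      ultimately have z: "r t < z" using rk by simp
      have "c (j + k) z = - c t (j + k)" by (rule D(7)) (use kt j z z_def in auto)
      moreover have "c (j + k) z = - c k (j + k)" by (rule D(7)) (use rk j z z_def in auto)
      moreover have "c t (j + k) = e" using F(4)[of t "j + k"] t j kt by simp
      ultimately show ?thesis by (simp add: c'_def)
    qed
  qed
  have "(r', c') \<in> mono_graphs (n - k) e" unfolding mono_graphs_def using g' tf' mono' by simp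
  moreover have "(r, c) = prepend_half n e k (r', c')"
  proof -
    have "r i = (if i < t then t + i else if i < k then k + r' 0 else if i < n then k + r' (i - k) else 0)" for i
      using F(1)[of i] ry[of i] r0 D(3)[of i] sgraph_ge[OF g, of i] by (auto simp: r'_def)
    moreover have "c i j = (if i < t then (if i < j \<and> j \<le> t + i then (if j < t then e else - e) else 0)
           else if i < k then (if i < j \<and> j \<le> k + r' 0 then e else 0)
           else c' (i - k) (j - k))" for i j
    proof -
      consider "i < t" | "t \<le> i" "i < k" | "k \<le> i" by linarith
      then show ?thesis
      proof cases
        case 1
        then show ?thesis using ce[of i j] F(1)[of i] D(6)[of i j] by auto
      next
        case 2
        then show ?thesis using F(4)[of i j] ry[of i] D(6)[of i j] r0 kt by auto
      next
        case 3
        show ?thesis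
        proof (cases "k \<le> j")
          case True then show ?thesis using 3 kt by (simp add: c'_def)
        next
          case False
          then have "c i j = 0" "c i k = 0" using 3 D(6)[of i j] D(6)[of i k] by auto
          then show ?thesis using 3 kt False by (simp add: c'_def)
        qed
      qed
    qed
    ultimately show ?thesis
      unfolding prepend_half_def prod.case Let_def kt(2) Pair_inject fun_eq_iff by blast
  qed
  ultimately show ?thesis using k kn by blast
qed

section \<open>Adding vertices in front, and peeling them off\<close>

text \<open>The common left inverse of the constructions that add vertices in front, which yields
  their injectivity.\<close>

definition suffix_graph :: "nat \<Rightarrow> (nat \<Rightarrow> nat) \<times> (nat \<Rightarrow> nat \<Rightarrow> int) \<Rightarrow> (nat \<Rightarrow> nat) \<times> (nat \<Rightarrow> nat \<Rightarrow> int)" where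
  "suffix_graph k = (\<lambda>(r, c). (\<lambda>i. r (i + k) - k, \<lambda>i j. c (i + k) (j + k)))"

definition prepend :: "nat \<Rightarrow> nat \<Rightarrow> int \<Rightarrow> (nat \<Rightarrow> nat) \<times> (nat \<Rightarrow> nat \<Rightarrow> int) \<Rightarrow> (nat \<Rightarrow> nat) \<times> (nat \<Rightarrow> nat \<Rightarrow> int)" where
  "prepend n v e = (\<lambda>(r, c).
     (\<lambda>i. if i = 0 then v else if i \<le> n then Suc (r (i - 1)) else 0,
      \<lambda>i j. if i = 0 then (if 0 < j \<and> j \<le> v then e else 0) else c (i - 1) (j - 1)))"

lemma suffix_graph_prepend:
  assumes "sgraph n r c"
  shows "suffix_graph 1 (prepend n v e (r, c)) = (r, c)"
  using sgraphD(3)[OF assms] by (auto simp: suffix_graph_def prepend_def fun_eq_iff)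

lemma suffix_graph_prepend_half:
  assumes "sgraph (n - k) r c" "k < n" "3 \<le> k"
  shows "suffix_graph k (prepend_half n e k (r, c)) = (r, c)"
proof -
  have "(k + 1) div 2 \<le> k" using assms(3) by linarith
  then show ?thesis
    using sgraphD(3)[OF assms(1)] assms(2) by (auto simp: suffix_graph_def prepend_half_def Let_def fun_eq_iff)
qed

text \<open>Assumption \<open>U\<close> is the alternation rule for triples that contain the new
  vertex, with the old vertices shifted by one; \<open>v \<le> Suc (r 0)\<close> keeps the last
  neighbours monotone.\<close>

lemma sgraph_prepend:
  assumes g: "sgraph n r c" and v: "0 < v" "v \<le> Suc (r 0)" and e: "e = 1 \<or> e = -1"
    and U: "\<And>j k. j < v \<Longrightarrow> v \<le> k \<Longrightarrow> k \<le> r j \<Longrightarrow> c j k = - e"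
    and RC: "(R, C) = prepend n v e (r, c)"
  shows "sgraph (Suc n) R C"
proof -
  note D = sgraphD[OF g]
  have R: "R 0 = v" "R (Suc i) = (if i < n then Suc (r i) else 0)" for i
    using RC by (auto simp: prepend_def)
  have C: "C 0 j = (if 0 < j \<and> j \<le> v then e else 0)" "C (Suc i) (Suc j) = c i j" "C (Suc i) 0 = 0" for i j
    using RC D(6)[of i 0] by (auto simp: prepend_def)
  have r0: "r 0 < n" using D(1,2) by simp
  have le: "i < j \<and> j \<le> R (Suc m) \<longleftrightarrow> i < j \<and> j - 1 \<le> r m \<and> m < n" if "m \<le> i" for i j m
    using that D(3)[of m] R(2)[of m] by auto
  show ?thesis
    unfolding sgraph_def
  proof (intro conjI allI impI)
    fix i assume "i < Suc n"
    then show "R i < Suc n" using D(2)[of "i - 1"] v r0 by (cases i) (auto simp: R)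
  next
    fix i assume "Suc n \<le> i"
    then show "R i = 0" by (cases i) (auto simp: R)
  next
    fix i assume i: "Suc i < Suc n"
    show "i < R i" using i v D(4)[of "i - 1"] sgraph_ge[OF g, of "i - 1"] by (cases i) (auto simp: R)
    show "R i \<le> R (Suc i)" using i v sgraph_mono[OF g, of "i - 1" i] by (cases i) (auto simp: R)
  next
    fix i j
    show "C i j \<in> {-1, 0, 1}" using e D(5)[of "i - 1" "j - 1"] by (cases i; cases j) (auto simp: C)
    show "C i j \<noteq> 0 \<longleftrightarrow> i < j \<and> j \<le> R i"
      using e v D(3)[of "i - 1"] D(6)[of "i - 1" "j - 1"] by (cases i; cases j) (auto simp: C R)
  next
    fix i j k assume a: "i < j" "j \<le> R i" "R i < k" "k \<le> R j"
    obtain j' where j: "j = Suc j'" using a by (cases j) auto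
    obtain k' where k: "k = Suc k'" using a by (cases k) auto
    have jn: "j' < n" "k' \<le> r j'" using a j k R(2)[of j'] by (auto split: if_splits)
    show "C j k = - C i j"
    proof (cases i)
      case 0 then show ?thesis using a U[of j' k'] jn by (simp add: C j k R)
    next
      case (Suc i')
      have "c j' k' = - c i' j'" by (rule D(7)) (use a Suc j k jn R(2)[of i'] in \<open>auto split: if_splits\<close>)
      then show ?thesis by (simp add: C j k Suc)
    qed
  next
    fix i j k assume a: "i < j" "j < k" "k \<le> R i" "C i j = C j k"
    obtain j' where j: "j = Suc j'" using a by (cases j) auto
    obtain k' where k: "k = Suc k'" using a by (cases k) auto
    show "C i k = C i j"
    proof (cases i)
      case 0 then show ?thesis using a by (simp add: C R)
    next
      case (Suc i')
      have "c i' k' = c i' j'"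
        by (rule D(8)) (use a Suc j k R(2)[of i'] in \<open>auto split: if_splits simp: C\<close>)
      then show ?thesis by (simp add: C j k Suc)
    qed
  qed simp
qed

lemma prepend_simps:
  assumes "(R, C) = prepend n v e (r, c)"
  shows "R 0 = v" "i < n \<Longrightarrow> R (Suc i) = Suc (r i)" "0 < j \<Longrightarrow> j \<le> v \<Longrightarrow> C 0 j = e"
    "C (Suc i) (Suc j) = c i j"
  using assms by (auto simp: prepend_def)

text \<open>No vertex precedes \<open>0\<close>, so only a later vertex can separate
  \<open>0\<close> from \<open>1\<close>. In particular a first vertex that sees all others is
  alone, which later isolates the exceptional graphs.\<close>

lemma mono_r0_less:
  assumes "(r, c) \<in> mono_graphs n e" "2 \<le> n"
  shows "r 0 < r 1" "0 < r 0" "r 0 < n - 1"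
proof -
  note g = mono_graphsD(1)[OF assms(1)]
  show p: "0 < r 0" using sgraphD(4)[OF g, of 0] assms(2) by simp
  show "r 0 < r 1" using twinfree_first[OF g mono_graphsD(2)[OF assms(1)] p] by simp
  then show "r 0 < n - 1" using sgraphD(2)[OF g, of 1] assms(2) by simp
qed

text \<open>The new clique \<open>{0, 1}\<close> shares the old first vertex with the next clique.
  With \<open>n = 1\<close> its two vertices would be twins.\<close>

lemma prepend_mono:
  assumes "(r, c) \<in> mono_graphs n (-e)" "2 \<le> n" and e: "e = 1 \<or> e = -1"
    and RC: "(R, C) = prepend n 1 e (r, c)"
  shows "(R, C) \<in> mono_graphs (Suc n) e"
proof -
  note Q = mono_graphsD[OF assms(1)]
  note Z = prepend_simps[OF RC]
  have "sgraph (Suc n) R C"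
    by (rule sgraph_prepend[OF Q(1) _ _ e _ RC]) (use Q(3) in auto)
  moreover have "twinfree (Suc n) R"
    unfolding twinfree_def
  proof (intro allI impI)
    fix i assume i: "Suc i < Suc n"
    show "R i < R (Suc i) \<or> (\<exists>k<i. R k = i)"
    proof (cases i)
      case 0 then show ?thesis using Z mono_r0_less[OF assms(1,2)] i by simp
    next
      case (Suc m)
      then consider "r m < r (Suc m)" | k where "k < m" "r k = m" using twinfreeD[OF Q(2), of m] i by auto
      then show ?thesis
      proof cases
        case 1 then show ?thesis using Z(2)[of m] Z(2)[of "Suc m"] Suc i by simp
      next
        case 2
        then have "Suc k < i" "R (Suc k) = i" using Z(2)[of k] Suc i by auto
        then show ?thesis by blast
      qed
    qed
  qed
  ultimately show ?thesis using Z by (auto simp: mono_graphs_def)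
qed

text \<open>Again a shared vertex, but a new one: a twin of the old first vertex, which thereby
  becomes the unlinked vertex of its clique. The pendant vertex in front tells the twins
  apart.\<close>

definition prepend_two :: "nat \<Rightarrow> int \<Rightarrow> (nat \<Rightarrow> nat) \<times> (nat \<Rightarrow> nat \<Rightarrow> int) \<Rightarrow> (nat \<Rightarrow> nat) \<times> (nat \<Rightarrow> nat \<Rightarrow> int)" where
  "prepend_two n e s = prepend (Suc n) 1 e (prepend n (Suc (fst s 0)) (-e) s)"

lemma prepend_two_mono:
  assumes "(r, c) \<in> mono_graphs n (-e)" and e: "e = 1 \<or> e = -1"
    and RC: "(R, C) = prepend_two n e (r, c)"
  shows "(R, C) \<in> mono_graphs (Suc (Suc n)) e" "R 0 = 1" "R 1 = R 2" "suffix_graph 2 (R, C) = (r, c)"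
proof -
  note Q = mono_graphsD[OF assms(1)]
  obtain r1 c1 where 1: "(r1, c1) = prepend n (Suc (r 0)) (-e) (r, c)" by (metis surj_pair)
  have RC2: "(R, C) = prepend (Suc n) 1 e (r1, c1)" using RC 1 by (simp add: prepend_two_def)
  note Z = prepend_simps[OF 1]
  note Y = prepend_simps[OF RC2]
  have n: "0 < n" using sgraphD(1)[OF Q(1)] .
  have g1: "sgraph (Suc n) r1 c1"
  proof (rule sgraph_prepend[OF Q(1) _ _ _ _ 1])
    fix j k assume a: "j < Suc (r 0)" "Suc (r 0) \<le> k" "k \<le> r j"
    then have "0 < j" by (cases j) auto
    then have "c j k = - c 0 j" using a by (intro sgraphD(7)[OF Q(1)]) auto
    then show "c j k = - (- e)" using Q(3)[of j] \<open>0 < j\<close> a by simp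
  qed (use e in auto)
  have g: "sgraph (Suc (Suc n)) R C"
    by (rule sgraph_prepend[OF g1 _ _ e _ RC2]) (use Z in auto)
  have R12: "R 1 = Suc (Suc (r 0))" "R 2 = Suc (Suc (r 0))"
    using Y(2)[of 0] Y(2)[of 1] Z(1) Z(2)[of 0] n by (auto simp: numeral_2_eq_2)
  show "R 0 = 1" using Y by simp
  show "R 1 = R 2" using R12 by simp
  have R2: "R (Suc (Suc i)) = Suc (Suc (r i))" if "i < n" for i using Y(2)[of "Suc i"] Z(2)[of i] that by simp
  have "twinfree (Suc (Suc n)) R"
    unfolding twinfree_def
  proof (intro allI impI)
    fix i assume i: "Suc i < Suc (Suc n)"
    consider "i = 0" | "i = 1" | m where "i = Suc (Suc m)" by (metis One_nat_def not0_implies_Suc)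
    then show "R i < R (Suc i) \<or> (\<exists>k<i. R k = i)"
    proof cases
      case 1 then show ?thesis using Y(1) R12 by simp
    next
      case 2 then show ?thesis using Y(1) by auto
    next
      case (3 m)
      then consider "r m < r (Suc m)" | k where "k < m" "r k = m" using twinfreeD[OF Q(2), of m] i by auto
      then show ?thesis
      proof cases
        case 1 then show ?thesis using R2[of m] R2[of "Suc m"] 3 i by simp
      next
        case 2
        then have "Suc (Suc k) < i" "R (Suc (Suc k)) = i" using R2[of k] 3 i by auto
        then show ?thesis by blast
      qed
    qed
  qed
  then show "(R, C) \<in> mono_graphs (Suc (Suc n)) e" using g Y by (auto simp: mono_graphs_def)
  have "suffix_graph 1 (suffix_graph 1 (R, C)) = (r, c)"
    using suffix_graph_prepend[OF g1, of 1 e] suffix_graph_prepend[OF Q(1), of "Suc (r 0)" "-e"] 1 RC2 by simp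
  then show "suffix_graph 2 (R, C) = (r, c)"
    by (auto simp: suffix_graph_def fun_eq_iff numeral_2_eq_2)
qed

text \<open>The new vertex ends at \<open>t\<close>, so it separates the two vertices that were
  allowed to be twins; after the shift they are \<open>t\<close> and \<open>t + 1\<close>.\<close>

lemma mono_prepend_half_start:
  assumes h: "half_start n e t r c" and e: "e = 1 \<or> e = -1"
    and RC: "(R, C) = prepend n t e (r, c)"
  shows "(R, C) \<in> mono_graphs (Suc n) e"
proof -
  have g: "sgraph n r c" and t: "2 \<le> t" "t \<le> r 0"
    and inc: "\<And>i. Suc i < t \<Longrightarrow> r i < r (Suc i)"
    and tw: "\<And>i. t \<le> i \<Longrightarrow> Suc i < n \<Longrightarrow> r i < r (Suc i) \<or> (\<exists>k<i. r k = i)"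
    and ce: "\<And>i j. i < t \<Longrightarrow> i < j \<Longrightarrow> j \<le> r i \<Longrightarrow> c i j = (if j < t then e else - e)"
    using h unfolding half_start_def by blast+
  note Z = prepend_simps[OF RC]
  have "sgraph (Suc n) R C"
    by (rule sgraph_prepend[OF g _ _ e _ RC]) (use t ce in auto)
  moreover have "twinfree (Suc n) R"
    unfolding twinfree_def
  proof (intro allI impI)
    fix i assume i: "Suc i < Suc n"
    consider "i = 0" | m where "i = Suc m" "Suc m < t" | "i = t" | m where "i = Suc m" "t \<le> m"
      by (cases i) (auto, linarith)
    then show "R i < R (Suc i) \<or> (\<exists>k<i. R k = i)"
    proof cases
      case 1 then show ?thesis using Z t i by simp
    next
      case (2 m) then show ?thesis using Z(2)[of m] Z(2)[of "Suc m"] inc[of m] i by simp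
    next
      case 3
      then have "R 0 = i" "0 < i" using Z(1) t by auto
      then show ?thesis by blast
    next
      case (4 m)
      then consider "r m < r (Suc m)" | k where "k < m" "r k = m" using tw[of m] i by auto
      then show ?thesis
      proof cases
        case 1 then show ?thesis using Z(2)[of m] Z(2)[of "Suc m"] 4 i by simp
      next
        case 2
        then have "Suc k < i" "R (Suc k) = i" using Z(2)[of k] 4 i by auto
        then show ?thesis by blast
      qed
    qed
  qed
  ultimately show ?thesis using Z by (auto simp: mono_graphs_def)
qed

lemma prepend_suffix_graph:
  assumes g: "sgraph (Suc n) r c" and "0 < n" and "\<And>j. 0 < j \<Longrightarrow> j \<le> r 0 \<Longrightarrow> c 0 j = e"
  shows "prepend n (r 0) e (suffix_graph 1 (r, c)) = (r, c)"
proof -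
  note D = sgraphD[OF g]
  have "Suc (r i - Suc 0) = r i" if "0 < i" "i \<le> n" for i
    using sgraph_ge[OF g, of i] that by simp
  moreover have "c i (Suc (j - Suc 0)) = c i j" if "0 < i" for i j
    using that D(6)[of i 0] D(6)[of i 1] by (cases j) auto
  moreover have "r i = 0" if "\<not> i \<le> n" for i using D(3)[of i] that by simp
  moreover have "c 0 j = 0" if "\<not> (0 < j \<and> j \<le> r 0)" for j using that D(6)[of 0 j] by auto
  ultimately show ?thesis using assms(3)
    by (auto simp: prepend_def suffix_graph_def fun_eq_iff)
qed

text \<open>\<open>r 0 = 1\<close> means a shared vertex, and comparing \<open>r 1\<close> with
  \<open>r 2\<close> tells whether the next clique has an unlinked vertex. For
  \<open>2 \<le> r 0\<close> the first link is a half graph, and just the vertex in front of it is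
  removed.\<close>

lemma mono_peel:
  assumes Q: "(r, c) \<in> mono_graphs n e" and n: "2 \<le> n" and e: "e = 1 \<or> e = -1"
  shows "r 0 = 1 \<and> r 1 < r 2 \<and> 3 \<le> n \<and> suffix_graph 1 (r, c) \<in> mono_graphs (n - 1) (-e) \<or>
     r 0 = 1 \<and> r 1 = r 2 \<and> 3 \<le> n \<and> suffix_graph 2 (r, c) \<in> mono_graphs (n - 2) (-e) \<or>
     2 \<le> r 0 \<and> half_start (n - 1) e (r 0) (fst (suffix_graph 1 (r, c))) (snd (suffix_graph 1 (r, c)))"
proof -
  note g = mono_graphsD(1)[OF Q] and mono = mono_graphsD(3)[OF Q]
  note tf = twinfreeD[OF mono_graphsD(2)[OF Q]]
  note D = sgraphD[OF g]
  note r0 = mono_r0_less[OF Q n]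
  have n3: "3 \<le> n" using r0 by simp
  define r1 where "r1 = (\<lambda>i. r (i + 1) - 1)"
  define c1 where "c1 = (\<lambda>i j. c (i + 1) (j + 1))"
  have s1: "suffix_graph 1 (r, c) = (r1, c1)" by (simp add: suffix_graph_def r1_def c1_def)
  have g1: "sgraph (n - 1) r1 c1" unfolding r1_def c1_def by (rule sgraph_suffix[OF g]) (use n in simp)
  show ?thesis
  proof (cases "r 0 = 1")
    case v: True
    have c1j: "c 1 j = - e" if "1 < j" "j \<le> r 1" for j
      using D(7)[of 0 1 j] mono[of 1] v that by simp
    show ?thesis
    proof (cases "r 1 < r 2")
      case True
      have "twinfree (n - 1) r1"
        unfolding twinfree_def
      proof (intro allI impI)
        fix i assume i: "Suc i < n - 1"
        then have "Suc (Suc i) < n" by simp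
        then consider "r (Suc i) < r (Suc (Suc i))" | k where "k < Suc i" "r k = Suc i"
          using tf[of "Suc i"] by blast
        then show "r1 i < r1 (Suc i) \<or> (\<exists>k<i. r1 k = i)"
        proof cases
          case 1
          moreover have "Suc i < r (Suc i)" using D(4)[of "Suc i"] i by simp
          ultimately show ?thesis by (simp add: r1_def diff_less_mono)
        next
          case 2
          show ?thesis
          proof (cases k)
            case 0
            \<comment> \<open>The lost vertex \<open>0\<close> separated only \<open>1\<close> from
              \<open>2\<close>, and these are also separated by \<open>r 1 < r 2\<close>.\<close>
            then have "i = 0" using 2 v by simp
            then show ?thesis using True r0 by (simp add: r1_def numeral_2_eq_2 diff_less_mono)
          next
            case (Suc k')
            then have "k' < i" "r1 k' = i" using 2 by (auto simp: r1_def)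
            then show ?thesis by blast
          qed
        qed
      qed
      moreover have "c1 0 j = - e" if "0 < j" "j \<le> r1 0" for j
        using c1j[of "Suc j"] that by (simp add: c1_def r1_def)
      ultimately have "(r1, c1) \<in> mono_graphs (n - 1) (-e)" using g1 by (simp add: mono_graphs_def)
      then show ?thesis using v True n3 s1 by simp
    next
      case False
      then have r12: "r 1 = r 2" using sgraph_mono[OF g, of 1 2] n3 by simp
      define r2 where "r2 = (\<lambda>i. r (i + 2) - 2)"
      define c2 where "c2 = (\<lambda>i j. c (i + 2) (j + 2))"
      have s2: "suffix_graph 2 (r, c) = (r2, c2)" by (simp add: suffix_graph_def r2_def c2_def)
      have g2: "sgraph (n - 2) r2 c2" unfolding r2_def c2_def by (rule sgraph_suffix[OF g]) (use n3 in simp)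
      have r20: "r2 0 = r 2 - 2" by (simp add: r2_def numeral_2_eq_2)
      have r2gt: "2 < r 2" if "3 < n" using D(4)[of 2] that by simp
      \<comment> \<open>No earlier vertex ends at \<open>2\<close>: vertex \<open>0\<close> ends at
        \<open>1\<close>, and vertex \<open>1\<close> ends where \<open>2\<close> does, which is
        later.\<close>
      have r23: "r 2 < r 3" if "3 < n"
      proof -
        have "r k \<noteq> 2" if "k < 2" for k
          using that v r12 r2gt \<open>3 < n\<close> by (auto simp: less_2_cases_iff)
        then show ?thesis using tf[of 2] that by (auto simp: numeral_3_eq_3 numeral_2_eq_2)
      qed
      have "twinfree (n - 2) r2"
        unfolding twinfree_def
      proof (intro allI impI)
        fix i assume i: "Suc i < n - 2"
        then have "Suc (i + 2) < n" by simp
        then consider "r (i + 2) < r (Suc i + 2)" | k where "k < i + 2" "r k = i + 2"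
          using tf[of "i + 2"] by auto
        then show "r2 i < r2 (Suc i) \<or> (\<exists>k<i. r2 k = i)"
        proof cases
          case 1
          moreover have "i + 2 < r (i + 2)" using D(4)[of "i + 2"] i by simp
          ultimately show ?thesis by (simp add: r2_def diff_less_mono)
        next
          case 2
          show ?thesis
          proof (cases "k < 2")
            case True
            then have "r 2 = i + 2" using 2 v r12 by (auto simp: less_2_cases_iff)
            then have "r2 0 = i" "i \<noteq> 0" using r2gt i r20 by auto
            then show ?thesis by blast
          next
            case False
            then obtain k' where "k = k' + 2" by (metis le_add_diff_inverse2 not_less)
            then have "k' < i" "r2 k' = i" using 2 by (auto simp: r2_def)
            then show ?thesis by blast
          qed
        qed
      qed
      moreover have "c2 0 j = - e" if j: "0 < j" "j \<le> r2 0" for j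
      proof -
        define l where "l = j + 2"
        have l: "2 < l" "l \<le> r 2" using j l_def r20 by auto
        have ln: "l < n" using l D(2)[of 2] n3 by simp
        \<comment> \<open>\<open>z\<close> is seen by \<open>l\<close> but by neither of
          \<open>1\<close> and \<open>2\<close>, so both edges into \<open>l\<close> have the same
          sign.\<close>
        define z where "z = r l"
        have "r 2 < z" using r23 sgraph_mono[OF g, of 3 l] l ln z_def by simp
        then have "c l z = - c 1 l" "c l z = - c 2 l"
          using l r12 z_def by (auto intro!: D(7))
        then show ?thesis using c1j[of l] l r12 by (simp add: c2_def l_def numeral_2_eq_2)
      qed
      ultimately have "(r2, c2) \<in> mono_graphs (n - 2) (-e)" using g2 by (simp add: mono_graphs_def)
      then show ?thesis using v r12 n3 s2 by simp
    qed
  next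
    case False
    define t where "t = r 0"
    have t: "2 \<le> t" using False r0 t_def by simp
    have st: "r i < r (Suc i)" if "i < t" for i
      using twinfree_first[OF g mono_graphsD(2)[OF Q]] that t_def by simp
    have tn: "t < n - 1" using r0 t_def by simp
    have ge: "Suc i \<le> r (Suc i)" if "i < n - 1" for i using sgraph_ge[OF g, of "Suc i"] that by simp
    have "half_start (n - 1) e t r1 c1"
      unfolding half_start_def
    proof (intro conjI allI impI)
      show "t \<le> r1 0" using st[of 0] t by (simp add: r1_def t_def)
    next
      fix i assume "Suc i < t"
      then show "r1 i < r1 (Suc i)" using st[of "Suc i"] ge[of i] tn by (simp add: r1_def diff_less_mono)
    next
      fix i assume i: "t \<le> i" "Suc i < n - 1"
      then have "Suc (Suc i) < n" by simp
      then consider "r (Suc i) < r (Suc (Suc i))" | k where "k < Suc i" "r k = Suc i"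
        using tf[of "Suc i"] by blast
      then show "r1 i < r1 (Suc i) \<or> (\<exists>k<i. r1 k = i)"
      proof cases
        case 1
        then show ?thesis using ge[of i] i by (simp add: r1_def diff_less_mono)
      next
        case 2
        \<comment> \<open>Vertex \<open>0\<close> ends at \<open>t\<close> and would only be needed
          for \<open>i = t - 1\<close>, the pair exempted in \<open>half_start\<close>.\<close>
        then have "k \<noteq> 0" using i t_def by (cases k) auto
        then have "k - 1 < i" "r1 (k - 1) = i" using 2 by (auto simp: r1_def)
        then show ?thesis by blast
      qed
    next
      fix i j assume a: "i < t" "i < j" "j \<le> r1 i"
      then have a': "Suc i < Suc j" "Suc j \<le> r (Suc i)" using ge[of i] tn by (auto simp: r1_def)
      show "c1 i j = (if j < t then e else - e)"
      proof (cases "j < t")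
        case True
        \<comment> \<open>\<open>z\<close> is seen by \<open>j + 1\<close> but by neither
          \<open>0\<close> nor \<open>i + 1\<close>, so both edges into \<open>j + 1\<close> have
          the sign \<open>e\<close>.\<close>
        define z where "z = r (Suc j)"
        have jn: "Suc j < n" using True tn by simp
        have z1: "r (Suc i) < z"
        proof -
          have "r (Suc i) < r (Suc (Suc i))" using st[of "Suc i"] a True by simp
          also have "\<dots> \<le> z" using sgraph_mono[OF g, of "Suc (Suc i)" "Suc j"] a jn z_def by simp
          finally show ?thesis .
        qed
        have z0: "r 0 < z" using z1 sgraph_mono[OF g, of 0 "Suc i"] a jn by simp
        have "c (Suc j) z = - c 0 (Suc j)"
          by (rule D(7)) (use True t_def z0 z_def in auto)
        moreover have "c (Suc j) z = - c (Suc i) (Suc j)"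
          by (rule D(7)) (use a' z1 z_def in auto)
        ultimately show ?thesis using mono[of "Suc j"] True t_def by (simp add: c1_def)
      next
        case F: False
        have "c (Suc i) (Suc j) = - c 0 (Suc i)"
          by (rule D(7)) (use a a' F t_def in auto)
        then show ?thesis using mono[of "Suc i"] a F t_def by (simp add: c1_def)
      qed
    qed (use g1 t in auto)
    then show ?thesis using t s1 by (simp add: t_def)
  qed
qed

section \<open>Counting signed graphs\<close>

lemma finite_mono_graphs: "finite (mono_graphs n e)"
proof -
  let ?A = "{r :: nat \<Rightarrow> nat. \<forall>i. (i \<in> {..<n} \<longrightarrow> r i \<in> {..<n}) \<and> (i \<notin> {..<n} \<longrightarrow> r i = 0)}"
  let ?B = "{g :: nat \<Rightarrow> int. \<forall>i. (i \<in> {..<n} \<longrightarrow> g i \<in> {-1, 0, 1}) \<and> (i \<notin> {..<n} \<longrightarrow> g i = 0)}"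
  let ?C = "{c. \<forall>i. (i \<in> {..<n} \<longrightarrow> c i \<in> ?B) \<and> (i \<notin> {..<n} \<longrightarrow> c i = (\<lambda>_. 0 :: int))}"
  have "finite ?A" by (intro finite_set_of_finite_funs) auto
  moreover have "finite ?B" by (intro finite_set_of_finite_funs) auto
  then have "finite ?C" by (intro finite_set_of_finite_funs) auto
  ultimately have fin: "finite (?A \<times> ?C)" by blast
  have "mono_graphs n e \<subseteq> ?A \<times> ?C"
  proof
    fix x assume x: "x \<in> mono_graphs n e"
    obtain r c where rc: "x = (r, c)" by (metis surj_pair)
    note D = sgraphD[OF mono_graphsD(1)[OF x[unfolded rc]]]
    have "r \<in> ?A" using D(2,3) by auto
    moreover have "c i \<in> ?B" for i
    proof -
      have "c i j = 0" if "n \<le> j" for j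
        using D(6)[of i j] D(2)[of i] D(3)[of i] that by (cases "i < n") auto
      moreover have "c i j \<in> {-1, 0, 1}" for j by (rule D(5))
      ultimately show ?thesis by simp
    qed
    moreover have "c i = (\<lambda>_. 0)" if "n \<le> i" for i
    proof
      fix j show "c i j = 0" using D(6)[of i j] D(3)[of i] that by auto
    qed
    ultimately have "c \<in> ?C" by (simp only: mem_Collect_eq lessThan_iff not_less) blast
    then show "x \<in> ?A \<times> ?C" using \<open>r \<in> ?A\<close> rc by blast
  qed
  then show ?thesis using fin finite_subset by blast
qed

section \<open>Recurrences for the numbers of graphs\<close>

lemma inj_on_prepend_half:
  assumes "3 \<le> k" "k < n"
  shows "inj_on (prepend_half n e k) (mono_graphs (n - k) e)"
proof (rule inj_on_inverseI[of _ "suffix_graph k"])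
  fix s assume s: "s \<in> mono_graphs (n - k) e"
  obtain r c where "s = (r, c)" by (metis surj_pair)
  then show "suffix_graph k (prepend_half n e k s) = s"
    using suffix_graph_prepend_half[OF mono_graphsD(1)[of r c "n - k" e]] s assms by simp
qed

lemma half_start_r0:
  assumes "half_start n e t r c" "e = 1 \<or> e = -1"
  shows "r 0 = t"
  using half_start_facts(1)[OF assms, of 0] assms(1) by (simp add: half_start_def)

lemma half_graphs_eq:
  assumes e: "e = 1 \<or> e = -1"
  shows "half_graphs n e = (\<Union>k\<in>{3..<n}. prepend_half n e k ` mono_graphs (n - k) e)"
proof (intro equalityI subsetI)
  fix x assume "x \<in> half_graphs n e"
  then obtain r c t where x: "x = (r, c)" and h: "half_start n e t r c" unfolding half_graphs_def by auto
  then have t: "2 \<le> t" by (simp add: half_start_def)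
  obtain k s where ks: "k = 2 * t - 1 \<or> k = 2 * t" "k < n" "s \<in> mono_graphs (n - k) e" "(r, c)
      = prepend_half n e k s"
    using half_start_peel[OF h e] by blast
  then have "k \<in> {3..<n}" using t by auto
  then show "x \<in> (\<Union>k\<in>{3..<n}. prepend_half n e k ` mono_graphs (n - k) e)" using ks x by blast
next
  fix x assume "x \<in> (\<Union>k\<in>{3..<n}. prepend_half n e k ` mono_graphs (n - k) e)"
  then obtain k r' c' where k: "3 \<le> k" "k < n" and Q: "(r', c') \<in> mono_graphs (n - k) e" and x: "x
      = prepend_half n e k (r', c')"
    by auto
  obtain r c where rc: "(r, c) = prepend_half n e k (r', c')" by (metis surj_pair)
  have "k = 2 * ((k + 1) div 2) - 1 \<or> k = 2 * ((k + 1) div 2)" "2 \<le> (k + 1) div 2" using k by presburger+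
  from half_start_prepend_half[OF Q k(2) e this rc] show "x \<in> half_graphs n e"
    using x rc unfolding half_graphs_def by auto
qed

lemma prepend_half_r:
  assumes "(r, c) = prepend_half n e k (r', c')" "3 \<le> k" "k < n"
  shows "r 0 = (k + 1) div 2" "r ((k + 1) div 2) = k + r' 0" "k \<le> i \<Longrightarrow> i < n \<Longrightarrow> r i = k + r' (i - k)"
proof -
  have "(k + 1) div 2 < k" "0 < (k + 1) div 2" using assms(2) by presburger+
  then show "r 0 = (k + 1) div 2" "r ((k + 1) div 2) = k + r' 0"
    "k \<le> i \<Longrightarrow> i < n \<Longrightarrow> r i = k + r' (i - k)"
    using assms(1,3) by (auto simp: prepend_half_def Let_def)
qed

text \<open>\<open>r 0\<close> reveals \<open>t\<close>, which leaves \<open>k = 2 * t - 1\<close>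
  against \<open>l = 2 * t\<close>. These differ in whether \<open>2 * t\<close> has the same last
  neighbour as \<open>t\<close>.\<close>

lemma prepend_half_disjoint:
  assumes k: "3 \<le> k" "k < l" "l < n"
  shows "prepend_half n e k ` mono_graphs (n - k) e \<inter> prepend_half n e l ` mono_graphs (n - l) e = {}"
proof (rule ccontr)
  assume "\<not> ?thesis"
  then obtain s1 s2 where s: "s1 \<in> mono_graphs (n - k) e" "s2 \<in> mono_graphs (n - l) e"
      "prepend_half n e k s1 = prepend_half n e l s2"
    by blast
  obtain r1 c1 r2 c2 where "s1 = (r1, c1)" "s2 = (r2, c2)" by (metis surj_pair)
  then have Q: "(r1, c1) \<in> mono_graphs (n - k) e" "(r2, c2) \<in> mono_graphs (n - l) e"
    and eq: "prepend_half n e k (r1, c1) = prepend_half n e l (r2, c2)" using s by auto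
  obtain r c where rc: "(r, c) = prepend_half n e k (r1, c1)" by (metis surj_pair)
  then have rc': "(r, c) = prepend_half n e l (r2, c2)" using eq by simp
  have kn: "k < n" "3 \<le> l" using k by auto
  note K = prepend_half_r[OF rc k(1) kn(1)] and L = prepend_half_r[OF rc' kn(2) k(3)]
  have t: "(k + 1) div 2 = (l + 1) div 2" using K(1) L(1) by simp
  then have lk: "l = Suc k" using k by presburger
  have "r k = k + r1 0" "r l = k + r1 1" using K(3)[of k] K(3)[of l] lk kn k by auto
  moreover have "r l = l + r2 0" using L(3)[of l] k by simp
  moreover have "r1 0 < r1 1" using mono_r0_less(1)[OF Q(1)] lk k by simp
  moreover have "k + r1 0 = l + r2 0" using K(2) L(2) t by simp
  ultimately show False by simp
qed

text \<open>\<open>m = n\<close> counts all half starts and \<open>m = n - 1\<close> those without a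
  universal vertex.\<close>

lemma card_UN_prepend_half:
  assumes "m \<le> n"
  shows "card (\<Union>k\<in>{3..<m}. prepend_half n e k ` mono_graphs (n - k) e)
      = (\<Sum>k\<in>{3..<m}. card (mono_graphs (n - k) e))"
proof -
  have "card (\<Union>k\<in>{3..<m}. prepend_half n e k ` mono_graphs (n - k) e)
      = (\<Sum>k\<in>{3..<m}. card (prepend_half n e k ` mono_graphs (n - k) e))"
  proof (rule card_UN_disjoint)
    show "\<forall>k\<in>{3..<m}. \<forall>l\<in>{3..<m}. k \<noteq> l \<longrightarrow>
        prepend_half n e k ` mono_graphs (n - k) e \<inter> prepend_half n e l ` mono_graphs (n - l) e = {}"
    proof (intro ballI impI)
      fix k l assume "k \<in> {3..<m}" "l \<in> {3..<m}" "k \<noteq> l"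
      then show "prepend_half n e k ` mono_graphs (n - k) e \<inter> prepend_half n e l ` mono_graphs (n - l) e = {}"
        using prepend_half_disjoint[of k l n e] prepend_half_disjoint[of l k n e] assms
        by (cases "k < l") auto
    qed
  qed (simp_all add: finite_mono_graphs)
  also have "\<dots> = (\<Sum>k\<in>{3..<m}. card (mono_graphs (n - k) e))"
    by (rule sum.cong) (use assms in \<open>auto intro!: card_image inj_on_prepend_half\<close>)
  finally show ?thesis .
qed

lemma card_half_graphs:
  assumes e: "e = 1 \<or> e = -1"
  shows "card (half_graphs n e) = (\<Sum>k\<in>{3..<n}. card (mono_graphs (n - k) e))"
  using card_UN_prepend_half[of n n e] by (simp add: half_graphs_eq[OF e])

lemma finite_half_graphs: "e = 1 \<or> e = -1 \<Longrightarrow> finite (half_graphs n e)"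
  by (simp add: half_graphs_eq finite_mono_graphs)

text \<open>In a half start \<open>r 0\<close> equals \<open>t\<close>, so the number of neighbours
  of the new vertex can be read off the graph.\<close>

definition prepend_to_half :: "nat \<Rightarrow> int \<Rightarrow> (nat \<Rightarrow> nat) \<times> (nat \<Rightarrow> nat \<Rightarrow> int) \<Rightarrow> (nat \<Rightarrow> nat) \<times> (nat \<Rightarrow> nat \<Rightarrow> int)" where
  "prepend_to_half n e s = prepend n (fst s 0) e s"

lemma mono_graphs_eq:
  assumes e: "e = 1 \<or> e = -1" and n: "3 \<le> n"
  shows "mono_graphs n e = prepend (n - 1) 1 e ` mono_graphs (n - 1) (-e)
      \<union> prepend_two (n - 2) e ` mono_graphs (n - 2) (-e)
    \<union> prepend_to_half (n - 1) e ` half_graphs (n - 1) e"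
proof (intro equalityI subsetI)
  fix x assume x: "x \<in> mono_graphs n e"
  obtain r c where rc: "x = (r, c)" by (metis surj_pair)
  note g = mono_graphsD(1)[OF x[unfolded rc]] and mono = mono_graphsD(3)[OF x[unfolded rc]]
  have n1: "Suc (n - 1) = n" "n - 1 = Suc (n - 2)" using n by auto
  have g1: "sgraph (Suc (n - 1)) r c" unfolding n1(1) by (rule g)
  have z: "prepend (n - 1) (r 0) e (suffix_graph 1 (r, c)) = (r, c)"
    by (rule prepend_suffix_graph[OF g1]) (use mono n in auto)
  have n2: "2 \<le> n" using n by simp
  from mono_peel[OF x[unfolded rc] n2 e]
  show "x \<in> prepend (n - 1) 1 e ` mono_graphs (n - 1) (-e) \<union> prepend_two (n - 2) e ` mono_graphs (n - 2) (-e)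
    \<union> prepend_to_half (n - 1) e ` half_graphs (n - 1) e"
  proof (elim disjE conjE)
    assume "r 0 = 1" "suffix_graph 1 (r, c) \<in> mono_graphs (n - 1) (- e)"
    then show ?thesis using z rc by (metis UnI1 image_eqI)
  next
    assume a: "r 0 = 1" "r 1 = r 2" "suffix_graph 2 (r, c) \<in> mono_graphs (n - 2) (- e)"
    define r1 where "r1 = (\<lambda>i. r (i + 1) - 1)"
    define c1 where "c1 = (\<lambda>i j. c (i + 1) (j + 1))"
    have s1: "suffix_graph 1 (r, c) = (r1, c1)" by (simp add: suffix_graph_def r1_def c1_def)
    have g1: "sgraph (n - 1) r1 c1" unfolding r1_def c1_def by (rule sgraph_suffix[OF g]) (use n in simp)
    have "suffix_graph 1 (r1, c1) = suffix_graph 2 (r, c)"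
      by (auto simp: suffix_graph_def r1_def c1_def fun_eq_iff numeral_2_eq_2)
    moreover have "prepend (n - 2) (r1 0) (-e) (suffix_graph 1 (r1, c1)) = (r1, c1)"
    proof (rule prepend_suffix_graph)
      show "sgraph (Suc (n - 2)) r1 c1" using g1 n1 by simp
      fix j assume "0 < j" "j \<le> r1 0"
      then show "c1 0 j = - e"
        using sgraphD(7)[OF g, of 0 1 "Suc j"] mono[of 1] a(1) by (simp add: c1_def r1_def)
    qed (use n in simp)
    moreover have "Suc (fst (suffix_graph 2 (r, c)) 0) = r1 0"
    proof -
      have "2 \<le> r 2" using sgraph_ge[OF g, of 2] n by simp
      then show ?thesis using a(2) by (simp add: suffix_graph_def r1_def numeral_2_eq_2)
    qed
    ultimately have "prepend_two (n - 2) e (suffix_graph 2 (r, c)) = (r, c)"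
      using z s1 a(1) n1 by (simp add: prepend_two_def)
    then show ?thesis using a(3) rc by (metis UnI1 UnI2 image_eqI)
  next
    assume a: "2 \<le> r 0" "half_start (n - 1) e (r 0) (fst (suffix_graph 1 (r, c))) (snd (suffix_graph 1 (r, c)))"
    then have "fst (suffix_graph 1 (r, c)) 0 = r 0" using half_start_r0[OF _ e] by blast
    then have "prepend_to_half (n - 1) e (suffix_graph 1 (r, c)) = (r, c)" using z
        by (simp add: prepend_to_half_def)
    moreover have "suffix_graph 1 (r, c) \<in> half_graphs (n - 1) e" using a(2) by (auto simp: half_graphs_def)
    ultimately show ?thesis using rc by (metis UnI2 image_eqI)
  qed
next
  fix x assume "x \<in> prepend (n - 1) 1 e ` mono_graphs (n - 1) (-e)
      \<union> prepend_two (n - 2) e ` mono_graphs (n - 2) (-e)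
    \<union> prepend_to_half (n - 1) e ` half_graphs (n - 1) e"
  then show "x \<in> mono_graphs n e"
  proof (elim UnE imageE)
    fix s assume s: "x = prepend (n - 1) 1 e s" "s \<in> mono_graphs (n - 1) (-e)"
    obtain r c R C where rc: "s = (r, c)" "x = (R, C)" by (metis surj_pair)
    show ?thesis using prepend_mono[of r c "n - 1" e R C] s rc n e by simp
  next
    fix s assume s: "x = prepend_two (n - 2) e s" "s \<in> mono_graphs (n - 2) (-e)"
    obtain r c R C where rc: "s = (r, c)" "x = (R, C)" by (metis surj_pair)
    have "Suc (Suc (n - 2)) = n" using n by simp
    then show ?thesis using prepend_two_mono(1)[of r c "n - 2" e R C] s rc e by simp
  next
    fix s assume s: "x = prepend_to_half (n - 1) e s" "s \<in> half_graphs (n - 1) e"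
    obtain r c R C where rc: "s = (r, c)" "x = (R, C)" by (metis surj_pair)
    obtain t where t: "half_start (n - 1) e t r c" using s rc by (auto simp: half_graphs_def)
    then have "r 0 = t" using half_start_r0 e by blast
    then show ?thesis using mono_prepend_half_start[OF t e, of R C] s rc n by (simp add: prepend_to_half_def)
  qed
qed

text \<open>The three images are told apart by \<open>r 0\<close> and by whether
  \<open>r 1 < r 2\<close>. A shared vertex flips the sign of the remainder, a half graph keeps
  it.\<close>

lemma card_mono_graphs_rec:
  assumes e: "e = 1 \<or> e = -1" and n: "3 \<le> n"
  shows "card (mono_graphs n e) = card (mono_graphs (n - 1) (-e)) + card (mono_graphs (n - 2) (-e)) +
      card (half_graphs (n - 1) e)"
proof -
  let ?A = "prepend (n - 1) 1 e ` mono_graphs (n - 1) (-e)" and ?B =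
      "prepend_two (n - 2) e ` mono_graphs (n - 2) (-e)"
    and ?C = "prepend_to_half (n - 1) e ` half_graphs (n - 1) e"
  have A: "fst x 0 = 1 \<and> fst x 1 < fst x 2" if x: "x \<in> ?A" for x
  proof -
    obtain r c where s: "x = prepend (n - 1) 1 e (r, c)" "(r, c) \<in> mono_graphs (n - 1) (-e)" using x by auto
    have "2 \<le> n - 1" using n by simp
    note r = mono_r0_less(1)[OF s(2) this]
    show ?thesis unfolding s(1) prepend_def using r n by simp
  qed
  have B: "fst x 0 = 1 \<and> fst x 1 = fst x 2" if x: "x \<in> ?B" for x
  proof -
    obtain r c where s: "x = prepend_two (n - 2) e (r, c)" "(r, c) \<in> mono_graphs (n - 2) (-e)" using x by auto
    obtain R C where "x = (R, C)" by (metis surj_pair)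
    then show ?thesis using prepend_two_mono[OF s(2) e, of R C] s by simp
  qed
  have C: "2 \<le> fst x 0" if x: "x \<in> ?C" for x
  proof -
    obtain r c where s: "x = prepend_to_half (n - 1) e (r, c)" "(r, c) \<in> half_graphs (n - 1) e" using x by auto
    then have "2 \<le> r 0" by (auto simp: half_graphs_def half_start_def)
    then show ?thesis using s(1) by (simp add: prepend_to_half_def prepend_def)
  qed
  have AB: "?A \<inter> ?B = {}"
  proof (rule equals0I)
    fix x assume x: "x \<in> ?A \<inter> ?B"
    show False using A[OF IntD1[OF x]] B[OF IntD2[OF x]] by simp
  qed
  have ABC: "(?A \<union> ?B) \<inter> ?C = {}"
  proof (rule equals0I)
    fix x assume x: "x \<in> (?A \<union> ?B) \<inter> ?C"
    from IntD1[OF x] have "fst x 0 = 1" using A B by (elim UnE) blast+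
    then show False using C[OF IntD2[OF x]] by simp
  qed
  have "inj_on (prepend (n - 1) 1 e) (mono_graphs (n - 1) (-e))"
  proof (rule inj_on_inverseI[of _ "suffix_graph 1"])
    fix s assume s: "s \<in> mono_graphs (n - 1) (-e)"
    obtain r c where "s = (r, c)" by (metis surj_pair)
    then show "suffix_graph 1 (prepend (n - 1) 1 e s) = s"
      using suffix_graph_prepend[OF mono_graphsD(1), of r c "n - 1" "-e" 1 e] s by (simp only:)
  qed
  moreover have "inj_on (prepend_two (n - 2) e) (mono_graphs (n - 2) (-e))"
  proof (rule inj_on_inverseI[of _ "suffix_graph 2"])
    fix s assume s: "s \<in> mono_graphs (n - 2) (-e)"
    obtain r c R C where "s = (r, c)" "prepend_two (n - 2) e s = (R, C)" by (metis surj_pair)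
    then show "suffix_graph 2 (prepend_two (n - 2) e s) = s" using prepend_two_mono(4)[of r c
        "n - 2" e R C] s e by simp
  qed
  moreover have "inj_on (prepend_to_half (n - 1) e) (half_graphs (n - 1) e)"
  proof (rule inj_on_inverseI[of _ "suffix_graph 1"])
    fix s assume s: "s \<in> half_graphs (n - 1) e"
    obtain r c where "s = (r, c)" by (metis surj_pair)
    then show "suffix_graph 1 (prepend_to_half (n - 1) e s) = s"
      using suffix_graph_prepend[of "n - 1" r c] s by (auto simp: half_graphs_def half_start_def
          prepend_to_half_def)
  qed
  ultimately show ?thesis
    unfolding mono_graphs_eq[OF assms]
    using finite_half_graphs[OF e, of "n - 1"] AB ABC
    by (simp add: card_Un_disjoint finite_mono_graphs card_image)
qed

lemma mono_graphs_1: "mono_graphs 1 e = {(\<lambda>_. 0, \<lambda>_ _. 0)}"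
proof (intro equalityI subsetI)
  fix x assume x: "x \<in> mono_graphs 1 e"
  obtain r c where rc: "x = (r, c)" by (metis surj_pair)
  note D = sgraphD[OF mono_graphsD(1)[OF x[unfolded rc]]]
  have r: "r i = 0" for i using D(2,3)[of i] by (cases i) auto
  have "c i j = 0" for i j using D(6)[of i j] r[of i] by auto
  then show "x \<in> {(\<lambda>_. 0, \<lambda>_ _. 0)}" using r rc by auto
qed (auto simp: mono_graphs_def sgraph_def twinfree_def)

lemma mono_graphs_0: "mono_graphs 0 e = {}"
  by (auto simp: mono_graphs_def sgraph_def)

lemma mono_graphs_2: "mono_graphs 2 e = {}"
proof -
  have False if "(r, c) \<in> mono_graphs 2 e" for r c
    using mono_r0_less[OF that] by simp
  then show ?thesis by auto
qed

text \<open>Reversing all signs is a symmetry; the recurrence respects it, so induction replaces an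
  explicit bijection.\<close>

lemma card_mono_graphs_sign:
  assumes "e = 1 \<or> e = -1"
  shows "card (mono_graphs n e) = card (mono_graphs n 1)"
  using assms
proof (induction n arbitrary: e rule: less_induct)
  case (less n)
  have H: "card (half_graphs (n - 1) e) = card (half_graphs (n - 1) 1)" if "3 \<le> n"
  proof -
    have "card (mono_graphs (n - 1 - k) e) = card (mono_graphs (n - 1 - k) 1)" if "k \<in> {3..<n - 1}" for k
      by (rule less.IH[OF _ less.prems]) (use that in auto)
    then show ?thesis unfolding card_half_graphs[OF less.prems] card_half_graphs[of 1, simplified]
      by (intro sum.cong) auto
  qed
  consider "n = 0" | "n = 1" | "n = 2" | "3 \<le> n" by linarith
  then show ?case
  proof cases
    case 4
    have s: "card (mono_graphs m (-e)) = card (mono_graphs m (-1))" if "m < n" for m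
    proof -
      have "card (mono_graphs m (-e)) = card (mono_graphs m 1)"
        by (rule less.IH[OF that]) (use less.prems in auto)
      moreover have "card (mono_graphs m (-1)) = card (mono_graphs m 1)"
        by (rule less.IH[OF that]) simp
      ultimately show ?thesis by simp
    qed
    have "card (mono_graphs n e) = card (mono_graphs (n - 1) (-1)) + card (mono_graphs (n - 2) (-1)) +
        card (half_graphs (n - 1) 1)"
      using card_mono_graphs_rec[OF less.prems 4] s[of "n - 1"] s[of "n - 2"] H[OF 4] 4 by simp
    also have "\<dots> = card (mono_graphs n 1)"
      using card_mono_graphs_rec[of 1 n] 4 by simp
    finally show ?thesis .
  qed (simp_all add: mono_graphs_0 mono_graphs_1[unfolded One_nat_def] mono_graphs_2)
qed

text \<open>
  The last condition excludes a vertex \<open>j\<close> adjacent to all others: then \<open>j \<le> r 0\<close> and \<open>r j = n - 1\<close>,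
  and conversely \<open>r 0\<close> is such a vertex if \<open>r (r 0) = n - 1\<close>.
\<close>

definition prime_graphs :: "nat \<Rightarrow> ((nat \<Rightarrow> nat) \<times> (nat \<Rightarrow> nat \<Rightarrow> int)) set" where
  "prime_graphs n = {(r, c). sgraph n r c \<and> twinfree n r \<and> r (r 0) < n - 1}"

section \<open>Classification by the first link\<close>

text \<open>The edges at \<open>0\<close>, except possibly the last one, are forced to agree. The
  sign of the last one then decides between a clique of one sign and a half graph that starts
  immediately.\<close>

lemma sgraph_dichotomy:
  assumes g: "sgraph n r c" and tf: "twinfree n r" and n: "2 \<le> n" 
  defines "e \<equiv> c 0 1"
  shows "e = 1 \<or> e = -1"
    and "(r, c) \<in> mono_graphs n e \<and> c 0 (r 0) = e \<or> half_start n e (r 0) r c \<and> c 0 (r 0) = - e"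
proof -
  note D = sgraphD[OF g]
  have v0: "0 < r 0" using D(4)[of 0] n by simp
  have vn: "r 0 < n" using D(2)[of 0] n by simp
  show e: "e = 1 \<or> e = -1" using D(5)[of 0 1] D(6)[of 0 1] v0 by (auto simp: e_def)
  have st: "r i < r (Suc i)" if "i < r 0" for i using twinfree_first[OF g tf that] .
  have stl: "r i < r j" if "i < j" "i < r 0" "j < n" for i j
    using st[of i] sgraph_mono[OF g, of "Suc i" j] that by simp
  \<comment> \<open>\<open>r j\<close> is a neighbour of \<open>j\<close> that neither
    \<open>0\<close> nor \<open>i\<close> sees.\<close>
  have tri: "c i j = c 0 j" if "0 < i" "i < j" "j \<le> r 0" for i j
  proof -
    have "r i < r j" "r 0 < r j" using stl[of i j] stl[of 0 j] that vn by auto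
    then have "c j (r j) = - c i j" "c j (r j) = - c 0 j"
      using that sgraph_mono[OF g, of 0 i] vn by (auto intro!: D(7))
    then show ?thesis by simp
  qed
  \<comment> \<open>\<open>z\<close> is a neighbour of \<open>1\<close> and of \<open>j\<close> that
    \<open>0\<close> does not see, and \<open>u\<close> is a neighbour of \<open>z\<close> that
    neither \<open>1\<close> nor \<open>j\<close> sees. Two alternations carry both
    \<open>c 0 1\<close> and \<open>c 0 j\<close> to \<open>c z u\<close>. As \<open>u\<close> is
    the last neighbour of \<open>r 0\<close>, the argument stops short of
    \<open>j = r 0\<close>.\<close>
  have const: "c 0 j = e" if j: "0 < j" "j < r 0" for j
  proof (cases "j = 1")
    case False
    define z where "z = r 1"
    define u where "u = r (r 0)"
    have zj: "z \<le> r j" using sgraph_mono[OF g, of 1 j] j vn z_def by simp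
    have ju: "r j < u" using stl[of j "r 0"] j vn u_def by simp
    have z0: "r 0 < z" using st[of 0] v0 z_def by simp
    have un: "u < n" using D(2) vn u_def by simp
    have uz: "u \<le> r z" using sgraph_mono[OF g, of "r 0" z] z0 zj ju un u_def by simp
    have "c 1 z = - c 0 1" using z0 z_def v0 by (intro D(7)) auto
    moreover have "c j z = - c 0 j" using z0 zj j by (intro D(7)) auto
    moreover have "c z u = - c 1 z" using uz zj ju z0 v0 z_def by (intro D(7)) auto
    moreover have "c z u = - c j z" using uz zj ju z0 j by (intro D(7)) auto
    ultimately show ?thesis by (simp add: e_def)
  qed (simp add: e_def)
  have "c 0 (r 0) \<in> {1, -1}" using D(5)[of 0 "r 0"] D(6)[of 0 "r 0"] v0 by auto
  then consider "c 0 (r 0) = e" | "c 0 (r 0) = - e" using e by auto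
  then show "(r, c) \<in> mono_graphs n e \<and> c 0 (r 0) = e \<or> half_start n e (r 0) r c \<and> c 0 (r 0) = - e"
  proof cases
    case 1
    then have "c 0 j = e" if "0 < j" "j \<le> r 0" for j using const[of j] that by (cases "j = r 0") auto
    then show ?thesis using 1 g tf by (auto simp: mono_graphs_def)
  next
    case 2
    have "r 0 \<noteq> 1" using 2 e by (auto simp: e_def)
    then have t: "2 \<le> r 0" using v0 by simp
    have "c i j = (if j < r 0 then e else - e)" if a: "i < r 0" "i < j" "j \<le> r i" for i j
    proof (cases "i = 0")
      case True
      then show ?thesis using a const[of j] 2 by auto
    next
      case False
      consider "j < r 0" | "j = r 0" | "r 0 < j" by linarith
      then show ?thesis
      proof cases
        case 3
        have "c i j = - c 0 i" by (rule D(7)) (use 3 a False in auto)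
        then show ?thesis using const[of i] a 3 False by simp
      qed (use tri[of i j] const[of j] a 2 False in auto)
    qed
    then have "half_start n e (r 0) r c"
      unfolding half_start_def using g t st twinfreeD[OF tf] by auto
    then show ?thesis using 2 by simp
  qed
qed

text \<open>Only \<open>t - 1\<close> and \<open>t\<close> could be twins. The former ends at
  \<open>2 * t - 1\<close>; if the second clique does not reach the end of the graph, vertex
  \<open>2 * t - 1\<close> and hence \<open>t\<close> has a later neighbour.\<close>

lemma half_start_simple:
  assumes h: "half_start n e t r c" and e: "e = 1 \<or> e = -1" and s: "r (r 0) < n - 1"
  shows "twinfree n r"
  unfolding twinfree_def
proof (intro allI impI)
  fix i assume i: "Suc i < n"
  have g: "sgraph n r c" and t: "2 \<le> t"
    and inc: "\<And>i. Suc i < t \<Longrightarrow> r i < r (Suc i)"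
    and tw: "\<And>i. t \<le> i \<Longrightarrow> Suc i < n \<Longrightarrow> r i < r (Suc i) \<or> (\<exists>k<i. r k = i)"
    using h unfolding half_start_def by blast+
  note F = half_start_facts[OF h e]
  have r0: "r 0 = t" by (rule half_start_r0[OF h e])
  show "r i < r (Suc i) \<or> (\<exists>k<i. r k = i)"
  proof (cases "i < t")
    case True
    show ?thesis
    proof (cases "Suc i < t")
      case False
      then have it: "Suc i = t" using True by simp
      have rl: "r (2 * t - 1) = r t" using F(3)[of "2 * t - 1"] t by simp
      have "2 * t - 1 \<le> r (2 * t - 1)" using sgraph_ge[OF g, of "2 * t - 1"] F(2) t by simp
      then have "Suc (2 * t - 1) < n" using rl s r0 by simp
      then have "2 * t - 1 < r t" using sgraphD(4)[OF g, of "2 * t - 1"] rl by simp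
      then have "r i < r t" using F(1)[OF True] it by linarith
      then show ?thesis using it by simp
    qed (use inc in blast)
  qed (use tw i in auto)
qed

lemma prime_graphs_eq:
  assumes n: "4 \<le> n"
  shows "prime_graphs n = (\<Union>e\<in>{1, -1}. {(r, c) \<in> mono_graphs n e. r (r 0) < n - 1}
      \<union> {(r, c) \<in> half_graphs n e. r (r 0) < n - 1})"
    (is "_ = ?R")
proof (intro equalityI subsetI)
  fix x assume x: "x \<in> prime_graphs n"
  obtain r c where rc: "x = (r, c)" by (metis surj_pair)
  have p: "sgraph n r c" "twinfree n r" "r (r 0) < n - 1" using x rc by (auto simp: prime_graphs_def)
  define e where "e = c 0 1"
  have "2 \<le> n" using n by simp
  note d = sgraph_dichotomy[OF p(1,2) this, folded e_def]
  from d(2) have "(r, c) \<in> mono_graphs n e \<or> (r, c) \<in> half_graphs n e" by (auto simp: half_graphs_def)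
  then have "(r, c) \<in> {(r, c) \<in> mono_graphs n e. r (r 0) < n - 1} \<union> {(r, c) \<in> half_graphs n e. r (r 0) < n - 1}"
    using p(3) by auto
  moreover have "e \<in> {1, -1}" using d(1) by auto
  ultimately show "x \<in> ?R" using rc by blast
next
  fix x assume x: "x \<in> ?R"
  obtain r c where rc: "x = (r, c)" by (metis surj_pair)
  from x obtain e :: int where e: "e = 1 \<or> e = -1" and s: "r (r 0) < n - 1"
    and or: "(r, c) \<in> mono_graphs n e \<or> (r, c) \<in> half_graphs n e" using rc by auto
  from or show "x \<in> prime_graphs n"
  proof
    assume "(r, c) \<in> mono_graphs n e" then show ?thesis using s rc by (auto simp: prime_graphs_def mono_graphs_def)
  next
    assume "(r, c) \<in> half_graphs n e"
    then obtain t where t: "half_start n e t r c" by (auto simp: half_graphs_def)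
    then show ?thesis using half_start_simple[OF t e s] s rc by (auto simp: prime_graphs_def half_start_def)
  qed
qed

text \<open>Together with \<open>half_signs\<close>: the signs of the first and of the last edge at
  \<open>0\<close> distinguish the four classes that make up \<open>prime_graphs\<close>.\<close>

lemma mono_signs:
  assumes "(r, c) \<in> mono_graphs n e" "2 \<le> n"
  shows "c 0 1 = e" "c 0 (r 0) = e"
  using mono_r0_less[OF assms] mono_graphsD(3)[OF assms(1)] by auto

lemma half_signs:
  assumes "(r, c) \<in> half_graphs n e" and e: "e = 1 \<or> e = -1"
  shows "c 0 1 = e" "c 0 (r 0) = - e"
proof -
  obtain t where h: "half_start n e t r c" using assms by (auto simp: half_graphs_def)
  have t: "2 \<le> t" "r 0 = t" using half_start_r0[OF h e] h by (auto simp: half_start_def)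
  have ce: "\<And>i j. i < t \<Longrightarrow> i < j \<Longrightarrow> j \<le> r i \<Longrightarrow> c i j = (if j < t then e else - e)"
    using h unfolding half_start_def by blast
  show "c 0 1 = e" "c 0 (r 0) = - e" using ce[of 0 1] ce[of 0 t] t by auto
qed

text \<open>\<open>r (r 0) = k + r' 0\<close> reaches \<open>n - 1\<close> only if the first vertex
  of the remainder sees all of it, and then the remainder is a single vertex. So one graph per sign
  is lost, the chain consisting of a single link.\<close>

lemma card_half_simple:
  assumes e: "e = 1 \<or> e = -1" and n: "4 \<le> n"
  shows "card (half_graphs n e) = Suc (card {(r, c) \<in> half_graphs n e. r (r 0) < n - 1})"
proof -
  have "{(r, c) \<in> half_graphs n e. r (r 0) < n - 1} = (\<Union>k\<in>{3..<n - 1}. prepend_half n e k ` mono_graphs (n - k) e)"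
  proof (intro equalityI subsetI)
    fix x assume x: "x \<in> {(r, c) \<in> half_graphs n e. r (r 0) < n - 1}"
    then obtain k r' c' where k: "k \<in> {3..<n}" "(r', c') \<in> mono_graphs (n - k) e" "x = prepend_half n e k (r', c')"
      unfolding half_graphs_eq[OF e] by auto
    obtain r c where rc: "x = (r, c)" by (metis surj_pair)
    have kk: "3 \<le> k" "k < n" "(r, c) = prepend_half n e k (r', c')" using k rc by auto
    note hr = prepend_half_r[OF kk(3,1,2)]
    have "k + r' 0 < n - 1" using x rc hr by simp
    then have "k \<in> {3..<n - 1}" using k by auto
    then show "x \<in> (\<Union>k\<in>{3..<n - 1}. prepend_half n e k ` mono_graphs (n - k) e)" using k by blast
  next
    fix x assume x: "x \<in> (\<Union>k\<in>{3..<n - 1}. prepend_half n e k ` mono_graphs (n - k) e)"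
    then obtain k r' c' where k: "k \<in> {3..<n - 1}" "(r', c') \<in> mono_graphs (n - k) e" "x
        = prepend_half n e k (r', c')"
      by auto
    obtain r c where rc: "x = (r, c)" by (metis surj_pair)
    have kk: "3 \<le> k" "k < n" "(r, c) = prepend_half n e k (r', c')" using k rc by auto
    note hr = prepend_half_r[OF kk(3,1,2)]
    have "2 \<le> n - k" using k by auto
    from mono_r0_less(3)[OF k(2) this] have "r (r 0) < n - 1" using hr by simp
    moreover have "k \<in> {3..<n}" using kk by simp
    then have "x \<in> half_graphs n e" unfolding half_graphs_eq[OF e] using k by blast
    ultimately show "x \<in> {(r, c) \<in> half_graphs n e. r (r 0) < n - 1}" using rc by simp
  qed
  then have "card {(r, c) \<in> half_graphs n e. r (r 0) < n - 1} = (\<Sum>k\<in>{3..<n - 1}. card (mono_graphs (n - k) e))"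
    using card_UN_prepend_half[of "n - 1" n e] by simp
  moreover have "{3..<n} = insert (n - 1) {3..<n - 1}" using n by auto
  then have "card (half_graphs n e) = card (mono_graphs (n - (n - 1)) e) + (\<Sum>k\<in>{3..<n - 1}. card
      (mono_graphs (n - k) e))"
    unfolding card_half_graphs[OF e] by simp
  moreover have "n - (n - 1) = 1" using n by simp
  ultimately show ?thesis using mono_graphs_1[of e] by simp
qed

text \<open>A shared vertex in front excludes universal vertices. With a half graph in front,
  \<open>r (r 0) = n - 1\<close> forces \<open>n = 2 * t + 1\<close>: one vertex in front of a half
  graph on \<open>t + t\<close> vertices and nothing behind it.\<close>

lemma card_mono_simple:
  assumes e: "e = 1 \<or> e = -1" and n: "4 \<le> n"
  shows "card (mono_graphs n e) = card {(r, c) \<in> mono_graphs n e. r (r 0) < n - 1} + (if odd n then 1 else 0)"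
proof -
  let ?o = "(\<lambda>_. 0, \<lambda>_ _. 0) :: (nat \<Rightarrow> nat) \<times> (nat \<Rightarrow> nat \<Rightarrow> int)"
  let ?b = "prepend_to_half (n - 1) e (prepend_half (n - 1) e (n - 2) ?o)"
  let ?B = "{(r, c) \<in> mono_graphs n e. \<not> r (r 0) < n - 1}"
  have nk: "3 \<le> n - 2 \<and> n - 2 < n - 1 \<and> (n - 2 + 1) div 2 = (n - 1) div 2" if "odd n"
    using that n by presburger
  have "?B = (if odd n then {?b} else {})"
  proof -
    have b: "odd n \<and> x = ?b" if x: "x \<in> ?B" for x
    proof -
      obtain r c where rc: "x = (r, c)" by (metis surj_pair)
      have Q: "(r, c) \<in> mono_graphs n e" and s: "\<not> r (r 0) < n - 1" using x rc by auto
      note g = mono_graphsD(1)[OF Q] and mono = mono_graphsD(3)[OF Q]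
      have n2: "2 \<le> n" using n by simp
      note r0 = mono_r0_less[OF Q n2]
      have rr: "r (r 0) = n - 1" using s sgraphD(2)[OF g, of "r 0"] r0 by linarith
      from mono_peel[OF Q n2 e] show ?thesis
      proof (elim disjE conjE)
        assume "r 0 = 1" "r 1 < r 2"
        then show ?thesis using rr sgraphD(2)[OF g, of 2] n by simp
      next
        assume a: "r 0 = 1" "r 1 = r 2" "suffix_graph 2 (r, c) \<in> mono_graphs (n - 2) (- e)"
        obtain r2 c2 where s2: "suffix_graph 2 (r, c) = (r2, c2)" by (metis surj_pair)
        then have "r2 0 = r 2 - 2" by (auto simp: suffix_graph_def numeral_2_eq_2)
        moreover have "2 \<le> n - 2" using n by simp
        note mono_r0_less(3)[OF a(3)[unfolded s2] this]
        ultimately show ?thesis using rr a by simp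
      next
        assume h: "half_start (n - 1) e (r 0) (fst (suffix_graph 1 (r, c))) (snd (suffix_graph 1 (r, c)))"
        define t where "t = r 0"
        obtain r1 c1 where s1: "suffix_graph 1 (r, c) = (r1, c1)" by (metis surj_pair)
        have h1: "half_start (n - 1) e t r1 c1" using h s1 t_def by simp
        have t: "2 \<le> t" using h1 by (simp add: half_start_def)
        have "r1 (t - 1) = n - 2" using s1 rr t t_def by (auto simp: suffix_graph_def)
        moreover have "r1 (t - 1) = t + (t - 1)" using half_start_facts(1)[OF h1 e, of "t - 1"] t by simp
        ultimately have nt: "n = 2 * t + 1" using t n by simp
        obtain k s where ks: "k = 2 * t - 1 \<or> k = 2 * t" "k < n - 1" "s \<in> mono_graphs (n - 1 - k) e"
            "(r1, c1) = prepend_half (n - 1) e k s"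
          using half_start_peel[OF h1 e] by blast
        \<comment> \<open>The alternative \<open>k = 2 * t\<close> would leave no vertex for the
          remainder.\<close>
        have k: "k = n - 2" using ks(1,2) nt by auto
        then have "n - 1 - k = 1" using n by simp
        then have "s = ?o" using ks(3) mono_graphs_1[of e] by simp
        then have s1': "suffix_graph 1 (r, c) = prepend_half (n - 1) e (n - 2) ?o" using ks(4) s1 k by simp
        have "(r, c) = prepend (n - 1) (r 0) e (suffix_graph 1 (r, c))"
          by (rule prepend_suffix_graph[symmetric]) (use g mono n in auto)
        moreover have "fst (suffix_graph 1 (r, c)) 0 = r 0" using half_start_r0[OF h1 e] s1 t_def by simp
        ultimately have "(r, c) = ?b" unfolding prepend_to_half_def s1'[symmetric] by simp
        then show ?thesis using nt rc by simp
      qed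
    qed
    moreover have bB: "?b \<in> ?B" if "odd n"
    proof -
      have o: "?o \<in> mono_graphs (n - 1 - (n - 2)) e" using mono_graphs_1[of e] n
          by (simp add: Suc_diff_Suc numeral_2_eq_2)
      have m: "n - 2 \<in> {3..<n - 1}" using nk[OF that] by simp
      have "prepend_half (n - 1) e (n - 2) ?o \<in> half_graphs (n - 1) e"
        unfolding half_graphs_eq[OF e] using m o by blast
      then have H: "?b \<in> prepend_to_half (n - 1) e ` half_graphs (n - 1) e" by (rule imageI)
      have "3 \<le> n" using n by simp
      from UnI2[OF H] have Q: "?b \<in> mono_graphs n e" unfolding mono_graphs_eq[OF e \<open>3 \<le> n\<close>] .
      obtain r c where rc: "(r, c) = prepend_half (n - 1) e (n - 2) ?o" by (metis surj_pair)
      define t where "t = (n - 1) div 2"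
      have nt: "n = 2 * t + 1" "2 \<le> t" using that n t_def by presburger+
      have "r 0 = t" using prepend_half_r(1)[OF rc] nk[OF that] t_def by simp
      moreover have "r (t - 1) = 2 * t - 1"
      proof -
        have "(n - 2 + 1) div 2 = t" using nk[OF that] t_def by simp
        then show ?thesis using rc nt by (simp add: prepend_half_def Let_def)
      qed
      ultimately have "fst ?b (fst ?b 0) = n - 1"
        unfolding rc[symmetric] prepend_to_half_def prepend_def using nt by simp
      moreover obtain r' c' where "?b = (r', c')" by (metis surj_pair)
      ultimately show ?thesis using Q by simp
    qed
    ultimately show ?thesis
    proof (cases "odd n")
      case True
      have "?B = {?b}"
      proof (intro equalityI subsetI)
        fix x assume x: "x \<in> ?B"
        show "x \<in> {?b}" by (rule ssubst[OF conjunct2[OF b[OF x]]]) (rule singletonI)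
      next
        fix x assume "x \<in> {?b}"
        then have "x = ?b" by (rule singletonD)
        then show "x \<in> ?B" by (rule ssubst) (rule bB[OF True])
      qed
      then show ?thesis using True by (simp only: if_True not_False_eq_True)
    next
      case False
      have "?B = {}"
      proof (rule equals0I)
        fix x assume "x \<in> ?B"
        from conjunct1[OF b[OF this]] False show False by contradiction
      qed
      then show ?thesis using False by (simp only: if_False)
    qed
  qed
  then have "card ?B = (if odd n then 1 else 0)" by simp
  moreover have "mono_graphs n e = {(r, c) \<in> mono_graphs n e. r (r 0) < n - 1} \<union> ?B" by auto
  moreover have "card ({(r, c) \<in> mono_graphs n e. r (r 0) < n - 1} \<union> ?B)
      = card {(r, c) \<in> mono_graphs n e. r (r 0) < n - 1} + card ?B"
  proof (rule card_Un_disjoint)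
    show "finite {(r, c) \<in> mono_graphs n e. r (r 0) < n - 1}" "finite ?B"
      by (rule finite_subset[OF _ finite_mono_graphs[of n e]]; blast)+
  qed blast
  ultimately show ?thesis by simp
qed

text \<open>The factor \<open>2\<close> is the sign of the edge from \<open>0\<close> to
  \<open>1\<close>; the subtracted terms are the single-link chains.\<close>

lemma card_prime_graphs:
  assumes n: "4 \<le> n"
  shows "int (card (prime_graphs n)) =
    2 * (int (card (mono_graphs n 1)) + int (card (half_graphs n 1)) - 1 - (if odd n then 1 else 0))"
proof -
  let ?Q = "\<lambda>e. {(r, c) \<in> mono_graphs n e. r (r 0) < n - 1}"
  let ?H = "\<lambda>e. {(r, c) \<in> half_graphs n e. r (r 0) < n - 1}"
  have n2: "2 \<le> n" using n by simp
  have finQ: "finite (?Q e)" for e by (rule finite_subset[OF _ finite_mono_graphs[of n e]]) auto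
  have finH: "finite (?H e)" if "e = 1 \<or> e = -1" for e
      by (rule finite_subset[OF _ finite_half_graphs[OF that, of n]]) auto
  have sQ: "snd x 0 1 = e \<and> snd x 0 (fst x 0) = e" if "x \<in> ?Q e" for x e
    using that mono_signs[OF _ n2] by auto
  have sH: "snd x 0 1 = e \<and> snd x 0 (fst x 0) = - e" if "x \<in> ?H e" "e = 1 \<or> e = -1" for x e
    using that(1) half_signs[OF _ that(2)] by auto
  have QH: "?Q e \<inter> ?H e = {}" if e: "e = 1 \<or> e = -1" for e
  proof (rule equals0I)
    fix x assume x: "x \<in> ?Q e \<inter> ?H e"
    show False using sQ[OF IntD1[OF x]] sH[OF IntD2[OF x] e] e by auto
  qed
  have c: "card (?Q e \<union> ?H e) = card (?Q e) + card (?H e)" if "e = 1 \<or> e = -1" for e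
    by (rule card_Un_disjoint[OF finQ finH[OF that] QH[OF that]])
  have sgn: "snd x 0 1 = e" if "x \<in> ?Q e \<union> ?H e" "e = 1 \<or> e = -1" for x e
    using that(1) sQ[of x e] sH[OF _ that(2), of x] by (elim UnE) blast+
  have disj: "(?Q 1 \<union> ?H 1) \<inter> (?Q (-1) \<union> ?H (-1)) = {}"
  proof (rule equals0I)
    fix x assume x: "x \<in> (?Q 1 \<union> ?H 1) \<inter> (?Q (-1) \<union> ?H (-1))"
    show False using sgn[OF IntD1[OF x]] sgn[OF IntD2[OF x]] by simp
  qed
  have "prime_graphs n = (?Q 1 \<union> ?H 1) \<union> (?Q (-1) \<union> ?H (-1))"
    unfolding prime_graphs_eq[OF n] by simp
  then have "card (prime_graphs n) = card (?Q 1 \<union> ?H 1) + card (?Q (-1) \<union> ?H (-1))"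
    using card_Un_disjoint[OF _ _ disj] finQ finH by simp
  also have "\<dots> = card (?Q 1) + card (?H 1) + (card (?Q (-1)) + card (?H (-1)))"
    using c[of 1] c[of "-1"] by simp
  finally have P: "card (prime_graphs n) = \<dots>" .
  have q: "card (mono_graphs n 1) = card (?Q 1) + (if odd n then 1 else 0)"
    "card (mono_graphs n 1) = card (?Q (-1)) + (if odd n then 1 else 0)"
    using card_mono_simple[OF _ n, of 1] card_mono_simple[OF _ n, of "-1"] card_mono_graphs_sign[of "-1" n] by auto
  have "card (half_graphs n (-1)) = card (half_graphs n 1)"
    unfolding card_half_graphs[of 1, simplified] card_half_graphs[of "-1", simplified]
    by (intro sum.cong) (use card_mono_graphs_sign[of "-1"] in auto)
  then have h: "card (half_graphs n 1) = Suc (card (?H 1))" "card (half_graphs n 1) = Suc (card (?H (-1)))"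
    using card_half_simple[OF _ n, of 1] card_half_simple[OF _ n, of "-1"] by auto
  show ?thesis using P q h by (auto split: if_splits)
qed

section \<open>Patterns and intervals in terms of positions\<close>

lemma subseq_obtain_index:
  assumes "subseq s p"
  obtains f where "\<And>i. i < length s \<Longrightarrow> f i < length p \<and> s ! i = p ! f i"
    "\<And>i j. i < j \<Longrightarrow> j < length s \<Longrightarrow> f i < (f j :: nat)"
proof -
  have "\<exists>f. (\<forall>i<length s. f i < length p \<and> s ! i = p ! f i) \<and> (\<forall>i j. i < j \<longrightarrow> j < length s \<longrightarrow> f i < (f j :: nat))"
    using assms
  proof (induction rule: list_emb.induct)
    case (list_emb_Nil ys)
    then show ?case by simp
  next
    case (list_emb_Cons xs ys y)
    then obtain f where f: "\<forall>i<length xs. f i < length ys \<and> xs ! i = ys ! f i"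
      "\<forall>i j. i < j \<longrightarrow> j < length xs \<longrightarrow> f i < (f j :: nat)" by blast
    show ?case by (rule exI[of _ "\<lambda>i. Suc (f i)"]) (use f in auto)
  next
    case (list_emb_Cons2 x y xs ys)
    then obtain f where f: "\<forall>i<length xs. f i < length ys \<and> xs ! i = ys ! f i"
      "\<forall>i j. i < j \<longrightarrow> j < length xs \<longrightarrow> f i < (f j :: nat)" by blast
    show ?case
    proof (intro exI[of _ "\<lambda>i. case i of 0 \<Rightarrow> 0 | Suc m \<Rightarrow> Suc (f m)"] conjI allI impI)
      fix i assume "i < length (x # xs)"
      then show "(case i of 0 \<Rightarrow> 0 | Suc m \<Rightarrow> Suc (f m)) < length (y # ys)"
        using f by (auto split: nat.split)
    next
      fix i assume "i < length (x # xs)"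
      then show "(x # xs) ! i = (y # ys) ! (case i of 0 \<Rightarrow> 0 | Suc m \<Rightarrow> Suc (f m))"
        using f list_emb_Cons2 by (auto split: nat.split)
    next
      fix i j assume "i < j" "j < length (x # xs)"
      then show "(case i of 0 \<Rightarrow> 0 | Suc m \<Rightarrow> Suc (f m)) < (case j of 0 \<Rightarrow> 0 | Suc m \<Rightarrow> Suc (f m))"
        using f by (auto split: nat.split)
    qed
  qed
  then show ?thesis using that by blast
qed

lemma subseq_map_nth:
  assumes "sorted_wrt (<) is" "\<forall>i\<in>set is. i < length p"
  shows "subseq (map ((!) p) is) p"
proof -
  have "is = filter (\<lambda>i. i \<in> set is) [0..<length p]"
    by (rule sorted_distinct_set_unique)
      (use assms in \<open>auto simp: strict_sorted_iff intro: sorted_filter[of id, simplified]\<close>)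
  then have "subseq is [0..<length p]" by (metis subseq_filter_left)
  then have "subseq (map ((!) p) is) (map ((!) p) [0..<length p])" by (rule subseq_map)
  then show ?thesis by (simp add: map_nth)
qed

lemma all_less_4: "(\<forall>i<4. P i) \<longleftrightarrow> P 0 \<and> P 1 \<and> P 2 \<and> P (3 :: nat)"
  by (auto simp: eval_nat_numeral less_Suc_eq)

lemma avoids_4:
  "avoids p [t0, t1, t2, t3] \<longleftrightarrow> \<not> (\<exists>a b c d. a < b \<and> b < c \<and> c < d \<and> d < length p \<and>
     order_isomorphic [p ! a, p ! b, p ! c, p ! d] [t0, t1, t2, t3])"
proof -
  have "(\<exists>s. subseq s p \<and> order_isomorphic s [t0, t1, t2, t3]) \<longleftrightarrow> (\<exists>a b c d. a < b \<and> b < c \<and> c < d \<and> d < length p \<and>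
     order_isomorphic [p ! a, p ! b, p ! c, p ! d] [t0, t1, t2, t3])" (is "?L \<longleftrightarrow> ?R")
  proof
    assume ?L
    then obtain s where s: "subseq s p" "order_isomorphic s [t0, t1, t2, t3]" by blast
    then have l: "length s = 4" by (simp add: order_isomorphic_def)
    from subseq_obtain_index[OF s(1)] obtain f where
      f: "\<And>i. i < length s \<Longrightarrow> f i < length p \<and> s ! i = p ! f i"
         "\<And>i j. i < j \<Longrightarrow> j < length s \<Longrightarrow> f i < (f j :: nat)" by blast
    have "s = [s ! 0, s ! 1, s ! 2, s ! 3]"
      by (rule nth_equalityI) (auto simp: l eval_nat_numeral less_Suc_eq)
    also have "\<dots> = [p ! f 0, p ! f 1, p ! f 2, p ! f 3]" using f(1) l by simp
    finally have "order_isomorphic [p ! f 0, p ! f 1, p ! f 2, p ! f 3] [t0, t1, t2, t3]" using s(2) by simp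
    moreover have "f 0 < f 1" "f 1 < f 2" "f 2 < f 3" "f 3 < length p" using f l by auto
    ultimately show ?R by blast
  next
    assume ?R
    then obtain a b c d where abcd: "a < b" "b < c" "c < d" "d < length p"
      "order_isomorphic [p ! a, p ! b, p ! c, p ! d] [t0, t1, t2, t3]" by blast
    have "subseq (map ((!) p) [a, b, c, d]) p" by (rule subseq_map_nth) (use abcd in auto)
    then show ?L using abcd(5) by auto
  qed
  then show ?thesis by (simp add: avoids_def)
qed

lemma order_isomorphic_4:
  "order_isomorphic [a, b, c, d] [2, 3, 4, 1] \<longleftrightarrow> d < a \<and> a < b \<and> b < c"
  "order_isomorphic [a, b, c, d] [4, 1, 2, 3] \<longleftrightarrow> b < c \<and> c < d \<and> d < a"
  "order_isomorphic [a, b, c, d] [3, 4, 1, 2] \<longleftrightarrow> c < d \<and> d < a \<and> a < b"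
proof -
  have l: "length [x, y, z, w :: nat] = 4" for x y z w by simp
  show "order_isomorphic [a, b, c, d] [2, 3, 4, 1] \<longleftrightarrow> d < a \<and> a < b \<and> b < c"
    "order_isomorphic [a, b, c, d] [4, 1, 2, 3] \<longleftrightarrow> b < c \<and> c < d \<and> d < a"
    "order_isomorphic [a, b, c, d] [3, 4, 1, 2] \<longleftrightarrow> c < d \<and> d < a \<and> a < b"
    unfolding order_isomorphic_def l all_less_4
    by (simp_all add: nth_Cons_numeral) linarith+
qed

text \<open>The patterns are exactly the permutations whose inversion graph is a claw or a 4-cycle.\<close>

definition claw_C4_free :: "nat list \<Rightarrow> bool" where
  "claw_C4_free p \<longleftrightarrow> avoids p [2,3,4,1] \<and> avoids p [4,1,2,3] \<and> avoids p [3,4,1,2]"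

lemma claw_C4_free_iff:
  "claw_C4_free p \<longleftrightarrow>
     \<not> (\<exists>a b c d. a < b \<and> b < c \<and> c < d \<and> d < length p \<and> p ! d < p ! a \<and> p ! a < p ! b \<and> p ! b < p ! c) \<and>
     \<not> (\<exists>a b c d. a < b \<and> b < c \<and> c < d \<and> d < length p \<and> p ! b < p ! c \<and> p ! c < p ! d \<and> p ! d < p ! a) \<and>
     \<not> (\<exists>a b c d. a < b \<and> b < c \<and> c < d \<and> d < length p \<and> p ! c < p ! d \<and> p ! d < p ! a \<and> p ! a < p ! b)"
  unfolding claw_C4_free_def avoids_4 order_isomorphic_4 by (rule refl)

lemma is_permD:
  assumes "is_perm p"
  shows "distinct p" "set p = {1..length p}" "inj_on ((!) p) {..<length p}"
    "(!) p ` {..<length p} = {1..length p}"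
proof -
  show d: "distinct p" and s: "set p = {1..length p}"
    using assms by (auto simp: is_perm_def permutations_of_set_def)
  show "inj_on ((!) p) {..<length p}" using d by (simp add: inj_on_nth)
  show "(!) p ` {..<length p} = {1..length p}" using s by (auto simp: set_conv_nth)
qed

text \<open>Intervals become sets of positions that no outside entry splits, by position or by
  value; contiguity follows. In this form they translate directly into modules of the inversion
  graph.\<close>

lemma simple_perm_iff:
  assumes "is_perm p"
  shows "simple_perm p \<longleftrightarrow> (\<forall>I\<subseteq>{..<length p}. 2 \<le> card I \<longrightarrow>
     (\<forall>x\<in>{..<length p} - I. ((\<forall>y\<in>I. x < y) \<or> (\<forall>y\<in>I. y < x)) \<and> ((\<forall>y\<in>I. p ! x < p ! y) \<or> (\<forall>y\<in>I. p ! y < p ! x))) \<longrightarrow>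
     I = {..<length p})" (is "_ \<longleftrightarrow> ?R")
proof
  note P = is_permD[OF assms]
  assume simp: "simple_perm p"
  show ?R
  proof (intro allI impI)
    fix I assume I: "I \<subseteq> {..<length p}" "2 \<le> card I" 
      and sep: "\<forall>x\<in>{..<length p} - I. ((\<forall>y\<in>I. x < y) \<or> (\<forall>y\<in>I. y < x)) \<and> ((\<forall>y\<in>I. p ! x < p ! y)
          \<or> (\<forall>y\<in>I. p ! y < p ! x))"
    have fin: "finite I" using I finite_subset by blast
    have ne: "I \<noteq> {}" using I by auto
    define a where "a = Min I"
    define b where "b = Max I"
    have ab: "a \<in> I" "b \<in> I" "\<And>x. x \<in> I \<Longrightarrow> a \<le> x \<and> x \<le> b" using fin ne by (auto simp: a_def b_def)
    have bl: "b < length p" using ab I by auto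
    have Iab: "I = {a..b}"
    proof
      show "{a..b} \<subseteq> I"
      proof
        fix x assume x: "x \<in> {a..b}"
        show "x \<in> I"
        proof (rule ccontr)
          assume "x \<notin> I"
          then have "(\<forall>y\<in>I. x < y) \<or> (\<forall>y\<in>I. y < x)" using sep x bl by auto
          then have "x < a \<or> b < x" using ab(1,2) by blast
          then show False using x by simp
        qed
      qed
    qed (use ab in auto)
    define s where "s = take (Suc b - a) (drop a p)"
    have "s = map ((!) p) [a..<Suc b]"
      using bl by (intro nth_equalityI) (auto simp: s_def simp del: upt_Suc)
    then have ss: "set s = (!) p ` I" using Iab by (auto simp: atLeastLessThanSuc_atLeastAtMost simp del: upt_Suc)
    have ls: "length s = card I" using Iab bl by (simp add: s_def)
    have "sublist s p" unfolding s_def using sublist_take sublist_drop sublist_order.order.trans by blast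
    define lo where "lo = Min ((!) p ` I)"
    define hi where "hi = Max ((!) p ` I)"
    have lh: "lo \<in> (!) p ` I" "hi \<in> (!) p ` I" "\<And>v. v \<in> (!) p ` I \<Longrightarrow> lo \<le> v \<and> v \<le> hi"
      using fin ne by (auto simp: lo_def hi_def)
    have "(!) p ` I = {lo..hi}"
    proof
      show "{lo..hi} \<subseteq> (!) p ` I"
      proof
        fix v assume v: "v \<in> {lo..hi}"
        have "(!) p ` I \<subseteq> {1..length p}" using image_mono[OF I(1), of "(!) p"] P(4) by simp
        then have "lo \<in> {1..length p}" "hi \<in> {1..length p}" using lh(1,2) by blast+
        then have "v \<in> {1..length p}" using v by simp
        then have "v \<in> (!) p ` {..<length p}" unfolding P(4) .
        then obtain x where x: "x < length p" "v = p ! x" by blast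
        show "v \<in> (!) p ` I"
        proof (rule ccontr)
          assume nv: "v \<notin> (!) p ` I"
          then have "x \<notin> I" using x by auto
          then have "(\<forall>y\<in>I. p ! x < p ! y) \<or> (\<forall>y\<in>I. p ! y < p ! x)" using sep x by auto
          then have "(\<forall>w\<in>(!) p ` I. v < w) \<or> (\<forall>w\<in>(!) p ` I. w < v)" using x by blast
          then have "v < lo \<or> hi < v" using lh(1,2) by blast
          then show False using v by simp
        qed
      qed
    qed (use lh in auto)
    then have "is_interval_of s p"
      unfolding is_interval_of_def using ss \<open>sublist s p\<close> ne by auto
    then have "s = p \<or> length s = 1" using simp by (simp add: simple_perm_def)
    then have "card I = length p" using ls I by auto
    then show "I = {..<length p}" using I by (intro card_subset_eq) auto
  qed
next
  note P = is_permD[OF assms]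
  assume R: ?R
  show "simple_perm p"
    unfolding simple_perm_def
  proof (intro conjI allI impI assms)
    fix s assume "is_interval_of s p"
    then obtain ps ss lo hi where s: "s \<noteq> []" "p = ps @ s @ ss" "set s = {lo..hi}"
      by (auto simp: is_interval_of_def sublist_def)
    define I where "I = {length ps..<length ps + length s}"
    have I: "I \<subseteq> {..<length p}" "card I = length s" using s by (auto simp: I_def)
    have "set s = (!) p ` I"
    proof -
      have "(!) p ` I = (\<lambda>i. p ! (length ps + i)) ` {..<length s}"
      proof -
        have "I = (+) (length ps) ` {0..<length s}" unfolding I_def image_add_atLeastLessThan
            by (simp add: add.commute)
        then show ?thesis by (simp only: image_image lessThan_atLeast0)
      qed
      also have "\<dots> = (!) s ` {..<length s}" by (rule image_cong) (auto simp: s nth_append)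
      also have "\<dots> = set s" by (auto simp: set_conv_nth)
      finally show ?thesis by simp
    qed
    then have v: "(!) p ` I = {lo..hi}" using s by simp
    show "s = p \<or> length s = 1"
    proof (cases "2 \<le> card I")
      case True
      have "I = {..<length p}"
      proof (rule R[rule_format, OF I(1) True])
        fix x assume x: "x \<in> {..<length p} - I"
        then have "p ! x \<notin> (!) p ` I" using P(3) I(1) by (auto simp: inj_on_def)
        then have out: "p ! x < lo \<or> hi < p ! x" using v by auto
        have "lo \<le> p ! y \<and> p ! y \<le> hi" if "y \<in> I" for y using v imageI[OF that, of "(!) p"] by simp
        then have "(\<forall>y\<in>I. p ! x < p ! y) \<or> (\<forall>y\<in>I. p ! y < p ! x)"
          using out by (meson order_le_less_trans order_less_le_trans)
        moreover have "(\<forall>y\<in>I. x < y) \<or> (\<forall>y\<in>I. y < x)" using x by (auto simp: I_def)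
        ultimately show "((\<forall>y\<in>I. x < y) \<or> (\<forall>y\<in>I. y < x)) \<and> ((\<forall>y\<in>I. p ! x < p ! y) \<or> (\<forall>y\<in>I. p ! y < p ! x))"
          by blast
      qed
      then have "length s = length p" using I(2) by simp
      then show ?thesis using s(2) by simp
    next
      case False
      moreover have "0 < length s" using s(1) by simp
      ultimately have "length s = 1" using I(2) by linarith
      then show ?thesis ..
    qed
  qed
qed

text \<open>Positions and values can thus be recovered from comparisons alone.\<close>

lemma rank_eq:
  fixes f :: "nat \<Rightarrow> nat"
  assumes "bij_betw f {..<n} {m..<m + n}" "i < n"
  shows "f i = m + card {j \<in> {..<n}. f j < f i}"
proof -
  have im: "f ` {..<n} = {m..<m + n}" and inj: "inj_on f {..<n}" using assms(1) by (auto simp: bij_betw_def)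
  have fi: "f i \<in> {m..<m + n}" using im assms(2) by blast
  have "f ` {j \<in> {..<n}. f j < f i} = {m..<f i}"
  proof -
    have "{m..<f i} \<subseteq> f ` {j \<in> {..<n}. f j < f i}"
    proof
      fix v assume v: "v \<in> {m..<f i}"
      then have "v \<in> f ` {..<n}" using im fi by simp
      then show "v \<in> f ` {j \<in> {..<n}. f j < f i}" using v by auto
    qed
    moreover have "f j \<in> {m..<m + n}" if "j < n" for j using im that by blast
    ultimately show ?thesis by auto
  qed
  moreover have "card (f ` {j \<in> {..<n}. f j < f i}) = card {j \<in> {..<n}. f j < f i}"
    by (rule card_image) (use inj in \<open>auto simp: inj_on_def\<close>)
  ultimately have "f i - m = card {j \<in> {..<n}. f j < f i}" by simp
  then show ?thesis using fi by (metis atLeastLessThan_iff le_add_diff_inverse)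
qed

section \<open>From graphs to permutations\<close>

text \<open>\<open>s i\<close> is the position of vertex \<open>i\<close>, and
  \<open>p ! s i\<close> is its value.\<close>

definition represents :: "nat \<Rightarrow> (nat \<Rightarrow> nat \<Rightarrow> int) \<Rightarrow> nat list \<Rightarrow> (nat \<Rightarrow> nat) \<Rightarrow> bool" where
  "represents n c p s \<longleftrightarrow> bij_betw s {..<n} {..<n} \<and>
     (\<forall>i j. i < j \<longrightarrow> j < n \<longrightarrow> (s i < s j \<longleftrightarrow> 0 \<le> c i j) \<and> (p ! s i < p ! s j \<longleftrightarrow> c i j \<le> 0))"

definition sgraph_adj :: "(nat \<Rightarrow> nat) \<Rightarrow> nat \<Rightarrow> nat \<Rightarrow> bool" where
  "sgraph_adj r i j \<longleftrightarrow> i < j \<and> j \<le> r i \<or> j < i \<and> i \<le> r j"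

text \<open>The assumptions exclude both kinds of cyclic triangles, so the tournament is a linear
  order, and \<open>f\<close> counts predecessors.\<close>

lemma tournament_rank:
  fixes F :: "nat \<Rightarrow> nat \<Rightarrow> bool"
  assumes t1: "\<And>i j k. i < j \<Longrightarrow> j < k \<Longrightarrow> k < n \<Longrightarrow> F i j \<Longrightarrow> F j k \<Longrightarrow> F i k"
    and t2: "\<And>i j k. i < j \<Longrightarrow> j < k \<Longrightarrow> k < n \<Longrightarrow> \<not> F i j \<Longrightarrow> \<not> F j k \<Longrightarrow> \<not> F i k"
  obtains f where "bij_betw f {..<n} {..<n}" "\<And>i j. i < j \<Longrightarrow> j < n \<Longrightarrow> f i < f j \<longleftrightarrow> F i j"
proof -
  define R where "R i j = (if i < j then F i j else j < i \<and> \<not> F j i)" for i j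
  have tr: "R i k" if "R i j" "R j k" "i < n" "j < n" "k < n" for i j k
  proof -
    have ne: "i \<noteq> j" "j \<noteq> k" using that by (auto simp: R_def)
    have "i \<noteq> k" using that by (auto simp: R_def split: if_splits)
    then consider "i < j" "j < k" | "i < k" "k < j" | "j < i" "i < k" | "j < k" "k < i" | "k < i" "i < j"
        | "k < j" "j < i"
      using ne by linarith
    then show ?thesis
    proof cases
      case 1 then show ?thesis using that t1[of i j k] by (simp add: R_def)
    next
      case 2 then show ?thesis using that t2[of i k j] by (auto simp: R_def)
    next
      case 3 then show ?thesis using that t2[of j i k] by (auto simp: R_def)
    next
      case 4 then show ?thesis using that t1[of j k i] by (auto simp: R_def)
    next
      case 5 then show ?thesis using that t1[of k i j] by (auto simp: R_def)
    next
      case 6 then show ?thesis using that t2[of k j i] by (simp add: R_def)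
    qed
  qed
  have tot: "R i j \<longleftrightarrow> \<not> R j i" if "i \<noteq> j" for i j using that by (auto simp: R_def)
  have irr: "\<not> R i i" for i by (simp add: R_def)
  define f where "f i = card {j \<in> {..<n}. R j i}" for i
  have lt: "f i < f j" if "R i j" "i < n" "j < n" for i j
    unfolding f_def
  proof (rule psubset_card_mono)
    have "{k \<in> {..<n}. R k i} \<subseteq> {k \<in> {..<n}. R k j}" using that tr by blast
    moreover have "i \<in> {k \<in> {..<n}. R k j}" "i \<notin> {k \<in> {..<n}. R k i}" using that irr by auto
    ultimately show "{k \<in> {..<n}. R k i} \<subset> {k \<in> {..<n}. R k j}" by blast
  qed simp
  have "f i < n" if "i < n" for i
  proof -
    have "f i < card {..<n}" unfolding f_def by (rule psubset_card_mono) (use that irr in auto)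
    then show ?thesis by simp
  qed
  then have im: "f ` {..<n} \<subseteq> {..<n}" by auto
  have inj: "inj_on f {..<n}"
  proof (rule inj_onI)
    fix i j assume "i \<in> {..<n}" "j \<in> {..<n}" "f i = f j"
    then show "i = j" using lt[of i j] lt[of j i] tot[of i j] by auto
  qed
  have "bij_betw f {..<n} {..<n}"
    using inj endo_inj_surj[OF _ im inj] by (simp add: bij_betw_def)
  moreover have "f i < f j \<longleftrightarrow> F i j" if "i < j" "j < n" for i j
  proof -
    have F: "R i j \<longleftrightarrow> F i j" and n: "i < n" "i \<noteq> j" using that by (simp_all add: R_def)
    show ?thesis
    proof (cases "R i j")
      case True then show ?thesis using lt[OF True n(1) that(2)] F by simp
    next
      case False
      then have "R j i" using tot[OF n(2)] by simp
      then show ?thesis using lt[of j i] n(1) that(2) False F by simp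
    qed
  qed
  ultimately show ?thesis using that by blast
qed

lemma represents_exists:
  assumes g: "sgraph n r c"
  obtains p s where "is_perm p" "length p = n" "represents n c p s"
proof -
  note D = sgraphD[OF g]
  \<comment> \<open>For a triple \<open>i < j < k\<close>: alternation, transitivity inside a
    clique, and the umbrella property. Together they exclude cyclic triangles in both tournaments
    \<open>0 \<le> c i j\<close> and \<open>c i j \<le> 0\<close>.\<close>
  have cyc: "c i k \<noteq> 0 \<or> c i j = 0 \<or> c j k = 0 \<or> c j k = - c i j"
    "c i k = 0 \<or> c i j \<noteq> c j k \<or> c i k = c i j" "c i k = 0 \<or> c i j \<noteq> 0 \<and> c j k \<noteq> 0"
    if "i < j" "j < k" "k < n" for i j k
  proof -
    have m: "r i \<le> r j" using sgraph_mono[OF g, of i j] that by simp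
    show "c i k \<noteq> 0 \<or> c i j = 0 \<or> c j k = 0 \<or> c j k = - c i j"
      using D(7)[of i j k] D(6)[of i k] D(6)[of i j] D(6)[of j k] that by force
    show "c i k = 0 \<or> c i j \<noteq> c j k \<or> c i k = c i j"
      using D(8)[of i j k] D(6)[of i k] that by force
    show "c i k = 0 \<or> c i j \<noteq> 0 \<and> c j k \<noteq> 0"
      using D(6)[of i k] D(6)[of i j] D(6)[of j k] that m by force
  qed
  have v: "c i j = -1 \<or> c i j = 0 \<or> c i j = 1" for i j using D(5)[of i j] by auto
  obtain s where s: "bij_betw s {..<n} {..<n}" "\<And>i j. i < j \<Longrightarrow> j < n \<Longrightarrow> s i < s j \<longleftrightarrow> 0 \<le> c i j"
  proof (rule tournament_rank[of n "\<lambda>i j. 0 \<le> c i j"])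
    fix i j k assume a: "i < j" "j < k" "k < n"
    show "0 \<le> c i j \<Longrightarrow> 0 \<le> c j k \<Longrightarrow> 0 \<le> c i k" "\<not> 0 \<le> c i j \<Longrightarrow> \<not> 0 \<le> c j k \<Longrightarrow> \<not> 0 \<le> c i k"
      using cyc[OF a] v[of i j] v[of j k] v[of i k] by auto
  qed blast
  obtain t where t: "bij_betw t {..<n} {..<n}" "\<And>i j. i < j \<Longrightarrow> j < n \<Longrightarrow> t i < t j \<longleftrightarrow> c i j \<le> 0"
  proof (rule tournament_rank[of n "\<lambda>i j. c i j \<le> 0"])
    fix i j k assume a: "i < j" "j < k" "k < n"
    show "c i j \<le> 0 \<Longrightarrow> c j k \<le> 0 \<Longrightarrow> c i k \<le> 0" "\<not> c i j \<le> 0 \<Longrightarrow> \<not> c j k \<le> 0 \<Longrightarrow> \<not> c i k \<le> 0"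
      using cyc[OF a] v[of i j] v[of j k] v[of i k] by auto
  qed blast
  define u where "u = the_inv_into {..<n} s"
  have u: "bij_betw u {..<n} {..<n}" unfolding u_def by (rule bij_betw_the_inv_into[OF s(1)])
  have us: "u (s i) = i" if "i < n" for i
    using the_inv_into_f_f[of s "{..<n}" i] s(1) that by (simp add: u_def bij_betw_def)
  define p where "p = map (\<lambda>x. Suc (t (u x))) [0..<n]"
  have lp: "length p = n" by (simp add: p_def)
  have "set p = Suc ` (t ` (u ` {..<n}))" by (auto simp: p_def image_iff)
  also have "\<dots> = {1..n}" using u t(1) by (simp add: bij_betw_def image_Suc_lessThan)
  finally have sp: "set p = {1..n}" .
  then have "distinct p" by (intro card_distinct) (simp add: lp)
  then have "is_perm p" using sp lp by (simp add: is_perm_def permutations_of_set_def)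
  moreover have "p ! s i = Suc (t i)" if "i < n" for i
  proof -
    have "s i < n" using s(1) that by (auto simp: bij_betw_def)
    then show ?thesis using us[OF that] by (simp add: p_def)
  qed
  then have "represents n c p s" unfolding represents_def using s t(2) by auto
  ultimately show ?thesis using that lp by blast
qed

lemma represents_bij:
  assumes "is_perm p" "length p = n" "represents n c p s"
  shows "bij_betw s {..<n} {..<n}" "bij_betw (\<lambda>i. p ! s i) {..<n} {1..n}"
proof -
  show s: "bij_betw s {..<n} {..<n}" using assms(3) by (simp add: represents_def)
  have "bij_betw ((!) p) {..<n} {1..n}" using is_permD(3,4)[OF assms(1)] assms(2) by (simp add: bij_betw_def)
  from bij_betw_trans[OF s this] show "bij_betw (\<lambda>i. p ! s i) {..<n} {1..n}" by (simp add: comp_def)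
qed

lemma represents_rank:
  assumes "is_perm p" "length p = n" "represents n c p s" "i < n"
  shows "s i = card {j \<in> {..<n}. s j < s i}" "p ! s i = Suc (card {j \<in> {..<n}. p ! s j < p ! s i})"
proof -
  have "bij_betw s {..<n} {0..<0 + n}" using represents_bij(1)[OF assms(1-3)] by (simp add: lessThan_atLeast0)
  from rank_eq[OF this assms(4)] show "s i = card {j \<in> {..<n}. s j < s i}" by simp
  have "{1..n} = {1..<1 + n}" by auto
  then have "bij_betw (\<lambda>i. p ! s i) {..<n} {1..<1 + n}" using represents_bij(2)[OF assms(1-3)] by simp
  from rank_eq[OF this assms(4)] show "p ! s i = Suc (card {j \<in> {..<n}. p ! s j < p ! s i})" by simp
qed

lemma represents_less:
  assumes "is_perm p" "length p = n" "represents n c p s" "i < n" "j < n"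
  shows "s i < s j \<longleftrightarrow> (if i < j then 0 \<le> c i j else j < i \<and> c j i < 0)"
    "p ! s i < p ! s j \<longleftrightarrow> (if i < j then c i j \<le> 0 else j < i \<and> 0 < c j i)"
proof -
  note b = represents_bij[OF assms(1-3)]
  have "s i \<noteq> s j" "p ! s i \<noteq> p ! s j" if "i \<noteq> j"
    using b that assms(4,5) by (auto simp: bij_betw_def inj_on_def)
  moreover have "i < j \<Longrightarrow> (s i < s j \<longleftrightarrow> 0 \<le> c i j) \<and> (p ! s i < p ! s j \<longleftrightarrow> c i j \<le> 0)"
    "j < i \<Longrightarrow> (s j < s i \<longleftrightarrow> 0 \<le> c j i) \<and> (p ! s j < p ! s i \<longleftrightarrow> c j i \<le> 0)"
    using assms(3-5) by (auto simp: represents_def)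
  moreover have "i < j \<or> i = j \<or> j < i" by linarith
  ultimately show "s i < s j \<longleftrightarrow> (if i < j then 0 \<le> c i j else j < i \<and> c j i < 0)"
    "p ! s i < p ! s j \<longleftrightarrow> (if i < j then c i j \<le> 0 else j < i \<and> 0 < c j i)"
    by (metis linorder_neqE_nat not_le less_asym less_irrefl)+
qed

lemma represents_perm_unique:
  assumes "is_perm p" "length p = n" "represents n c p s" "is_perm p'" "length p' = n" "represents n c p' s'"
  shows "p = p'"
proof -
  have s: "s i = s' i" "p ! s i = p' ! s' i" if "i < n" for i
  proof -
    have A: "{j \<in> {..<n}. s j < s i} = {j \<in> {..<n}. s' j < s' i}"
      and B: "{j \<in> {..<n}. p ! s j < p ! s i} = {j \<in> {..<n}. p' ! s' j < p' ! s' i}"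
      using represents_less[OF assms(1-3) _ that] represents_less[OF assms(4-6) _ that] by auto
    show "s i = s' i"
      by (rule trans[OF represents_rank(1)[OF assms(1-3) that] trans[OF arg_cong[OF A, of card]
          represents_rank(1)[OF assms(4-6) that, symmetric]]])
    show "p ! s i = p' ! s' i"
      by (rule trans[OF represents_rank(2)[OF assms(1-3) that]
            trans[OF arg_cong[OF B, of "\<lambda>S. Suc (card S)"] represents_rank(2)[OF assms(4-6) that, symmetric]]])
  qed
  show ?thesis
  proof (rule nth_equalityI)
    fix x assume "x < length p"
    then have "x \<in> s ` {..<n}" using represents_bij(1)[OF assms(1-3)] assms(2) by (simp add: bij_betw_def)
    then obtain i where "i < n" "x = s i" by auto
    then show "p ! x = p' ! x" using s[of i] by simp
  qed (use assms in simp)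
qed

text \<open>
  The order of the vertices can be recovered from the permutation: the sum of position and value increases
  along it. Indeed this sum counts each entry with weight \<open>2\<close> if it lies to the left and below and with
  weight \<open>1\<close> if it is inverted.
\<close>

definition weight :: "(nat \<Rightarrow> nat \<Rightarrow> int) \<Rightarrow> nat \<Rightarrow> nat \<Rightarrow> nat" where
  "weight c i j = (if j < i then (if c j i = 0 then 2 else 1) else if j = i then 0 else if c i j
      = 0 then 0 else 1)"

lemma represents_key:
  assumes "is_perm p" "length p = n" "represents n c p s" "i < n"
  shows "s i + p ! s i = Suc (\<Sum>j<n. weight c i j)"
proof -
  have c: "card {j \<in> {..<n}. P j} = (\<Sum>j<n. if P j then 1 else 0)" for P
    by (simp add: sum.If_cases Int_def conj_commute)
  have "s i + p ! s i = Suc (card {j \<in> {..<n}. s j < s i} + card {j \<in> {..<n}. p ! s j < p ! s i})"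
    using represents_rank[OF assms] by simp
  also have "\<dots> = Suc (\<Sum>j<n. (if s j < s i then 1 else 0) + (if p ! s j < p ! s i then 1 else 0))"
    unfolding c by (simp add: sum.distrib)
  also have "(\<Sum>j<n. (if s j < s i then 1 else 0) + (if p ! s j < p ! s i then 1 else 0)) = (\<Sum>j<n. weight c i j)"
    by (rule sum.cong) (use represents_less[OF assms(1-3) _ assms(4)] in \<open>auto simp: weight_def\<close>)
  finally show ?thesis .
qed

text \<open>It suffices to compare \<open>i\<close> with \<open>i + 1\<close>, which count each
  other with weight \<open>1\<close>. Every other vertex weighs at least as much for
  \<open>i + 1\<close> as for \<open>i\<close>, and a separating vertex weighs more.\<close>

lemma represents_key_less:
  assumes g: "sgraph n r c" and tf: "twinfree n r"
    and p: "is_perm p" "length p = n" "represents n c p s"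
    and ij: "i < j" "j < n"
  shows "s i + p ! s i < s j + p ! s j"
proof -
  note D = sgraphD[OF g]
  have Z: "c i j = 0 \<longleftrightarrow> \<not> (i < j \<and> j \<le> r i)" for i j using D(6)[of i j] by blast
  have step: "s i + p ! s i < s (Suc i) + p ! s (Suc i)" if i: "Suc i < n" for i
  proof -
    let ?A = "{..<n} - {i, Suc i}"
    have A: "{..<n} = insert i (insert (Suc i) ?A)" using i by auto
    have fin: "finite ?A" by simp
    have adj: "c i (Suc i) \<noteq> 0" using D(6)[of i "Suc i"] D(4)[OF i] by simp
    have split: "(\<Sum>j<n. weight c k j) = weight c k i + (weight c k (Suc i) + (\<Sum>j\<in>?A. weight c k j))" for k
      by (subst A, subst sum.insert) auto
    have mono: "r i \<le> r (Suc i)" using sgraph_mono[OF g, of i "Suc i"] i by simp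
    have "(\<Sum>j\<in>?A. weight c i j) < (\<Sum>j\<in>?A. weight c (Suc i) j)"
    proof (rule sum_strict_mono_ex1[OF fin])
      show "\<forall>j\<in>?A. weight c i j \<le> weight c (Suc i) j"
        using mono by (auto simp: weight_def Z)
      from twinfreeD[OF tf i] show "\<exists>j\<in>?A. weight c i j < weight c (Suc i) j"
      proof
        assume lt: "r i < r (Suc i)"
        have "r (Suc i) \<in> ?A" "Suc i < r (Suc i)"
          using lt D(4)[OF i] D(2)[OF i] by auto
        moreover have "weight c i (r (Suc i)) < weight c (Suc i) (r (Suc i))"
          using D(6)[of i "r (Suc i)"] D(6)[of "Suc i" "r (Suc i)"] lt calculation by (auto simp: weight_def)
        ultimately show ?thesis by blast
      next
        assume "\<exists>k<i. r k = i"
        then obtain k where k: "k < i" "r k = i" by blast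
        have "weight c i k < weight c (Suc i) k"
          using D(6)[of k i] D(6)[of k "Suc i"] k by (auto simp: weight_def)
        then show ?thesis using k i by (intro bexI[of _ k]) auto
      qed
    qed
    then have "(\<Sum>j<n. weight c i j) < (\<Sum>j<n. weight c (Suc i) j)"
      unfolding split[of i] split[of "Suc i"] using adj by (simp add: weight_def)
    then show ?thesis using represents_key[OF p, of i] represents_key[OF p, of "Suc i"] i by simp
  qed
  show ?thesis using ij
  proof (induction j)
    case (Suc j)
    then show ?case using step[of j] by (cases "i = j") auto
  qed simp
qed

text \<open>The rank of an entry by position plus value is its vertex number, so the permutation
  determines \<open>s\<close>, hence the signs, hence \<open>r\<close>.\<close>

lemma represents_graph_unique:
  assumes g: "sgraph n r c" "twinfree n r" and g': "sgraph n r' c'" "twinfree n r'"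
    and p: "is_perm p" "length p = n" and R: "represents n c p s" and R': "represents n c' p s'"
  shows "r = r' \<and> c = c'"
proof -
  define key where "key x = x + p ! x" for x
  have rank: "i = card {x \<in> {..<n}. key x < key (t i)}"
    if "sgraph n q d" "twinfree n q" "represents n d p t" "i < n" for q d t i
  proof -
    note b = represents_bij(1)[OF p that(3)]
    have "{x \<in> {..<n}. key x < key (t i)} = t ` {..<i}"
    proof (intro equalityI subsetI)
      fix x assume x: "x \<in> {x \<in> {..<n}. key x < key (t i)}"
      then have "x \<in> t ` {..<n}" using b by (simp add: bij_betw_def)
      then obtain j where j: "j < n" "x = t j" by auto
      have "\<not> i < j" "i \<noteq> j" using represents_key_less[OF that(1,2) p that(3), of i j] j x by (auto simp: key_def)
      then show "x \<in> t ` {..<i}" using j by auto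
    next
      fix x assume "x \<in> t ` {..<i}"
      then obtain j where j: "j < i" "x = t j" by auto
      then have "key x < key (t i)" using represents_key_less[OF that(1,2) p that(3), of j i] that(4)
          by (simp add: key_def)
      moreover have "x < n" using b j that(4) by (auto simp: bij_betw_def)
      ultimately show "x \<in> {x \<in> {..<n}. key x < key (t i)}" by simp
    qed
    moreover have "card (t ` {..<i}) = i"
      using b that(4) by (subst card_image) (auto simp: bij_betw_def inj_on_def)
    ultimately show ?thesis by simp
  qed
  have s: "s i = s' i" if i: "i < n" for i
  proof -
    have "s' i \<in> s ` {..<n}" using represents_bij(1)[OF p R] represents_bij(1)[OF p R'] i
        by (auto simp: bij_betw_def)
    then obtain j where j: "j < n" "s' i = s j" by auto
    have "i = j" using rank[OF g' R' i] rank[OF g R j(1)] j by simp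
    then show ?thesis using j by simp
  qed
  note D = sgraphD[OF g(1)] and D' = sgraphD[OF g'(1)]
  have c: "c i j = c' i j" for i j
  proof (cases "i < j \<and> j < n")
    case True
    have "s i < s j \<longleftrightarrow> 0 \<le> c i j" "p ! s i < p ! s j \<longleftrightarrow> c i j \<le> 0"
      "s' i < s' j \<longleftrightarrow> 0 \<le> c' i j" "p ! s' i < p ! s' j \<longleftrightarrow> c' i j \<le> 0"
      using R R' True by (simp_all add: represents_def)
    then have "0 \<le> c i j \<longleftrightarrow> 0 \<le> c' i j" "c i j \<le> 0 \<longleftrightarrow> c' i j \<le> 0"
      using s[of i] s[of j] True by simp_all
    then show ?thesis using D(5)[of i j] D'(5)[of i j] by auto
  next
    case False
    have "c i j = 0" using D(6)[of i j] D(2,3)[of i] False by (cases "i < n") auto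
    moreover have "c' i j = 0" using D'(6)[of i j] D'(2,3)[of i] False by (cases "i < n") auto
    ultimately show ?thesis by simp
  qed
  have "r i = r' i" for i
  proof (cases "i < n")
    case True
    have *: "i < j \<and> j \<le> r i \<longleftrightarrow> i < j \<and> j \<le> r' i" for j using D(6)[of i j] D'(6)[of i j] c by simp
    show ?thesis using *[of "r i"] *[of "r' i"] sgraph_ge[OF g(1) True] sgraph_ge[OF g'(1) True] by linarith
  qed (use D(3) D'(3) in simp)
  then show ?thesis using c by (simp add: fun_eq_iff)
qed

section \<open>Modules and forbidden induced subgraphs\<close>

lemma sgraph_prime:
  assumes g: "sgraph n r c" and tf: "twinfree n r" and u: "r (r 0) < n - 1"
    and J: "J \<subseteq> {..<n}" "2 \<le> card J"
    and mod: "\<And>x. x \<in> {..<n} - J \<Longrightarrow> (\<forall>y\<in>J. sgraph_adj r x y) \<or> (\<forall>y\<in>J. \<not> sgraph_adj r x y)"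
  shows "J = {..<n}"
proof (rule ccontr)
  assume neq: "J \<noteq> {..<n}"
  note D = sgraphD[OF g]
  have fin: "finite J" using J finite_subset by blast
  have ne: "J \<noteq> {}" using J by auto
  define a where "a = Min J"
  define b where "b = Max J"
  have ab: "a \<in> J" "b \<in> J" "\<And>x. x \<in> J \<Longrightarrow> a \<le> x \<and> x \<le> b" using fin ne by (auto simp: a_def b_def)
  have bn: "b < n" using ab J by auto
  have "a \<noteq> b"
  proof
    assume "a = b"
    then have "x = a" if "x \<in> J" for x using ab(3)[OF that] by simp
    then have "J \<subseteq> {a}" by blast
    then have "card J \<le> card {a}" by (intro card_mono) auto
    then show False using J by simp
  qed
  then have ltab: "a < b" using ab(3)[OF ab(1)] by simp
  have m: "sgraph_adj r x y \<longleftrightarrow> sgraph_adj r x z" if "x < n" "x \<notin> J" "y \<in> J" "z \<in> J" for x y z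
  proof -
    have "x \<in> {..<n} - J" using that by simp
    from mod[OF this] show ?thesis using that(3,4) by (elim disjE) simp_all
  qed
  have mono: "r i \<le> r j" if "i \<le> j" "j < n" for i j using sgraph_mono[OF g that] .
  show False
  proof (cases "b \<le> r a")
    case True
    have sa: "Suc a < n" using ltab bn by simp
    \<comment> \<open>Here \<open>J\<close> is a clique. A vertex that separates \<open>a\<close>
      from \<open>a + 1\<close> lies to the right of \<open>b\<close> or to the left of
      \<open>a\<close>, so outside \<open>J\<close>, and it treats \<open>a\<close> and
      \<open>b\<close> differently.\<close>
    from twinfreeD[OF tf sa] show False
    proof
      assume lt: "r a < r (Suc a)"
      define k where "k = r (Suc a)"
      have k: "b < k" "k < n" using lt True D(2)[OF sa] by (simp_all add: k_def)
      have kJ: "k \<notin> J" using ab(3)[of k] k by auto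
      have "sgraph_adj r k b" using k mono[of "Suc a" b] ltab bn by (auto simp: sgraph_adj_def k_def)
      moreover have "\<not> sgraph_adj r k a" using k lt ltab by (auto simp: sgraph_adj_def k_def)
      ultimately show False using m[OF k(2) kJ ab(1,2)] by simp
    next
      assume "\<exists>k<a. r k = a"
      then obtain k where k: "k < a" "r k = a" by blast
      then have "k \<notin> J" "k < n" using ab(3)[of k] bn ltab by auto
      moreover have "sgraph_adj r k a" "\<not> sgraph_adj r k b" using k ltab by (auto simp: sgraph_adj_def)
      ultimately show False using m[of k a b] ab(1,2) by blast
    qed
  next
    case False
    \<comment> \<open>A neighbour just before \<open>a\<close> would also see \<open>b\<close>, and
      then so would \<open>a\<close>, by monotonicity. The argument at \<open>b\<close> is the
      mirror image.\<close>
    have a0: "a = 0"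
    proof (rule ccontr)
      assume "a \<noteq> 0"
      then obtain x where x: "a = Suc x" by (cases a) auto
      have xn: "Suc x < n" using x ltab bn by simp
      have "x \<notin> J" using ab(3)[of x] x by auto
      moreover have "sgraph_adj r x a" using D(4)[OF xn] x by (auto simp: sgraph_adj_def)
      moreover have "x < n" using xn by simp
      ultimately have "sgraph_adj r x b" using m[of x a b] ab(1,2) by blast
      then have "b \<le> r x" using x ltab by (auto simp: sgraph_adj_def)
      then show False using False mono[of x a] x xn by simp
    qed
    have bl: "Suc b = n"
    proof (rule ccontr)
      assume "Suc b \<noteq> n"
      then have sb: "Suc b < n" using bn by simp
      have "Suc b \<notin> J" using ab(3)[of "Suc b"] by auto
      moreover have "sgraph_adj r (Suc b) b" using D(4)[OF sb] by (auto simp: sgraph_adj_def)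
      ultimately have "sgraph_adj r (Suc b) a" using m[of "Suc b" a b] ab(1,2) sb by blast
      then show False using False ltab by (auto simp: sgraph_adj_def)
    qed
    \<comment> \<open>An outside vertex adjacent to \<open>J\<close> would see both \<open>0\<close>
      and \<open>n - 1\<close>. So nothing leaves \<open>J\<close>, although consecutive vertices
      are adjacent.\<close>
    have nadj: "\<not> sgraph_adj r x y" if x: "x < n" "x \<notin> J" "y \<in> J" for x y
    proof
      assume "sgraph_adj r x y"
      then have "sgraph_adj r x a" "sgraph_adj r x b" using m[OF x(1,2,3)] ab(1,2) by blast+
      moreover have "x \<noteq> a" "x \<noteq> b" using x ab by blast+
      then have "a < x" "x < b" using x(1) bl a0 by linarith+
      ultimately have "x \<le> r 0" "b \<le> r x" using a0 by (auto simp: sgraph_adj_def)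
      then have "b \<le> r (r 0)" using mono[of x "r 0"] D(2)[of 0] bn by simp
      then show False using u bl by simp
    qed
    obtain x where x: "x < n" "x \<notin> J" using neq J(1) by blast
    have "\<exists>i. Suc i < n \<and> i \<in> J \<and> Suc i \<notin> J"
    proof (rule ccontr)
      assume no: "\<not> ?thesis"
      have "i < n \<Longrightarrow> i \<in> J" for i
      proof (induction i)
        case 0 then show ?case using a0 ab(1) by simp
      next
        case (Suc i)
        then have "i \<in> J" by simp
        then show ?case using no Suc.prems by blast
      qed
      then show False using x by simp
    qed
    then obtain i where i: "Suc i < n" "i \<in> J" "Suc i \<notin> J" by blast
    then have "sgraph_adj r (Suc i) i" using D(4)[of i] by (auto simp: sgraph_adj_def)
    then show False using nadj[OF i(1,3,2)] by contradiction
  qed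
qed

lemma represents_lt:
  assumes g: "sgraph n r c" and p: "is_perm p" "length p = n" "represents n c p s" "i < n" "j < n"
    and "s i < s j" "p ! s i < p ! s j"
  shows "i < j" "r i < j"
proof -
  have "i < j \<and> c i j = 0"
    using represents_less[OF p] assms(7,8) by (cases "i < j") auto
  then show "i < j" "r i < j" using sgraphD(6)[OF g, of i j] by auto
qed

lemma represents_inv:
  assumes g: "sgraph n r c" and p: "is_perm p" "length p = n" "represents n c p s" "i < n" "j < n"
    and "s i < s j" "p ! s j < p ! s i"
  shows "sgraph_adj r i j"
proof -
  have "i < j \<and> c i j \<noteq> 0 \<or> j < i \<and> c j i \<noteq> 0"
    using represents_less(1)[OF p] represents_less(2)[OF p(1-3) p(5,4)] assms(7,8) by (cases "i < j") auto
  then show ?thesis using sgraphD(6)[OF g, of i j] sgraphD(6)[OF g, of j i] by (auto simp: sgraph_adj_def)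
qed

lemma sgraph_adj_sym: "sgraph_adj r i j \<longleftrightarrow> sgraph_adj r j i"
  by (auto simp: sgraph_adj_def)

text \<open>A common neighbour of the outer leaves lies on one side of \<open>j\<close>: on the left
  it sees at most as far as \<open>j\<close>, on the right \<open>i\<close> does not reach
  it.\<close>

lemma sgraph_claw:
  assumes g: "sgraph n r c" and "r i < j" "i < j" "r j < k" "j < k" "k < n"
    and "sgraph_adj r i m" "sgraph_adj r k m" "m < n" "m \<noteq> j"
  shows False
proof (cases "m < j")
  case True
  then have "r m \<le> r j" using sgraph_mono[OF g, of m j] assms by simp
  then show False using assms True by (auto simp: sgraph_adj_def)
next
  case False
  then show False using assms by (auto simp: sgraph_adj_def)
qed

lemma sgraph_C4:
  assumes "r i < j" "i < j" "r k < l" "k < l"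
    and "sgraph_adj r i k" "sgraph_adj r i l" "sgraph_adj r j k" "sgraph_adj r j l"
  shows False
proof (cases "i < k")
  case True
  then have "k \<le> r i" using assms(5) by (auto simp: sgraph_adj_def)
  then have "k < j" using assms by simp
  then have "j \<le> r k" using assms(7) by (auto simp: sgraph_adj_def)
  then have "i < l" "j < l" using assms by auto
  then have "l \<le> r i" using assms(6) by (auto simp: sgraph_adj_def)
  then show False using assms \<open>j < l\<close> by simp
next
  case False
  then have "k < i" "i \<le> r k" using assms(5) by (auto simp: sgraph_adj_def)
  then have "l \<le> r i" using assms(6,3) by (auto simp: sgraph_adj_def)
  then have "l < j" "k < j" using assms by auto
  then have "j \<le> r k" using assms(7) by (auto simp: sgraph_adj_def)
  then show False using assms \<open>l < j\<close> by simp
qed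

lemma represents_claw_C4_free:
  assumes g: "sgraph n r c" and p: "is_perm p" "length p = n" "represents n c p s"
  shows "claw_C4_free p"
proof -
  have ex: "\<exists>i<n. s i = x" if "x < n" for x
  proof -
    have "x \<in> s ` {..<n}" using represents_bij(1)[OF p] that by (simp add: bij_betw_def)
    then show ?thesis by auto
  qed
  note lt = represents_lt[OF g p] and inv = represents_inv[OF g p]
  show ?thesis
    unfolding claw_C4_free_iff
  proof (intro conjI notI; elim exE conjE)
    fix a b c d assume o: "a < b" "b < c" "c < d" "d < length p"
    then have "a < n" "b < n" "c < n" "d < n" using p(2) by auto
    then obtain i j k l where i: "i < n" "s i = a" and j: "j < n" "s j = b" and k: "k < n" "s k = c"
        and l: "l < n" "s l = d"
      using ex by metis
    note o = o[folded i(2) j(2) k(2) l(2)]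
    show False if v: "p ! d < p ! a" "p ! a < p ! b" "p ! b < p ! c"
    proof -
      note v = v[folded i(2) j(2) k(2) l(2)]
      have "l \<noteq> j" using o by auto
      then show False
        using sgraph_claw[OF g _ _ _ _ k(1), of i j l] lt[OF i(1) j(1)] lt[OF j(1) k(1)]
          inv[OF i(1) l(1)] inv[OF k(1) l(1)] o v l(1) by linarith
    qed
    show False if v: "p ! b < p ! c" "p ! c < p ! d" "p ! d < p ! a"
    proof -
      note v = v[folded i(2) j(2) k(2) l(2)]
      have "i \<noteq> k" using o by auto
      moreover have "sgraph_adj r j i" "sgraph_adj r l i"
        using inv[OF i(1) j(1)] inv[OF i(1) l(1)] o v sgraph_adj_sym[of r i] by simp_all
      ultimately show False
        using sgraph_claw[OF g _ _ _ _ l(1), of j k i] lt[OF j(1) k(1)] lt[OF k(1) l(1)] o v i(1) by linarith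
    qed
    show False if v: "p ! c < p ! d" "p ! d < p ! a" "p ! a < p ! b"
    proof -
      note v = v[folded i(2) j(2) k(2) l(2)]
      have "sgraph_adj r i k" "sgraph_adj r i l" "sgraph_adj r j k" "sgraph_adj r j l"
        using inv[OF i(1) k(1)] inv[OF i(1) l(1)] inv[OF j(1) k(1)] inv[OF j(1) l(1)] o v by simp_all
      moreover have "i < j" "r i < j" "k < l" "r k < l"
        using lt[OF i(1) j(1)] lt[OF k(1) l(1)] o v by simp_all
      ultimately show False using sgraph_C4[of r i j k l] by simp
    qed
  qed
qed

text \<open>An entry outside an interval is inverted with all entries of the interval or with none,
  so the interval pulls back to a module.\<close>

lemma represents_simple:
  assumes g: "sgraph n r c" and tf: "twinfree n r" and u: "r (r 0) < n - 1"
    and p: "is_perm p" "length p = n" "represents n c p s"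
  shows "simple_perm p"
  unfolding simple_perm_iff[OF p(1)]
proof (intro allI impI)
  fix I assume I: "I \<subseteq> {..<length p}" "2 \<le> card I"
    and sep: "\<forall>x\<in>{..<length p} - I. ((\<forall>y\<in>I. x < y) \<or> (\<forall>y\<in>I. y < x)) \<and> ((\<forall>y\<in>I. p ! x < p ! y)
        \<or> (\<forall>y\<in>I. p ! y < p ! x))"
  note lt = represents_lt[OF g p] and inv = represents_inv[OF g p]
  have s: "inj_on s {..<n}" "s ` {..<n} = {..<n}" using represents_bij(1)[OF p] by (auto simp: bij_betw_def)
  define J where "J = {i \<in> {..<n}. s i \<in> I}"
  have sJ: "s ` J = I"
  proof
    show "I \<subseteq> s ` J"
    proof
      fix x assume "x \<in> I"
      then have "x \<in> s ` {..<n}" using I p(2) s(2) by auto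
      then show "x \<in> s ` J" using \<open>x \<in> I\<close> by (auto simp: J_def)
    qed
  qed (auto simp: J_def)
  have JN: "J \<subseteq> {..<n}" by (auto simp: J_def)
  have "card J = card I" using card_image[OF inj_on_subset[OF s(1) JN]] sJ by simp
  then have cJ: "2 \<le> card J" using I by simp
  have nadj: "\<not> sgraph_adj r i j" if "i < n" "j < n" "s i < s j \<and> p ! s i < p ! s j \<or> s j < s i
      \<and> p ! s j < p ! s i" for i j
    using that lt[of i j] lt[of j i] by (auto simp: sgraph_adj_def)
  have adj: "sgraph_adj r i j" if "i < n" "j < n" "s i < s j \<and> p ! s j < p ! s i \<or> s j < s i
      \<and> p ! s i < p ! s j" for i j
    using that inv[of i j] inv[of j i] sgraph_adj_sym[of r i j] by blast
  have "J = {..<n}"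
  proof (rule sgraph_prime[OF g tf u JN cJ])
    fix i assume i: "i \<in> {..<n} - J"
    then have "s i \<in> {..<length p} - I" using s(2) p(2) by (auto simp: J_def)
    with sep have *: "((\<forall>y\<in>I. s i < y) \<or> (\<forall>y\<in>I. y < s i)) \<and> ((\<forall>y\<in>I. p ! s i < p ! y) \<or> (\<forall>y\<in>I. p ! y < p ! s i))"
      by blast
    have J: "s j \<in> I" "j < n" if "j \<in> J" for j using that by (auto simp: J_def)
    have il: "i < n" using i by simp
    from * consider "\<forall>y\<in>I. s i < y" "\<forall>y\<in>I. p ! s i < p ! y" | "\<forall>y\<in>I. s i < y" "\<forall>y\<in>I. p ! y < p ! s i"
      | "\<forall>y\<in>I. y < s i" "\<forall>y\<in>I. p ! s i < p ! y" | "\<forall>y\<in>I. y < s i" "\<forall>y\<in>I. p ! y < p ! s i" by blast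
    then show "(\<forall>y\<in>J. sgraph_adj r i y) \<or> (\<forall>y\<in>J. \<not> sgraph_adj r i y)"
    proof cases
      case 1
      then have "\<not> sgraph_adj r i j" if "j \<in> J" for j using nadj[OF il J(2)[OF that]] J(1)[OF that] by blast
      then show ?thesis by blast
    next
      case 2
      then have "sgraph_adj r i j" if "j \<in> J" for j using adj[OF il J(2)[OF that]] J(1)[OF that] by blast
      then show ?thesis by blast
    next
      case 3
      then have "sgraph_adj r i j" if "j \<in> J" for j using adj[OF il J(2)[OF that]] J(1)[OF that] by blast
      then show ?thesis by blast
    next
      case 4
      then have "\<not> sgraph_adj r i j" if "j \<in> J" for j using nadj[OF il J(2)[OF that]] J(1)[OF that] by blast
      then show ?thesis by blast
    qed
  qed
  then show "I = {..<length p}" using sJ s(2) p(2) by simp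
qed

section \<open>From permutations to graphs\<close>

definition below :: "nat list \<Rightarrow> nat \<Rightarrow> nat \<Rightarrow> bool" where
  "below p x y \<longleftrightarrow> x < y \<and> p ! x < p ! y"

definition inverted :: "nat list \<Rightarrow> nat \<Rightarrow> nat \<Rightarrow> bool" where
  "inverted p x y \<longleftrightarrow> x < y \<and> p ! y < p ! x \<or> y < x \<and> p ! x < p ! y"

lemma below_trans: "below p x y \<Longrightarrow> below p y z \<Longrightarrow> below p x z"
  by (auto simp: below_def)

lemma inverted_sym: "inverted p x y \<longleftrightarrow> inverted p y x"
  by (auto simp: inverted_def)

lemma below_inverted_cases:
  assumes "is_perm p" "x < length p" "y < length p" "x \<noteq> y"
  shows "below p x y \<or> below p y x \<or> inverted p x y"
proof -
  have "p ! x \<noteq> p ! y" using is_permD(3)[OF assms(1)] assms by (auto simp: inj_on_def)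
  then show ?thesis using assms(4) by (auto simp: below_def inverted_def)
qed

lemma not_below_inverted: "inverted p x y \<Longrightarrow> \<not> below p x y" "inverted p x y \<Longrightarrow> \<not> below p y x"
  by (auto simp: below_def inverted_def)

text \<open>The centre \<open>m\<close> gives \<open>4123\<close> if it lies to the left of the
  chain and \<open>2341\<close> otherwise; its inversion with \<open>y\<close> is automatic. So
  \<open>below\<close> has no suborder 3+1, and by \<open>C4_free\<close> no 2+2: it is a
  semiorder.\<close>

lemma claw_free:
  assumes "claw_C4_free p" "below p x y" "below p y z" "inverted p x m" "inverted p z m"
    and "z < length p" "m < length p"
  shows False
proof (cases "m < x")
  have b: "x < y" "y < z" "p ! x < p ! y" "p ! y < p ! z" using assms(2,3) by (simp_all add: below_def)
  case True
  then have "m < z" using b by simp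
  then have "p ! z < p ! m" using assms(5) by (simp add: inverted_def)
  then have "m < x \<and> x < y \<and> y < z \<and> z < length p \<and> p ! x < p ! y \<and> p ! y < p ! z \<and> p ! z < p ! m"
    using b True assms(6) by simp
  then show False using assms(1)[unfolded claw_C4_free_iff, THEN conjunct2, THEN conjunct1] by blast
next
  have b: "x < y" "y < z" "p ! x < p ! y" "p ! y < p ! z" using assms(2,3) by (simp_all add: below_def)
  case False
  then have x: "x < m" "p ! m < p ! x" using assms(4) by (auto simp: inverted_def)
  then have "p ! m < p ! z" using b by simp
  then have "z < m" using assms(5) by (simp add: inverted_def)
  then have "x < y \<and> y < z \<and> z < m \<and> m < length p \<and> p ! m < p ! x \<and> p ! x < p ! y \<and> p ! y < p ! z"
    using b x assms(7) by simp
  then show False using assms(1)[unfolded claw_C4_free_iff, THEN conjunct1] by blast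
qed

lemma C4_free:
  assumes cf: "claw_C4_free p" and b: "below p a b" "below p c d"
    and i: "inverted p a c" "inverted p a d" "inverted p b c" "inverted p b d"
    and l: "b < length p" "d < length p"
  shows False
proof -
  have False if "a < c" "below p a b" "below p c d" "inverted p a c" "inverted p a d" "inverted p b c"
      "inverted p b d"
    "d < length p" for a b c d
  proof -
    have "p ! c < p ! a" using that by (auto simp: inverted_def)
    have "p ! d < p ! a" "a < d" using that by (auto simp: inverted_def below_def)
    have "b < c"
    proof (rule ccontr)
      assume "\<not> b < c"
      then have "p ! b < p ! c" using that by (auto simp: inverted_def)
      then show False using that(2) \<open>p ! c < p ! a\<close> by (simp add: below_def)
    qed
    then have "a < b \<and> b < c \<and> c < d \<and> d < length p \<and> p ! c < p ! d \<and> p ! d < p ! a \<and> p ! a < p ! b"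
      using that \<open>p ! d < p ! a\<close> by (simp add: below_def)
    then show False using cf[unfolded claw_C4_free_iff, THEN conjunct2, THEN conjunct2] by blast
  qed
  note key = this
  have ii: "inverted p c a" "inverted p d a" "inverted p c b" "inverted p d b"
    using i inverted_sym[of p a] inverted_sym[of p b] by blast+
  show False
  proof (cases "a < c")
    case True
    then show False using key[OF True b i l(2)] by simp
  next
    case False
    then have "c < a" using i(1) by (auto simp: inverted_def)
    then show False using key[OF _ b(2,1) ii(1,3,2,4) l(1)] by simp
  qed
qed

text \<open>For inverted entries, one separating entry decides which of the two comes later
  throughout. A violation on the lower side is a 4-cycle on \<open>w, u\<close> and
  \<open>x, v\<close>; one on the upper side is a claw with leaves \<open>w, u, x\<close> and centre
  \<open>v\<close>.\<close>

lemma nested: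
  assumes P: "is_perm p" and cf: "claw_C4_free p" and uv: "inverted p u v"
    and n: "u < length p" "v < length p" "w < length p" and w: "below p w u" "\<not> below p w v"
  shows "x < length p \<Longrightarrow> below p x v \<Longrightarrow> below p x u" "x < length p \<Longrightarrow> below p u x \<Longrightarrow> below p v x"
proof -
  note cases = below_inverted_cases[OF P]
  have vw: "inverted p w v"
    using cases[OF n(3,2)] w uv below_trans[of p v w u] not_below_inverted[OF uv] by (auto simp: inverted_def)
  show "below p x u" if x: "x < length p" "below p x v"
  proof (rule ccontr)
    assume nx: "\<not> below p x u"
    have "x \<noteq> u" using x not_below_inverted[OF uv] by auto
    then have xu: "inverted p x u"
      using cases[OF x(1) n(1)] nx below_trans[of p u x v] x not_below_inverted[OF uv] by blast
    have "x \<noteq> w" using w x by auto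
    then have xw: "inverted p x w"
      using cases[OF x(1) n(3)] below_trans[of p x w u] below_trans[of p w x v] w x nx by blast
    have "inverted p w x" "inverted p u x" using xw xu inverted_sym[of p x] by blast+
    then show False using C4_free[OF cf w(1) x(2) _ vw _ uv n(1,2)] by blast
  qed
  show "below p v x" if x: "x < length p" "below p u x"
  proof (rule ccontr)
    assume nx: "\<not> below p v x"
    have "x \<noteq> v" using x not_below_inverted[OF uv] by auto
    then have "inverted p x v"
      using cases[OF x(1) n(2)] nx below_trans[of p u x v] x not_below_inverted[OF uv] by blast
    then show False using claw_free[OF cf w(1) x(2) vw] x(1) n(2) by simp
  qed
qed

section \<open>Consequences of simplicity\<close>

text \<open>The positions from \<open>u\<close> to \<open>v\<close> form an interval, hence all of
  \<open>p\<close>. Then \<open>p\<close> begins with its largest entry, and the remaining entries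
  form a proper interval.\<close>

lemma simple_no_twins:
  assumes P: "is_perm p" and s: "simple_perm p" and n: "4 \<le> length p" and uv: "u < v" "v < length p"
      "p ! v < p ! u"
    and D: "\<And>x. x < length p \<Longrightarrow> below p x u \<longleftrightarrow> below p x v"
    and U: "\<And>x. x < length p \<Longrightarrow> below p u x \<longleftrightarrow> below p v x"
  shows False
proof -
  note S = s[unfolded simple_perm_iff[OF P], rule_format]
  have inj: "p ! x \<noteq> p ! y" if "x < length p" "y < length p" "x \<noteq> y" for x y
    using is_permD(3)[OF P] that by (auto simp: inj_on_def)
  have inside: "p ! v \<le> p ! x \<and> p ! x \<le> p ! u" if "u \<le> x" "x \<le> v" for x
  proof -
    have xl: "x < length p" using that uv by simp
    have "\<not> p ! u < p ! x" using U[OF xl] that uv by (auto simp: below_def)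
    moreover have "\<not> p ! x < p ! v" using D[OF xl] that uv by (auto simp: below_def)
    ultimately show ?thesis by simp
  qed
  have outside: "p ! u < p ! x \<or> p ! x < p ! v" if "x < length p" "x < u \<or> v < x" for x
    using D[OF that(1)] U[OF that(1)] that uv inj[of x u] inj[of x v] by (auto simp: below_def)
  have "{u..v} = {..<length p}"
  proof (rule S)
    show "{u..v} \<subseteq> {..<length p}" "2 \<le> card {u..v}" using uv by auto
    fix x assume x: "x \<in> {..<length p} - {u..v}"
    then have "p ! u < p ! x \<or> p ! x < p ! v" using outside[of x] by auto
    then have "(\<forall>y\<in>{u..v}. p ! x < p ! y) \<or> (\<forall>y\<in>{u..v}. p ! y < p ! x)"
      using inside by (meson atLeastAtMost_iff order_le_less_trans order_less_le_trans)
    moreover have "(\<forall>y\<in>{u..v}. x < y) \<or> (\<forall>y\<in>{u..v}. y < x)" using x by auto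
    ultimately show "((\<forall>y\<in>{u..v}. x < y) \<or> (\<forall>y\<in>{u..v}. y < x)) \<and>
      ((\<forall>y\<in>{u..v}. p ! x < p ! y) \<or> (\<forall>y\<in>{u..v}. p ! y < p ! x))" by blast
  qed
  moreover have "0 < length p" using n by linarith
  then have "0 \<in> {..<length p}" "length p - 1 \<in> {..<length p}" by simp_all
  ultimately have "0 \<in> {u..v}" "length p - 1 \<in> {u..v}" by blast+
  then have u0: "u = 0" and v: "Suc v = length p" using uv by auto
  have "{1..v} = {..<length p}"
  proof (rule S)
    show "{1..v} \<subseteq> {..<length p}" "2 \<le> card {1..v}" using v n by auto
    fix x assume x: "x \<in> {..<length p} - {1..v}"
    then have x0: "x = 0" using v by auto
    have "p ! y < p ! x" if "y \<in> {1..v}" for y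
    proof -
      have "0 < length p" using n by linarith
      then have "p ! y \<noteq> p ! 0" using inj[of y 0] that uv by simp
      then show ?thesis using inside[of y] that u0 x0 by simp
    qed
    then show "((\<forall>y\<in>{1..v}. x < y) \<or> (\<forall>y\<in>{1..v}. y < x)) \<and>
      ((\<forall>y\<in>{1..v}. p ! x < p ! y) \<or> (\<forall>y\<in>{1..v}. p ! y < p ! x))" using x0 by auto
  qed
  moreover have "0 < length p" using n by linarith
  then have "0 \<in> {..<length p}" by simp
  ultimately show False by (metis atLeastAtMost_iff not_one_le_zero)
qed

text \<open>All entries to the left of \<open>u\<close> are larger than it and all to the right are
  smaller, so cutting next to \<open>u\<close> gives intervals; the side is chosen to leave at least
  two entries and not all of them.\<close>

lemma simple_no_universal:
  assumes P: "is_perm p" and s: "simple_perm p" and n: "4 \<le> length p" and u: "u < length p"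
    and U: "\<And>x. x < length p \<Longrightarrow> x \<noteq> u \<Longrightarrow> inverted p x u"
  shows False
proof -
  note S = s[unfolded simple_perm_iff[OF P], rule_format]
  have lo: "p ! u < p ! x" if "x < u" for x using U[of x] that u by (auto simp: inverted_def)
  have hi: "p ! x < p ! u" if "u < x" "x < length p" for x using U[of x] that u by (auto simp: inverted_def)
  have sep: "((\<forall>y\<in>I. x < y) \<or> (\<forall>y\<in>I. y < x)) \<and> ((\<forall>y\<in>I. p ! x < p ! y) \<or> (\<forall>y\<in>I. p ! y < p ! x))"
    if "I \<subseteq> {..u} \<and> u < x \<or> I \<subseteq> {u..<length p} \<and> x < u" "x < length p" for I x
    using that
  proof (elim disjE conjE)
    assume a: "I \<subseteq> {..u}" "u < x" "x < length p"
    have "p ! x < p ! y" if "y \<in> I" for y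
      using hi[OF a(2,3)] lo[of y] a(1) that by (cases "y = u") auto
    then show ?thesis using a by auto
  next
    assume a: "I \<subseteq> {u..<length p}" "x < u"
    have "p ! y < p ! x" if "y \<in> I" for y
      using lo[OF a(2)] hi[of y] a(1) that by (cases "y = u") auto
    then show ?thesis using a by auto
  qed
  show False
  proof (cases "2 \<le> u \<or> u = 1")
    case True
    show False
    proof (cases "Suc u = length p")
      case True
      have "{..<u} = {..<length p}"
      proof (rule S)
        fix x assume "x \<in> {..<length p} - {..<u}"
        then have x: "x = u" using True by auto
        show "((\<forall>y\<in>{..<u}. x < y) \<or> (\<forall>y\<in>{..<u}. y < x)) \<and> ((\<forall>y\<in>{..<u}. p ! x < p ! y)
            \<or> (\<forall>y\<in>{..<u}. p ! y < p ! x))"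
          using lo x by auto
      qed (use True n in auto)
      then show False using True by simp
    next
      case False
      have "{..u} = {..<length p}"
      proof (rule S)
        fix x assume "x \<in> {..<length p} - {..u}"
        then show "((\<forall>y\<in>{..u}. x < y) \<or> (\<forall>y\<in>{..u}. y < x)) \<and> ((\<forall>y\<in>{..u}. p ! x < p ! y)
            \<or> (\<forall>y\<in>{..u}. p ! y < p ! x))"
          by (intro sep) auto
      qed (use u \<open>2 \<le> u \<or> u = 1\<close> in auto)
      then have "card {..u} = card {..<length p}" by simp
      then show False using False by simp
    qed
  next
    case False
    then have u0: "u = 0" by auto
    have "{1..<length p} = {..<length p}"
    proof (rule S)
      fix x assume "x \<in> {..<length p} - {1..<length p}"
      then have x: "x = 0" by auto
      show "((\<forall>y\<in>{1..<length p}. x < y) \<or> (\<forall>y\<in>{1..<length p}. y < x)) \<and>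
        ((\<forall>y\<in>{1..<length p}. p ! x < p ! y) \<or> (\<forall>y\<in>{1..<length p}. p ! y < p ! x))"
        using hi x u0 by auto
    qed (use n in auto)
    then have "card {1..<length p} = card {..<length p}" by simp
    then show False using n by simp
  qed
qed

section \<open>Recovering the vertex order\<close>

lemma perm_key:
  assumes P: "is_perm p" and x: "x < length p"
  shows "x + p ! x = Suc (\<Sum>y<length p. (if below p y x then 2 else if inverted p y x then 1 else 0))"
proof -
  have c: "card {y \<in> {..<length p}. Q y} = (\<Sum>y<length p. if Q y then 1 else 0)" for Q
    by (simp add: sum.If_cases Int_def conj_commute)
  have "{1..length p} = {1..<1 + length p}" by auto
  then have "bij_betw ((!) p) {..<length p} {1..<1 + length p}"
    using is_permD(3,4)[OF P] by (simp add: bij_betw_def)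
  from rank_eq[OF this x] have "p ! x = Suc (\<Sum>y<length p. if p ! y < p ! x then 1 else 0)" unfolding c by simp
  moreover have "{y \<in> {..<length p}. y < x} = {..<x}" using x by auto
  then have "x = (\<Sum>y<length p. if y < x then 1 else 0)" unfolding c[symmetric] by simp
  ultimately have "x + p ! x = Suc (\<Sum>y<length p. (if y < x then 1 else 0) + (if p ! y < p ! x then 1 else 0))"
    unfolding sum.distrib by simp
  also have "(\<Sum>y<length p. (if y < x then 1 else 0) + (if p ! y < p ! x then 1 else 0)) =
    (\<Sum>y<length p. (if below p y x then 2 else if inverted p y x then 1 else (0 :: nat)))"
  proof (rule sum.cong)
    fix y assume "y \<in> {..<length p}"
    then have "y \<noteq> x \<Longrightarrow> p ! y \<noteq> p ! x" using is_permD(3)[OF P] x by (auto simp: inj_on_def)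
    then show "(if y < x then 1 else 0) + (if p ! y < p ! x then 1 else 0) =
      (if below p y x then 2 else if inverted p y x then 1 else (0 :: nat))"
      by (auto simp: below_def inverted_def)
  qed simp
  finally show ?thesis .
qed

lemma perm_key_less:
  assumes P: "is_perm p" and n: "u < length p" "v < length p" and uv: "inverted p u v"
    and D: "\<And>x. x < length p \<Longrightarrow> below p x u \<Longrightarrow> below p x v"
    and U: "\<And>x. x < length p \<Longrightarrow> below p v x \<Longrightarrow> below p u x"
    and w: "w < length p" "below p w v \<and> \<not> below p w u \<or> below p u w \<and> \<not> below p v w"
  shows "u + p ! u < v + p ! v"
proof -
  let ?f = "\<lambda>x y. if below p y x then 2 else if inverted p y x then 1 else (0 :: nat)"
  let ?A = "{..<length p} - {u, v}"
  have ne: "u \<noteq> v" using uv by (auto simp: inverted_def)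
  have A: "{..<length p} = insert u (insert v ?A)" using n by auto
  have split: "(\<Sum>y<length p. ?f x y) = ?f x u + (?f x v + (\<Sum>y\<in>?A. ?f x y))" for x
    by (subst A, subst sum.insert) (use ne in auto)
  have irr: "\<not> below p x x" "\<not> inverted p x x" for x by (auto simp: below_def inverted_def)
  note nb = not_below_inverted
  note cases = below_inverted_cases[OF P]
  have "(\<Sum>y\<in>?A. ?f u y) < (\<Sum>y\<in>?A. ?f v y)"
  proof (rule sum_strict_mono_ex1)
    show "\<forall>y\<in>?A. ?f u y \<le> ?f v y"
    proof
      fix y assume y: "y \<in> ?A"
      then have "y < length p" "y \<noteq> v" "y \<noteq> u" by auto
      then show "?f u y \<le> ?f v y"
        using D[of y] U[of y] cases[of y v] cases[of y u] n nb[of p y u] nb[of p y v] by auto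
    qed
    have "w \<in> ?A" using w irr nb[OF uv] by auto
    moreover have "?f u w < ?f v w"
      using w D[of w] U[of w] cases[of w v] cases[of w u] n nb[of p w u] nb[of p w v] \<open>w \<in> ?A\<close>
        below_trans[of p w u w] irr[of w] by auto
    ultimately show "\<exists>y\<in>?A. ?f u y < ?f v y" by blast
  qed simp
  then have "(\<Sum>y<length p. ?f u y) < (\<Sum>y<length p. ?f v y)"
    unfolding split[of u] split[of v] using uv inverted_sym[of p u v] irr nb[OF uv] by auto
  then show ?thesis unfolding perm_key[OF P n(1)] perm_key[OF P n(2)] by simp
qed

lemma enumerate_by_key:
  fixes key :: "nat \<Rightarrow> nat"
  assumes "inj_on key {..<n}"
  obtains s where "bij_betw s {..<n} {..<n}" "\<And>i j. i < j \<Longrightarrow> j < n \<Longrightarrow> key (s i) < key (s j)"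
proof -
  have c: "card (key ` {..<n}) = n" using card_image[OF assms] by simp
  have "finite (key ` {..<n})" by simp
  from ex_bij_betw_strict_mono_card[OF this] obtain h
    where h: "bij_betw h {..<n} (key ` {..<n})" "strict_mono_on {..<n} h" unfolding c by blast
  define s where "s = (\<lambda>i. inv_into {..<n} key (h i))"
  have "bij_betw (inv_into {..<n} key) (key ` {..<n}) {..<n}"
    by (rule bij_betw_inv_into[OF inj_on_imp_bij_betw[OF assms]])
  from bij_betw_trans[OF h(1) this] have "bij_betw s {..<n} {..<n}" by (simp add: s_def comp_def)
  moreover have "key (s i) = h i" if "i < n" for i
    unfolding s_def by (rule f_inv_into_f) (use h(1) that in \<open>auto simp: bij_betw_def\<close>)
  then have "key (s i) < key (s j)" if "i < j" "j < n" for i j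
    using h(2) that by (simp add: strict_mono_on_def)
  ultimately show ?thesis using that by blast
qed

text \<open>The vertices are the entries sorted by position plus value, which respects domination.
  Simplicity enters three times: no twins makes the order strict, indecomposability makes
  consecutive vertices adjacent, and no entry is inverted with all others.\<close>

lemma perm_graph:
  assumes P: "is_perm p" and ln: "length p = n" and n: "4 \<le> n" and sp: "simple_perm p" and cf: "claw_C4_free p"
  obtains r c s where "(r, c) \<in> prime_graphs n" "represents n c p s"
proof -
  define key where "key = (\<lambda>x. x + p ! x)"
  note cases = below_inverted_cases[OF P, unfolded ln]
  have below_key: "key x < key y" if "below p x y" for x y using that by (simp add: key_def below_def)
  have n4: "4 \<le> length p" using n ln by simp
  have sym: "inverted p x y \<Longrightarrow> inverted p y x" for x y using inverted_sym by blast
  \<comment> \<open>one of two inverted entries is dominated by the other, and the key tells which\<close>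
  have dom: "key u < key v \<and> (\<forall>x<n. (below p x u \<longrightarrow> below p x v) \<and> (below p v x \<longrightarrow> below p u x)) \<and>
      (\<exists>x<n. below p x v \<and> \<not> below p x u \<or> below p u x \<and> \<not> below p v x) \<or>
      key v < key u \<and> (\<forall>x<n. (below p x v \<longrightarrow> below p x u) \<and> (below p u x \<longrightarrow> below p v x))"
    if uv: "inverted p u v" "u < n" "v < n" for u v
  proof -
    have vu: "inverted p v u" by (rule sym[OF uv(1)])
    have ex: "\<exists>x<n. below p x u \<noteq> below p x v \<or> below p u x \<noteq> below p v x"
    proof (rule ccontr)
      assume "\<not> ?thesis"
      then have "\<And>x. x < length p \<Longrightarrow> below p x u \<longleftrightarrow> below p x v" "\<And>x. x < length p \<Longrightarrow> below p u x \<longleftrightarrow> below p v x"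
        using ln by auto
      then show False
        using simple_no_twins[OF P sp n4, of u v] simple_no_twins[OF P sp n4, of v u] uv ln
        by (auto simp: inverted_def)
    qed
    show ?thesis
    proof (cases "\<exists>w<n. below p w u \<and> \<not> below p w v \<or> below p v w \<and> \<not> below p u w")
      case True
      then obtain w where w: "w < n" "below p w u \<and> \<not> below p w v \<or> below p v w \<and> \<not> below p u w" by blast
      have N: "(below p x v \<longrightarrow> below p x u) \<and> (below p u x \<longrightarrow> below p v x)" if x: "x < n" for x
      proof (cases "below p w u \<and> \<not> below p w v")
        case True
        then show ?thesis using nested[OF P cf uv(1), of w x] uv w x ln by blast
      next
        case False
        then have a: "below p v w" "\<not> below p u w" using w by auto
        have "\<not> (below p x v \<and> \<not> below p x u)"
        proof
          assume "below p x v \<and> \<not> below p x u"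
          then have "below p v w \<longrightarrow> below p u w" using nested(2)[OF P cf vu, of x w] uv w x ln by blast
          then show False using a by blast
        qed
        moreover have "\<not> (below p u x \<and> \<not> below p v x)"
        proof
          assume b: "below p u x \<and> \<not> below p v x"
          have "inverted p v x"
            using cases[OF uv(3) x] b below_trans[of p u x v] not_below_inverted[OF uv(1)] by blast
          have "inverted p u w"
            using cases[OF uv(2) w(1)] a below_trans[of p v w u] not_below_inverted[OF uv(1)] by blast
          have "x \<noteq> w" using a b by blast
          moreover have "\<not> below p x w" "\<not> below p w x"
            using below_trans[of p u x w] below_trans[of p v w x] a b by blast+
          ultimately have "inverted p x w" using cases[OF x w(1)] by blast
          \<comment> \<open>\<open>u\<close> below \<open>x\<close> and \<open>v\<close> below
            \<open>w\<close>, with all cross pairs inverted, form a 4-cycle.\<close>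
          show False
            by (rule C4_free[OF cf _ a(1), of u x])
              (use b uv \<open>inverted p v x\<close> \<open>inverted p u w\<close> \<open>inverted p x w\<close> sym x w ln in blast)+
        qed
        ultimately show ?thesis by blast
      qed
      have "key v < key u"
        unfolding key_def
        by (rule perm_key_less[OF P _ _ vu, of w]) (use N w uv ln in auto)
      then show ?thesis using N by blast
    next
      case False
      obtain w where w: "w < n" "below p w v \<and> \<not> below p w u \<or> below p u w \<and> \<not> below p v w"
        using ex False by blast
      have "key u < key v"
        unfolding key_def
        by (rule perm_key_less[OF P _ _ uv(1), of w]) (use False w uv ln in auto)
      then show ?thesis using False w by blast
    qed
  qed
  have keyinj: "inj_on key {..<n}"
  proof (rule inj_onI)
    fix x y assume xy: "x \<in> {..<n}" "y \<in> {..<n}" "key x = key y"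
    show "x = y"
    proof (rule ccontr)
      assume "x \<noteq> y"
      then consider "below p x y" | "below p y x" | "inverted p x y" using cases[of x y] xy by auto
      then show False
        using below_key[of x y] below_key[of y x] dom[of x y] xy by cases auto
    qed
  qed
  obtain s where s: "bij_betw s {..<n} {..<n}" "\<And>i j. i < j \<Longrightarrow> j < n \<Longrightarrow> key (s i) < key (s j)"
    using enumerate_by_key[OF keyinj] by blast
  have sn: "s i < n" if "i < n" for i using s(1) that by (auto simp: bij_betw_def)
  have sinj: "s i \<noteq> s j" if "i < n" "j < n" "i \<noteq> j" for i j using s(1) that by (auto simp: bij_betw_def inj_on_def)
  have sur: "\<exists>i<n. x = s i" if "x < n" for x
  proof -
    have "x \<in> s ` {..<n}" using s(1) that by (simp add: bij_betw_def)
    then show ?thesis by auto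
  qed
  have less: "i < j" if "key (s i) < key (s j)" "i < n" "j < n" for i j
    using s(2)[of j i] that by (cases "i = j") (auto simp: not_less intro: ccontr)
  have sdom: "(\<forall>x<n. (below p x (s i) \<longrightarrow> below p x (s j)) \<and> (below p (s j) x \<longrightarrow> below p (s i) x)) \<and>
      (\<exists>x<n. below p x (s j) \<and> \<not> below p x (s i) \<or> below p (s i) x \<and> \<not> below p (s j) x)"
    if "i < j" "j < n" "inverted p (s i) (s j)" for i j
    using dom[OF that(3)] s(2)[OF that(1,2)] sn that by auto
  have nb: "\<not> below p (s j) (s i)" if "i < j" "j < n" for i j
    using s(2)[OF that] below_key[of "s j" "s i"] by auto
  have tri: "below p (s i) (s j) \<or> inverted p (s i) (s j)" if "i < j" "j < n" for i j
    using cases[of "s i" "s j"] sn sinj[of i j] nb[OF that] that by auto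
  \<comment> \<open>Umbrella property: if \<open>s i\<close> were below \<open>s j\<close>, then
    \<open>s j\<close> and \<open>s k\<close> would be inverted, and domination would put
    \<open>s i\<close> below \<open>s k\<close>. The second half is dual.\<close>
  have umb1: "inverted p (s i) (s j)" if "i < j" "j < k" "k < n" "inverted p (s i) (s k)" for i j k
  proof (rule ccontr)
    assume "\<not> ?thesis"
    then have b: "below p (s i) (s j)" using tri[of i j] that by auto
    have "inverted p (s j) (s k)"
      using tri[of j k] that b below_trans[of p "s i" "s j" "s k"] not_below_inverted[OF that(4)] by blast
    then have "below p (s i) (s k)" using sdom[of j k] that b sn[of i] by auto
    then show False using not_below_inverted[OF that(4)] by blast
  qed
  have umb2: "inverted p (s j) (s k)" if "i < j" "j < k" "k < n" "inverted p (s i) (s k)" for i j k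
  proof (rule ccontr)
    assume "\<not> ?thesis"
    then have b: "below p (s j) (s k)" using tri[of j k] that by auto
    have "inverted p (s i) (s j)"
      using tri[of i j] that b below_trans[of p "s i" "s j" "s k"] not_below_inverted[OF that(4)] by auto
    then have "below p (s i) (s k)" using sdom[of i j] that b sn[of k] by auto
    then show False using not_below_inverted[OF that(4)] by blast
  qed
  \<comment> \<open>By the umbrella property a missing edge puts all entries up to \<open>i\<close>
    below all later ones. The lower block is then an interval; for \<open>i = 0\<close> it is a
    single entry, and the upper block is used.\<close>
  have conn: "inverted p (s i) (s (Suc i))" if i: "Suc i < n" for i
  proof (rule ccontr)
    assume na: "\<not> ?thesis"
    have b: "below p (s a) (s b)" if "a \<le> i" "i < b" "b < n" for a b
    proof (rule ccontr)
      assume "\<not> ?thesis"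
      then have "inverted p (s a) (s b)" using tri[of a b] that by auto
      then have "inverted p (s i) (s b)" using umb2[of a i b] that by (cases "a = i") auto
      then have "inverted p (s i) (s (Suc i))" using umb1[of i "Suc i" b] that by (cases "b = Suc i") auto
      then show False using na by blast
    qed
    note S = sp[unfolded simple_perm_iff[OF P], rule_format, unfolded ln]
    have img: "s ` A \<subseteq> {..<n}" "card (s ` A) = card A" if "A \<subseteq> {..<n}" for A
    proof -
      show "s ` A \<subseteq> {..<n}" using sn that by auto
      show "card (s ` A) = card A"
        by (rule card_image[OF inj_on_subset[of s "{..<n}"]]) (use s(1) that in \<open>auto simp: bij_betw_def\<close>)
    qed
    show False
    proof (cases "1 \<le> i")
      case True
      have sub: "{..i} \<subseteq> {..<n}" using i by auto
      have "s ` {..i} = {..<n}"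
      proof (rule S)
        show "s ` {..i} \<subseteq> {..<n}" "2 \<le> card (s ` {..i})" using img[OF sub] True by auto
        fix x assume x: "x \<in> {..<n} - s ` {..i}"
        then obtain k where k: "k < n" "x = s k" using sur by auto
        then have "i < k" using x by (meson DiffD2 atMost_iff image_eqI not_le)
        then have "below p y x" if "y \<in> s ` {..i}" for y using b[of _ k] k that by auto
        then show "((\<forall>y\<in>s ` {..i}. x < y) \<or> (\<forall>y\<in>s ` {..i}. y < x)) \<and>
          ((\<forall>y\<in>s ` {..i}. p ! x < p ! y) \<or> (\<forall>y\<in>s ` {..i}. p ! y < p ! x))"
          by (simp add: below_def)
      qed
      then have "card {..i} = n" using img(2)[OF sub] by simp
      then show False using i by simp
    next
      case False
      then have i0: "i = 0" by simp
      have sub: "{1..<n} \<subseteq> {..<n}" by auto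
      have "s ` {1..<n} = {..<n}"
      proof (rule S)
        show "s ` {1..<n} \<subseteq> {..<n}" "2 \<le> card (s ` {1..<n})" using img[OF sub] n by auto
        fix x assume x: "x \<in> {..<n} - s ` {1..<n}"
        then obtain k where k: "k < n" "x = s k" using sur by auto
        then have "k = 0" using x by (cases k) auto
        then have "below p x y" if "y \<in> s ` {1..<n}" for y using b[of 0] i0 k that by auto
        then show "((\<forall>y\<in>s ` {1..<n}. x < y) \<or> (\<forall>y\<in>s ` {1..<n}. y < x)) \<and>
          ((\<forall>y\<in>s ` {1..<n}. p ! x < p ! y) \<or> (\<forall>y\<in>s ` {1..<n}. p ! y < p ! x))"
          by (simp add: below_def)
      qed
      then have "card {1..<n} = n" using img(2)[OF sub] by simp
      then show False using n by simp
    qed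
  qed
  define c :: "nat \<Rightarrow> nat \<Rightarrow> int" where
    "c i j = (if i < j \<and> j < n \<and> inverted p (s i) (s j) then (if s i < s j then 1 else - 1) else 0)" for i j
  \<comment> \<open>Including \<open>i\<close> itself keeps the set nonempty for the last
    vertex.\<close>
  define r where "r i = (if i < n then Max {j. j = i \<or> c i j \<noteq> 0} else 0)" for i
  have c0: "c i j \<noteq> 0 \<longleftrightarrow> i < j \<and> j < n \<and> inverted p (s i) (s j)" for i j by (simp add: c_def)
  have fin: "finite {j. j = i \<or> c i j \<noteq> 0}" if "i < n" for i
    by (rule finite_subset[of _ "{..<n}"]) (use c0 that in auto)
  have rin: "r i = i \<or> c i (r i) \<noteq> 0" if "i < n" for i
    using Max_in[OF fin[OF that]] that by (auto simp: r_def)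
  have rmax: "j \<le> r i" if "i < n" "c i j \<noteq> 0" for i j
    using Max_ge[OF fin[OF that(1)], of j] that by (simp add: r_def)
  have adj: "c i j \<noteq> 0 \<longleftrightarrow> i < j \<and> j \<le> r i" for i j
  proof
    assume a: "c i j \<noteq> 0"
    then show "i < j \<and> j \<le> r i" using c0 rmax[of i j] by auto
  next
    assume a: "i < j \<and> j \<le> r i"
    then have "i < n" by (auto simp: r_def split: if_splits)
    then have "c i (r i) \<noteq> 0" using rin[of i] a by auto
    then have "r i < n" "inverted p (s i) (s (r i))" using c0 by auto
    then show "c i j \<noteq> 0" using umb1[of i j "r i"] a c0 by (cases "j = r i") auto
  qed
  have rn: "r i < n" if "i < n" for i using rin[OF that] c0[of i "r i"] that by auto
  have below_r: "below p (s i) (s j)" if "r i < j" "i < j" "j < n" for i j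
    using tri[of i j] adj[of i j] c0[of i j] that by auto
  have g: "sgraph n r c"
    unfolding sgraph_def
  proof (intro conjI allI impI)
    fix i assume i: "Suc i < n"
    then have "c i (Suc i) \<noteq> 0" using conn c0 by auto
    then show ir: "i < r i" using adj by auto
    show "r i \<le> r (Suc i)"
    proof (cases "r i = Suc i")
      case True
      then show ?thesis using rin[OF i] adj[of "Suc i" "r (Suc i)"] by auto
    next
      case False
      then have "Suc i < r i" "c i (r i) \<noteq> 0" using ir rin[of i] i by auto
      then have "inverted p (s (Suc i)) (s (r i))" using umb2[of i "Suc i" "r i"] c0[of i "r i"] by auto
      then show ?thesis using rmax[of "Suc i" "r i"] i c0 \<open>Suc i < r i\<close> rn[of i] by auto
    qed
  next
    fix i j k assume a: "i < j" "j \<le> r i" "r i < k" "k \<le> r j"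
    have ij: "c i j \<noteq> 0" using adj[of i j] a by simp
    have jk: "c j k \<noteq> 0" using adj[of j k] a by simp
    have "below p (s i) (s k)" using below_r[of i k] a jk c0[of j k] by auto
    then show "c j k = - c i j"
      using ij jk by (auto simp: c_def below_def inverted_def split: if_splits)
  next
    fix i j k assume a: "i < j" "j < k" "k \<le> r i" "c i j = c j k"
    have "c i j \<noteq> 0" using a(1-3) adj[of i j] by simp
    moreover have "c i k \<noteq> 0" using a(1-3) adj[of i k] by simp
    moreover have "c j k \<noteq> 0" using a(4) \<open>c i j \<noteq> 0\<close> by simp
    moreover have v: "c x y = (if s x < s y then 1 else - 1)" if "c x y \<noteq> 0" for x y
      using that by (simp add: c_def split: if_splits)
    ultimately have "c i j = (if s i < s j then 1 else - 1)" "c j k = (if s j < s k then 1 else - 1)"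
      "c i k = (if s i < s k then 1 else - 1)" by blast+
    moreover have "s i \<noteq> s j" "s j \<noteq> s k" "s i \<noteq> s k"
      using sinj[of i j] sinj[of j k] sinj[of i k] a(1,2) c0[of j k] \<open>c j k \<noteq> 0\<close> by auto
    ultimately show "c i k = c i j" using a(4) by (simp split: if_splits)
  next
    fix i j
    show "c i j \<in> {-1, 0, 1}" by (simp add: c_def)
    show "c i j \<noteq> 0 \<longleftrightarrow> i < j \<and> j \<le> r i" by (rule adj)
  next
    show "0 < n" using n by simp
    fix i
    show "i < n \<Longrightarrow> r i < n" by (rule rn)
    show "n \<le> i \<Longrightarrow> r i = 0" by (simp add: r_def)
  qed
  moreover have "twinfree n r"
    unfolding twinfree_def
  proof (intro allI impI)
    fix i assume i: "Suc i < n"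
    \<comment> \<open>An entry that makes the domination strict separates the two vertices; its
      place before or after them decides the alternative of \<open>twinfree\<close>.\<close>
    have "\<exists>x<n. below p x (s (Suc i)) \<and> \<not> below p x (s i) \<or> below p (s i) x \<and> \<not> below p (s (Suc i)) x"
      using sdom[of i "Suc i"] conn[OF i] i by blast
    then obtain k where k: "k < n" "below p (s k) (s (Suc i)) \<and> \<not> below p (s k) (s i)
        \<or> below p (s i) (s k) \<and> \<not> below p (s (Suc i)) (s k)"
      using sur by blast
    have ni: "\<not> below p (s i) (s (Suc i))" using not_below_inverted[OF conn[OF i]] by blast
    have irr: "\<not> below p x x" for x by (simp add: below_def)
    from k(2) show "r i < r (Suc i) \<or> (\<exists>k<i. r k = i)"
    proof
      assume a: "below p (s k) (s (Suc i)) \<and> \<not> below p (s k) (s i)"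
      have "k < Suc i" using less[OF below_key[OF conjunct1[OF a]]] k i by auto
      moreover have "k \<noteq> i" using a ni by blast
      ultimately have ki: "k < i" by simp
      then have "inverted p (s k) (s i)" using tri[of k i] a i by auto
      then have "c k i \<noteq> 0" using c0 ki i by auto
      moreover have "c k (Suc i) = 0" using c0[of k "Suc i"] a not_below_inverted(1) by blast
      ultimately have "r k = i" using adj[of k i] adj[of k "Suc i"] ki by auto
      then show ?thesis using ki by blast
    next
      assume a: "below p (s i) (s k) \<and> \<not> below p (s (Suc i)) (s k)"
      have "i < k" using less[OF below_key[OF conjunct1[OF a]]] k i by auto
      moreover have "k \<noteq> Suc i" using a ni by blast
      ultimately have ki: "Suc i < k" by simp
      then have "inverted p (s (Suc i)) (s k)" using tri[of "Suc i" k] a k by auto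
      then have "c (Suc i) k \<noteq> 0" using c0 ki k by auto
      moreover have "c i k = 0" using c0[of i k] a not_below_inverted(1) by blast
      ultimately have "r i < k" "k \<le> r (Suc i)" using adj[of i k] adj[of "Suc i" k] ki by auto
      then show ?thesis by simp
    qed
  qed
  moreover have "r (r 0) < n - 1"
  proof (rule ccontr)
    assume "\<not> ?thesis"
    then have rr: "r (r 0) = n - 1" using rn[of "r 0"] rn[of 0] n by simp
    define u where "u = r 0"
    have un: "u < n" using rn[of 0] n u_def by simp
    have "inverted p (s j) (s u)" if "j < n" "j \<noteq> u" for j
    proof (cases "j < u")
      case True
      have "u \<le> r j" using sgraph_mono[OF g, of 0 j] that u_def by simp
      then show ?thesis using adj[of j u] c0[of j u] True by auto
    next
      case False
      then have "u < j" "j \<le> r u" using that rr u_def by auto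
      then show ?thesis using adj[of u j] c0[of u j] sym by auto
    qed
    then have "inverted p x (s u)" if "x < length p" "x \<noteq> s u" for x
      using sur[of x] that ln by auto
    then show False using simple_no_universal[OF P sp n4, of "s u"] sn[OF un] ln by auto
  qed
  ultimately have "(r, c) \<in> prime_graphs n" by (simp add: prime_graphs_def)
  moreover have "represents n c p s"
    unfolding represents_def
  proof (intro conjI allI impI)
    fix i j assume ij: "i < j" "j < n"
    from tri[OF ij] show "s i < s j \<longleftrightarrow> 0 \<le> c i j" "p ! s i < p ! s j \<longleftrightarrow> c i j \<le> 0"
      using ij by (auto simp: c_def below_def inverted_def)
  qed (rule s(1))
  ultimately show ?thesis using that by blast
qed

section \<open>The generating function\<close>

text \<open>Each prime graph is represented by exactly one permutation and each permutation of the
  class by exactly one prime graph.\<close>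

lemma card_simple_claw_C4_free:
  assumes n: "4 \<le> n"
  shows "card {p. simple_perm p \<and> claw_C4_free p \<and> length p = n} = card (prime_graphs n)"
proof -
  let ?S = "{p. simple_perm p \<and> claw_C4_free p \<and> length p = n}"
  define R where "R x p \<longleftrightarrow> is_perm p \<and> length p = n \<and> (\<exists>s. represents n (snd x) p s)"
    for x :: "(nat \<Rightarrow> nat) \<times> (nat \<Rightarrow> nat \<Rightarrow> int)" and p
  define f where "f x = (SOME p. R x p)" for x
  have P: "sgraph n r c" "twinfree n r" "r (r 0) < n - 1" if "(r, c) \<in> prime_graphs n" for r c
    using that by (auto simp: prime_graphs_def)
  have Rf: "R x (f x)" if "x \<in> prime_graphs n" for x
  proof -
    obtain r c where x: "x = (r, c)" by (metis surj_pair)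
    have "sgraph n r c" using P(1) \<open>x \<in> prime_graphs n\<close> x by blast
    from represents_exists[OF this] obtain p s where "is_perm p" "length p = n" "represents n c p s" by blast
    then have "R x p" using x by (auto simp: R_def)
    then show ?thesis unfolding f_def by (rule someI)
  qed
  have uniq: "p = p'" if "R x p" "R x p'" for x p p'
    using that represents_perm_unique[of p n "snd x" _ p'] unfolding R_def by blast
  have "inj_on f (prime_graphs n)"
  proof (rule inj_onI)
    fix x y assume xy: "x \<in> prime_graphs n" "y \<in> prime_graphs n" "f x = f y"
    obtain r c r' c' where x: "x = (r, c)" "y = (r', c')" by (metis surj_pair)
    obtain s s' where s: "is_perm (f x)" "length (f x) = n" "represents n c (f x) s" "represents n c' (f x) s'"
      using Rf[OF xy(1)] Rf[OF xy(2)] x xy(3) by (auto simp: R_def)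
    note px = P[OF xy(1)[unfolded x]] and py = P[OF xy(2)[unfolded x]]
    show "x = y" using represents_graph_unique[OF px(1,2) py(1,2) s] x by simp
  qed
  moreover have "f ` prime_graphs n = ?S"
  proof (intro equalityI subsetI)
    fix p assume "p \<in> f ` prime_graphs n"
    then obtain x where x: "x \<in> prime_graphs n" "p = f x" by blast
    obtain r c where rc: "x = (r, c)" by (metis surj_pair)
    obtain s where s: "is_perm p" "length p = n" "represents n c p s" using Rf[OF x(1)] x(2) rc
        by (auto simp: R_def)
    note p = P[OF x(1)[unfolded rc]]
    show "p \<in> ?S" using represents_simple[OF p s] represents_claw_C4_free[OF p(1) s] s(2) by simp
  next
    fix p assume p: "p \<in> ?S"
    then have ip: "is_perm p" by (simp add: simple_perm_def)
    obtain r c s where rc: "(r, c) \<in> prime_graphs n" "represents n c p s" using perm_graph[OF ip _ n] p by blast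
    then have "R (r, c) p" using ip p by (auto simp: R_def)
    then have "p = f (r, c)" using uniq Rf[OF rc(1)] by blast
    then show "p \<in> f ` prime_graphs n" using rc(1) by blast
  qed
  ultimately show ?thesis using card_image by fastforce
qed

section \<open>From the recurrences to the rational function\<close>

lemma half_graphs_rec:
  assumes "3 \<le> n"
  shows "card (half_graphs (Suc n) 1) = card (half_graphs n 1) + card (mono_graphs (n - 2) 1)"
proof -
  have "(\<Sum>k\<in>{3..<Suc n}. card (mono_graphs (Suc n - k) 1))
      = card (mono_graphs (n - 2) 1) + (\<Sum>k\<in>{Suc 3..<Suc n}. card (mono_graphs (Suc n - k) 1))"
    using assms by (subst sum.atLeast_Suc_lessThan) auto
  also have "(\<Sum>k\<in>{Suc 3..<Suc n}. card (mono_graphs (Suc n - k) 1)) = (\<Sum>k\<in>{3..<n}. card (mono_graphs (n - k) 1))"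
    by (subst sum.shift_bounds_Suc_ivl) simp
  finally show ?thesis by (simp add: card_half_graphs)
qed

text \<open>The factor \<open>1 - fps_X ^ 2\<close> annihilates the correction, which has period
  two, and the other factor annihilates \<open>q\<close> and \<open>h\<close>, up to initial terms
  that make up the numerator.\<close>

lemma linear_recurrence:
  fixes f q h :: "nat \<Rightarrow> rat"
  assumes q0: "q 1 = 1" "q 2 = 0" and q: "\<And>n. 3 \<le> n \<Longrightarrow> q n = q (n - 1) + q (n - 2) + h (n - 1)"
    and h0: "\<And>n. n \<le> 3 \<Longrightarrow> h n = 0" and h: "\<And>n. 3 \<le> n \<Longrightarrow> h (Suc n) = h n + q (n - 2)"
    and f0: "\<And>n. n < 4 \<Longrightarrow> f n = 0" and f: "\<And>n. 4 \<le> n \<Longrightarrow> f n = 2 * (q n + h n - 1 - (if odd n then 1 else 0))"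
  shows "Abs_fps f * ((1 - fps_X ^ 2) * (1 - 2 * fps_X + fps_X ^ 3 - fps_X ^ 4))
      = 2 * (fps_X ^ 4 + fps_X ^ 6 + fps_X ^ 9)"
proof -
  let ?F = "Abs_fps f"
  have D: "(1 - fps_X ^ 2) * (1 - 2 * fps_X + fps_X ^ 3 - fps_X ^ 4) =
    1 - 2 * fps_X ^ 1 - fps_X ^ 2 + 3 * fps_X ^ 3 - fps_X ^ 4 - fps_X ^ 5 + (fps_X ^ 6 :: rat fps)"
    by (simp add: algebra_simps flip: power_add) (simp add: power_numeral_reduce algebra_simps)
  \<comment> \<open>The denominator has degree \<open>6\<close> and the formula for \<open>f\<close>
    holds from \<open>4\<close> on, so the coefficients up to \<open>9\<close> are computed
    directly.\<close>
  have vals: "q 3 = 1" "q 4 = 1" "q 5 = 3" "q 6 = 5" "q 7 = 10" "q 8 = 18" "q 9 = 34"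
    "h 3 = 0" "h 4 = 1" "h 5 = 1" "h 6 = 2" "h 7 = 3" "h 8 = 6" "h 9 = 11"
  proof -
    show h3: "h 3 = 0" using h0 by simp
    show h4: "h 4 = 1" using h[of 3] h3 q0 by simp
    show q3: "q 3 = 1" using q[of 3] q0 h0[of 2] by simp
    show q4: "q 4 = 1" using q[of 4] q0 q3 h3 by simp
    show h5: "h 5 = 1" using h[of 4] h4 q0 by simp
    show q5: "q 5 = 3" using q[of 5] q4 q3 h4 by simp
    show h6: "h 6 = 2" using h[of 5] h5 q3 by simp
    show q6: "q 6 = 5" using q[of 6] q4 q5 h5 by simp
    show h7: "h 7 = 3" using h[of 6] h6 q4 by simp
    show q7: "q 7 = 10" using q[of 7] q6 q5 h6 by simp
    show h8: "h 8 = 6" using h[of 7] h7 q5 by simp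
    show q8: "q 8 = 18" using q[of 8] q6 q7 h7 by simp
    show h9: "h 9 = 11" using h[of 8] h8 q6 by simp
    show q9: "q 9 = 34" using q[of 9] q8 q7 h8 by simp
  qed
  have S: "fps_nth (?F * fps_X ^ k) n = (if n < k then 0 else f (n - k))" for k n
    by (simp add: fps_X_power_mult_right_nth)
  have "?F * ((1 - fps_X ^ 2) * (1 - 2 * fps_X + fps_X ^ 3 - fps_X ^ 4)) =
    ?F * fps_X ^ 0 - fps_const 2 * (?F * fps_X ^ 1) - ?F * fps_X ^ 2 + fps_const 3 * (?F * fps_X ^ 3)
      - ?F * fps_X ^ 4 - ?F * fps_X ^ 5 + ?F * fps_X ^ 6"
    unfolding D by (simp add: algebra_simps numeral_fps_const)
  also have "\<dots> = fps_const 2 * fps_X ^ 4 + fps_const 2 * fps_X ^ 6 + fps_const 2 * fps_X ^ 9" (is "?L = ?R")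
  proof (rule fps_ext)
    fix n
    have L: "fps_nth ?L n = f n - 2 * (if n < 1 then 0 else f (n - 1)) - (if n < 2 then 0 else f (n - 2))
      + 3 * (if n < 3 then 0 else f (n - 3)) - (if n < 4 then 0 else f (n - 4))
      - (if n < 5 then 0 else f (n - 5)) + (if n < 6 then 0 else f (n - 6))"
      unfolding fps_add_nth fps_sub_nth fps_mult_left_const_nth S by simp
    have R: "fps_nth ?R n = (if n = 4 then 2 else 0) + (if n = 6 then 2 else 0) + (if n = 9 then 2 else 0)"
      by simp
    have "n = 0 \<or> n = 1 \<or> n = 2 \<or> n = 3 \<or> n = 4 \<or> n = 5 \<or> n = 6 \<or> n = 7 \<or> n = 8 \<or> n = 9 \<or> 10 \<le> n"
      by presburger
    then consider "n = 0" | "n = 1" | "n = 2" | "n = 3" | "n = 4" | "n = 5" | "n = 6" | "n = 7" | "n = 8"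
        | "n = 9" | "10 \<le> n"
      by blast
    then show "fps_nth ?L n = fps_nth ?R n"
    proof cases
      case 11
      then obtain m where m: "n = m + 10" by (metis add.commute le_Suc_ex)
      \<comment> \<open>The parity of \<open>m\<close> fixes that of every index
        \<open>m + k\<close>: the correction is \<open>1 + d\<close> for even \<open>k\<close> and
        \<open>2 - d\<close> for odd \<open>k\<close>, which makes the identity linear.\<close>
      define d where "d = (if odd m then 1 else 0 :: rat)"
      have Q: "q (m + k) = q (m + (k - 1)) + q (m + (k - 2)) + h (m + (k - 1))" if "3 \<le> k" for k
        using q[of "m + k"] that by simp
      have H: "h (m + Suc k) = h (m + k) + q (m + (k - 2))" if "3 \<le> k" for k
        using h[of "m + k"] that by simp
      have f0: "f (m + k) = 2 * (q (m + k) + h (m + k) - 1 - d)" if "4 \<le> k" "even k" for k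
        using f[of "m + k"] that by (simp add: d_def)
      have f1: "f (m + k) = 2 * (q (m + k) + h (m + k) - 2 + d)" if "4 \<le> k" "odd k" for k
        using f[of "m + k"] that by (simp add: d_def)
      have "f (m + 10) - 2 * f (m + 9) - f (m + 8) + 3 * f (m + 7) - f (m + 6) - f (m + 5) + f (m + 4) = 0"
        using Q[of 10] Q[of 9] Q[of 8] Q[of 7] Q[of 6] Q[of 5] H[of 9] H[of 8] H[of 7] H[of 6] H[of 5] H[of 4]
          f0[of 10] f1[of 9] f0[of 8] f1[of 7] f0[of 6] f1[of 5] f0[of 4]
        by simp
      moreover have "n - 1 = m + 9" "n - 2 = m + 8" "n - 3 = m + 7" "n - 4 = m + 6" "n - 5 = m + 5" "n - 6 = m + 4"
        using m by auto
      ultimately show ?thesis unfolding L R using 11 by (simp add: m[symmetric])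
    qed (unfold L R, simp_all add: f f0 vals)
  qed
  also have "\<dots> = 2 * (fps_X ^ 4 + fps_X ^ 6 + fps_X ^ 9)"
    by (simp add: algebra_simps numeral_fps_const)
  finally show ?thesis .
qed

theorem theorem10:
  shows "length_gf {\<sigma>. simple_perm \<sigma> \<and> length \<sigma> \<ge> 4 \<and>
                        avoids \<sigma> [2,3,4,1] \<and> avoids \<sigma> [4,1,2,3] \<and> avoids \<sigma> [3,4,1,2]}
         = 2 * (fps_X ^ 4 + fps_X ^ 6 + fps_X ^ 9)
           / ((1 - fps_X ^ 2) * (1 - 2 * fps_X + fps_X ^ 3 - fps_X ^ 4))"
proof -
  let ?C = "{\<sigma>. simple_perm \<sigma> \<and> length \<sigma> \<ge> 4 \<and>
                        avoids \<sigma> [2,3,4,1] \<and> avoids \<sigma> [4,1,2,3] \<and> avoids \<sigma> [3,4,1,2]}"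
  let ?D = "(1 - fps_X ^ 2) * (1 - 2 * fps_X + fps_X ^ 3 - fps_X ^ 4) :: rat fps"
  define f where "f n = (of_nat (card {p \<in> ?C. length p = n}) :: rat)" for n
  define q where "q n = (of_nat (card (mono_graphs n 1)) :: rat)" for n
  define h where "h n = (of_nat (card (half_graphs n 1)) :: rat)" for n
  have eq: "Abs_fps f * ?D = 2 * (fps_X ^ 4 + fps_X ^ 6 + fps_X ^ 9)"
  proof (rule linear_recurrence[where q = q and h = h])
    show "q 1 = 1" "q 2 = 0" using mono_graphs_1[of 1] mono_graphs_2 by (simp_all add: q_def)
    fix n
    show "q n = q (n - 1) + q (n - 2) + h (n - 1)" if "3 \<le> n"
      using card_mono_graphs_rec[of 1 n] card_mono_graphs_sign[of "-1"] that by (simp add: q_def h_def)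
    show "h n = 0" if "n \<le> 3" using that by (simp add: h_def card_half_graphs)
    show "h (Suc n) = h n + q (n - 2)" if "3 \<le> n" using half_graphs_rec[OF that] by (simp add: q_def h_def)
    show "f n = 0" if "n < 4"
    proof -
      have e: "{p \<in> ?C. length p = n} = {}" using that by auto
      show ?thesis unfolding f_def e by simp
    qed
    show "f n = 2 * (q n + h n - 1 - (if odd n then 1 else 0))" if n: "4 \<le> n"
    proof -
      have "{p \<in> ?C. length p = n} = {p. simple_perm p \<and> claw_C4_free p \<and> length p = n}"
        using n by (auto simp: claw_C4_free_def)
      then have "f n = of_nat (card (prime_graphs n))" unfolding f_def card_simple_claw_C4_free[OF n, symmetric] by simp
      also have "\<dots> = of_int (int (card (prime_graphs n)))" by simp
      also have "\<dots> = 2 * (q n + h n - 1 - (if odd n then 1 else 0))"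
        unfolding card_prime_graphs[OF n] by (simp add: q_def h_def)
      finally show ?thesis .
    qed
  qed
  have lg: "length_gf ?C = Abs_fps f" unfolding length_gf_def f_def ..
  have D0: "?D \<noteq> 0"
  proof -
    have "fps_nth ?D 0 = 1" by simp
    then show ?thesis by (metis fps_zero_nth zero_neq_one)
  qed
  show ?thesis
    unfolding lg eq[symmetric] by (rule nonzero_mult_div_cancel_right[OF D0, symmetric])
qed

end
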